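(* Let $G$ be a finitely generated virtually nilpotent group, and let $M$ be a sequence of probability measures on $G$ that measures index uniformly. Then an equation $\varphi$ over $G$ is a probabilistic identity with respect to $M$ if and only if it is a coset identity.
   Context: Groups are discrete. Write $F_k$ for the free group on generators $x_1,\ldots,x_k$. An equation in $k$ variables over $G$ is a word $\varphi\in F_k\ast G$ (free product), viewed as a function $G^k\to G$ by letting $\varphi(g_1,\ldots,g_k)$ be the element of $G$ obtained by replacing each instance of $x_i$ in $\varphi$ by $g_i$. For a probability measure $\mu$ on $G$, $\mathrm{d}\varphi_\mu(G)$ is the probability that $\varphi(g_1,\ldots,g_k)=1$ when $g_1,\ldots,g_k$ are chosen independently according to $\mu$. For a sequence $M=(\mu_n)_{n=1}^\infty$ of probability measures, $\mathrm{d}\varphi_M(G)=\limsup_{n\to\infty}\mathrm{d}\varphi_{\mu_n}(G)$. An equation $\varphi$ in $k$ variables over $G$ is a probabilistic identity with respect to $M$ if $\mathrm{d}\varphi_M(G)>0$. It is a coset identity if there exist a finite-index subgroup $H\le G$ and elements $g_1,\ldots,g_k\in G$ such that $\varphi(g_1H,\ldots,g_kH)=1$, i.e. $\varphi(y_1,\ldots,y_k)=1$ for all $y_i\in g_iH$. The sequence $M$ measures index uniformly if $\mu_n(xH)\to1/[G:H]$ as $n\to\infty$, uniformly over all $x\in G$ and all subgroups $H$ of $G$, where $1/[G:H]=0$ if $[G:H]=\infty$. *)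

theory Defs
  imports "HOL-Probability.Probability" "HOL-Algebra.Left_Coset" "HOL-Algebra.Generated_Groups"
begin

datatype 'a letter = Var nat | VarInv nat | Const 'a

definition words :: "('a, 'b) monoid_scheme \<Rightarrow> nat \<Rightarrow> 'a letter list set" where
  "words G k = lists (Var ` {..<k} \<union> VarInv ` {..<k} \<union> Const ` carrier G)"

text \<open>The free product of the free group on \<open>x\<^sub>1, \<dots>, x\<^sub>k\<close> with \<open>G\<close> is presented as the words in the
  letters \<open>x\<^sub>i\<close>, their inverses and the elements of \<open>G\<close>, modulo free cancellation and the
  multiplication table of \<open>G\<close>. The variables \<open>x\<^sub>1, \<dots>, x\<^sub>k\<close> are \<open>Var 0, \<dots>, Var (k - 1)\<close>.\<close>

inductive word_eq :: "('a, 'b) monoid_scheme \<Rightarrow> nat \<Rightarrow> 'a letter list \<Rightarrow> 'a letter list \<Rightarrow> bool"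
  for G (structure) and k where
  cancel_right: "i < k \<Longrightarrow> word_eq G k [Var i, VarInv i] []"
| cancel_left: "i < k \<Longrightarrow> word_eq G k [VarInv i, Var i] []"
| const_one: "word_eq G k [Const \<one>] []"
| const_mult: "a \<in> carrier G \<Longrightarrow> b \<in> carrier G \<Longrightarrow> word_eq G k [Const a, Const b] [Const (a \<otimes> b)]"
| refl: "w \<in> words G k \<Longrightarrow> word_eq G k w w"
| sym: "word_eq G k u v \<Longrightarrow> word_eq G k v u"
| trans: "word_eq G k u v \<Longrightarrow> word_eq G k v w \<Longrightarrow> word_eq G k u w"
| append: "word_eq G k u v \<Longrightarrow> word_eq G k u' v' \<Longrightarrow> word_eq G k (u @ u') (v @ v')"

definition word_rel :: "('a, 'b) monoid_scheme \<Rightarrow> nat \<Rightarrow> 'a letter list rel" where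
  "word_rel G k = {(u, v). word_eq G k u v}"

definition free_prod :: "('a, 'b) monoid_scheme \<Rightarrow> nat \<Rightarrow> 'a letter list set monoid" where
  "free_prod G k =
    \<lparr>carrier = words G k // word_rel G k,
     monoid.mult = (\<lambda>X Y. \<Union>u\<in>X. \<Union>v\<in>Y. word_rel G k `` {u @ v}),
     one = word_rel G k `` {[]}\<rparr>"

fun eval_letter :: "('a, 'b) monoid_scheme \<Rightarrow> (nat \<Rightarrow> 'a) \<Rightarrow> 'a letter \<Rightarrow> 'a" where
  "eval_letter G g (Var i) = g i"
| "eval_letter G g (VarInv i) = inv\<^bsub>G\<^esub> g i"
| "eval_letter G g (Const a) = a"

definition eval_word :: "('a, 'b) monoid_scheme \<Rightarrow> (nat \<Rightarrow> 'a) \<Rightarrow> 'a letter list \<Rightarrow> 'a" where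
  "eval_word G g w = foldr (\<lambda>l a. eval_letter G g l \<otimes>\<^bsub>G\<^esub> a) w \<one>\<^bsub>G\<^esub>"

text \<open>All representatives of a class have the same value; see \<open>eval_eqn_class\<close> below.\<close>

definition eval_eqn :: "('a, 'b) monoid_scheme \<Rightarrow> 'a letter list set \<Rightarrow> (nat \<Rightarrow> 'a) \<Rightarrow> 'a" where
  "eval_eqn G \<phi> g = the_elem (eval_word G g ` \<phi>)"

lemma append_in_words_iff [simp]: "u @ v \<in> words G k \<longleftrightarrow> u \<in> words G k \<and> v \<in> words G k"
  by (auto simp: words_def)

lemma Nil_in_words [simp]: "[] \<in> words G k"
  by (simp add: words_def)

lemma word_eq_in_words:
  assumes "group G" "word_eq G k u v"
  shows "u \<in> words G k \<and> v \<in> words G k"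
proof -
  interpret group G by fact
  show ?thesis using assms(2) by induction (auto simp: words_def)
qed

lemma equiv_word_rel:
  assumes "group G"
  shows "equiv (words G k) (word_rel G k)"
proof (rule equivI)
  show "word_rel G k \<subseteq> words G k \<times> words G k"
    using word_eq_in_words[OF assms] by (auto simp: word_rel_def)
  show "refl_on (words G k) (word_rel G k)"
    using word_eq_in_words[OF assms] by (auto simp: word_rel_def refl_on_def intro: word_eq.refl)
  show "sym (word_rel G k)"
    by (rule symI) (simp add: word_rel_def, rule word_eq.sym)
  show "trans (word_rel G k)"
    by (rule transI) (simp add: word_rel_def, rule word_eq.trans)
qed

lemma free_prod_mult_class:
  assumes "group G" "u \<in> words G k" "v \<in> words G k"
  shows "(word_rel G k `` {u}) \<otimes>\<^bsub>free_prod G k\<^esub> (word_rel G k `` {v}) = word_rel G k `` {u @ v}"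
proof -
  have "word_rel G k `` {u' @ v'} = word_rel G k `` {u @ v}"
    if "(u, u') \<in> word_rel G k" "(v, v') \<in> word_rel G k" for u' v'
  proof (rule equiv_class_eq[OF equiv_word_rel[OF assms(1)], symmetric])
    show "(u @ v, u' @ v') \<in> word_rel G k"
      using that by (simp add: word_rel_def word_eq.append)
  qed
  moreover have "u \<in> word_rel G k `` {u}" "v \<in> word_rel G k `` {v}"
    using assms by (simp_all add: word_rel_def word_eq.refl)
  ultimately have "(\<Union>u'\<in>word_rel G k `` {u}. \<Union>v'\<in>word_rel G k `` {v}. word_rel G k `` {u' @ v'})
      = word_rel G k `` {u @ v}"
    by blast
  then show ?thesis by (simp add: free_prod_def)
qed

lemma word_left_inverse:
  assumes "group G" "w \<in> words G k"
  shows "\<exists>v\<in>words G k. word_eq G k (v @ w) []"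
  using assms(2)
proof (induction w)
  case Nil
  show ?case by (auto intro!: bexI[of _ "[]"] word_eq.refl)
next
  case (Cons l w)
  interpret group G by fact
  have "[l] \<in> words G k" "w \<in> words G k" using Cons.prems by (auto simp: words_def)
  then obtain v where v: "v \<in> words G k" "word_eq G k (v @ w) []" using Cons.IH by blast
  obtain l' where l': "[l'] \<in> words G k" "word_eq G k [l', l] []"
  proof (cases l)
    case (Const a)
    have "a \<in> carrier G" using \<open>[l] \<in> words G k\<close> Const by (auto simp: words_def)
    then have "word_eq G k [Const (inv\<^bsub>G\<^esub> a), Const a] []"
      using word_eq.trans[OF word_eq.const_mult[of "inv\<^bsub>G\<^esub> a" G a k]] word_eq.const_one[of G k]
      by simp
    then show ?thesis using that[of "Const (inv\<^bsub>G\<^esub> a)"] Const \<open>a \<in> carrier G\<close>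
      by (auto simp: words_def)
  next
    case (Var i)
    then show ?thesis using that[of "VarInv i"] \<open>[l] \<in> words G k\<close>
      by (auto simp: words_def intro: word_eq.cancel_left)
  next
    case (VarInv i)
    then show ?thesis using that[of "Var i"] \<open>[l] \<in> words G k\<close>
      by (auto simp: words_def intro: word_eq.cancel_right)
  qed
  have "word_eq G k (v @ ([l', l] @ w)) (v @ ([] @ w))"
    using v l' \<open>w \<in> words G k\<close> by (intro word_eq.append word_eq.refl)
  then have "word_eq G k ((v @ [l']) @ l # w) []"
    using word_eq.trans[OF _ v(2)] by simp
  then show ?case using v l' by (intro bexI[of _ "v @ [l']"]) auto
qed

lemma group_free_prod:
  assumes "group G"
  shows "group (free_prod G k)"
proof (rule groupI)
  let ?F = "free_prod G k" and ?c = "\<lambda>w. word_rel G k `` {w}"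
  have carr: "X \<in> carrier ?F \<longleftrightarrow> (\<exists>w\<in>words G k. X = ?c w)" for X
    by (auto simp: free_prod_def quotient_def)
  have one: "\<one>\<^bsub>?F\<^esub> = ?c []" by (simp add: free_prod_def)
  note mult = free_prod_mult_class[OF assms]
  show "\<one>\<^bsub>?F\<^esub> \<in> carrier ?F" by (auto simp: carr one intro!: bexI[of _ "[]"])
  fix X assume "X \<in> carrier ?F"
  then obtain u where u: "u \<in> words G k" "X = ?c u" by (auto simp: carr)
  show "\<one>\<^bsub>?F\<^esub> \<otimes>\<^bsub>?F\<^esub> X = X" using u by (simp add: one mult)
  obtain v where v: "v \<in> words G k" "word_eq G k (v @ u) []"
    using word_left_inverse[OF assms u(1)] by blast
  have "?c v \<otimes>\<^bsub>?F\<^esub> X = \<one>\<^bsub>?F\<^esub>"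
    using u v equiv_class_eq[OF equiv_word_rel[OF assms], of "v @ u" "[]" k]
    by (simp add: one mult) (simp add: word_rel_def)
  then show "\<exists>Y\<in>carrier ?F. Y \<otimes>\<^bsub>?F\<^esub> X = \<one>\<^bsub>?F\<^esub>" using v(1) by (intro bexI[of _ "?c v"]) (auto simp: carr)
  fix Y assume "Y \<in> carrier ?F"
  then obtain v where v: "v \<in> words G k" "Y = ?c v" by (auto simp: carr)
  show "X \<otimes>\<^bsub>?F\<^esub> Y \<in> carrier ?F"
    using u v by (auto simp: mult carr intro!: bexI[of _ "u @ v"])
  fix Z assume "Z \<in> carrier ?F"
  then obtain w where w: "w \<in> words G k" "Z = ?c w" by (auto simp: carr)
  show "X \<otimes>\<^bsub>?F\<^esub> Y \<otimes>\<^bsub>?F\<^esub> Z = X \<otimes>\<^bsub>?F\<^esub> (Y \<otimes>\<^bsub>?F\<^esub> Z)"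
    using u v w by (simp add: mult)
qed

lemma eval_word_closed:
  assumes "group G" "w \<in> words G k" "\<And>i. i < k \<Longrightarrow> g i \<in> carrier G"
  shows "eval_word G g w \<in> carrier G"
proof -
  interpret group G by fact
  show ?thesis using assms(2,3) by (induction w) (auto simp: words_def eval_word_def)
qed

lemma eval_word_append:
  assumes "group G" "u \<in> words G k" "v \<in> words G k" "\<And>i. i < k \<Longrightarrow> g i \<in> carrier G"
  shows "eval_word G g (u @ v) = eval_word G g u \<otimes>\<^bsub>G\<^esub> eval_word G g v"
proof -
  interpret group G by fact
  have v: "eval_word G g v \<in> carrier G" using eval_word_closed assms by blast
  show ?thesis using assms(2)
  proof (induction u)
    case Nil
    then show ?case using v by (simp add: eval_word_def)
  next
    case (Cons l u)
    have "u \<in> words G k" using Cons.prems by (auto simp: words_def)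
    moreover from this have "eval_word G g u \<in> carrier G" using eval_word_closed assms by blast
    moreover have "eval_letter G g l \<in> carrier G" using Cons.prems assms(4) by (auto simp: words_def)
    ultimately show ?case using Cons.IH v by (simp add: eval_word_def m_assoc)
  qed
qed

lemma eval_word_cong:
  assumes "group G" "word_eq G k u v" "\<And>i. i < k \<Longrightarrow> g i \<in> carrier G"
  shows "eval_word G g u = eval_word G g v"
proof -
  interpret group G by fact
  show ?thesis using assms(2)
  proof induction
    case (append u v u' v')
    have "u \<in> words G k" "v \<in> words G k" "u' \<in> words G k" "v' \<in> words G k"
      using word_eq_in_words[OF assms(1) append.hyps(1)] word_eq_in_words[OF assms(1) append.hyps(2)]
      by simp_all
    then have "eval_word G g (u @ u') = eval_word G g u \<otimes>\<^bsub>G\<^esub> eval_word G g u'"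
      "eval_word G g (v @ v') = eval_word G g v \<otimes>\<^bsub>G\<^esub> eval_word G g v'"
      using eval_word_append[OF assms(1) _ _ assms(3)] by simp_all
    then show ?case using append.IH by simp
  qed (simp_all add: eval_word_def assms(3))
qed

lemma eval_eqn_class:
  assumes "group G" "w \<in> words G k" "\<And>i. i < k \<Longrightarrow> g i \<in> carrier G"
  shows "eval_eqn G (word_rel G k `` {w}) g = eval_word G g w"
proof -
  have "w \<in> word_rel G k `` {w}"
    using assms(2) by (simp add: word_rel_def word_eq.refl)
  moreover have "eval_word G g v = eval_word G g w" if "v \<in> word_rel G k `` {w}" for v
    using that eval_word_cong[OF assms(1) _ assms(3), of k w v] by (simp add: word_rel_def)
  ultimately have "eval_word G g ` (word_rel G k `` {w}) = {eval_word G g w}"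
    by blast
  then show ?thesis by (simp add: eval_eqn_def)
qed

definition finitely_generated :: "('a, 'b) monoid_scheme \<Rightarrow> bool" where
  "finitely_generated G \<longleftrightarrow> (\<exists>S. finite S \<and> S \<subseteq> carrier G \<and> generate G S = carrier G)"

fun lower_central :: "('a, 'b) monoid_scheme \<Rightarrow> nat \<Rightarrow> 'a set" where
  "lower_central G 0 = carrier G"
| "lower_central G (Suc n) =
    generate G (\<Union>a\<in>lower_central G n. \<Union>b\<in>carrier G.
      {a \<otimes>\<^bsub>G\<^esub> b \<otimes>\<^bsub>G\<^esub> inv\<^bsub>G\<^esub> a \<otimes>\<^bsub>G\<^esub> inv\<^bsub>G\<^esub> b})"

definition nilpotent_group :: "('a, 'b) monoid_scheme \<Rightarrow> bool" where
  "nilpotent_group G \<longleftrightarrow> group G \<and> (\<exists>n. lower_central G n = {\<one>\<^bsub>G\<^esub>})"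

definition finite_index_subgroup :: "'a set \<Rightarrow> ('a, 'b) monoid_scheme \<Rightarrow> bool" where
  "finite_index_subgroup H G \<longleftrightarrow> subgroup H G \<and> finite (lcosets\<^bsub>G\<^esub> H)"

definition virtually_nilpotent :: "('a, 'b) monoid_scheme \<Rightarrow> bool" where
  "virtually_nilpotent G \<longleftrightarrow>
    (\<exists>H. finite_index_subgroup H G \<and> nilpotent_group (G\<lparr>carrier := H\<rparr>))"

definition prob_measure_on :: "('a, 'b) monoid_scheme \<Rightarrow> 'a measure \<Rightarrow> bool" where
  "prob_measure_on G \<mu> \<longleftrightarrow> prob_space \<mu> \<and> space \<mu> = carrier G \<and> sets \<mu> = Pow (carrier G)"

definition inverse_index :: "('a, 'b) monoid_scheme \<Rightarrow> 'a set \<Rightarrow> real" where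
  "inverse_index G H =
    (if finite (lcosets\<^bsub>G\<^esub> H) then 1 / real (card (lcosets\<^bsub>G\<^esub> H)) else 0)"

definition measures_index_uniformly ::
    "('a, 'b) monoid_scheme \<Rightarrow> (nat \<Rightarrow> 'a measure) \<Rightarrow> bool" where
  "measures_index_uniformly G M \<longleftrightarrow>
    uniform_limit (carrier G \<times> {H. subgroup H G})
      (\<lambda>n (x, H). measure (M n) (x <#\<^bsub>G\<^esub> H)) (\<lambda>(x, H). inverse_index G H) sequentially"

text \<open>The solution set below is measurable whenever \<open>G\<close> is countable (e.g. finitely generated).\<close>

definition eqn_prob ::
    "('a, 'b) monoid_scheme \<Rightarrow> nat \<Rightarrow> 'a letter list set \<Rightarrow> 'a measure \<Rightarrow> real" where
  "eqn_prob G k \<phi> \<mu> =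
    measure (\<Pi>\<^sub>M i\<in>{..<k}. \<mu>) {g \<in> space (\<Pi>\<^sub>M i\<in>{..<k}. \<mu>). eval_eqn G \<phi> g = \<one>\<^bsub>G\<^esub>}"

definition eqn_limsup ::
    "('a, 'b) monoid_scheme \<Rightarrow> nat \<Rightarrow> 'a letter list set \<Rightarrow> (nat \<Rightarrow> 'a measure) \<Rightarrow> ereal" where
  "eqn_limsup G k \<phi> M = limsup (\<lambda>n. ereal (eqn_prob G k \<phi> (M n)))"

definition probabilistic_identity ::
    "('a, 'b) monoid_scheme \<Rightarrow> nat \<Rightarrow> 'a letter list set \<Rightarrow> (nat \<Rightarrow> 'a measure) \<Rightarrow> bool" where
  "probabilistic_identity G k \<phi> M \<longleftrightarrow> eqn_limsup G k \<phi> M > 0"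

definition coset_identity :: "('a, 'b) monoid_scheme \<Rightarrow> nat \<Rightarrow> 'a letter list set \<Rightarrow> bool" where
  "coset_identity G k \<phi> \<longleftrightarrow>
    (\<exists>H g. finite_index_subgroup H G \<and> (\<forall>i<k. g i \<in> carrier G) \<and>
      (\<forall>y. (\<forall>i<k. y i \<in> g i <#\<^bsub>G\<^esub> H) \<longrightarrow> eval_eqn G \<phi> y = \<one>\<^bsub>G\<^esub>))"

end

theory Submission
  imports Defs "HOL-Algebra.Product_Groups" "HOL-Computational_Algebra.Computational_Algebra"
begin

text \<open>Let \<open>N\<close> be a nilpotent normal subgroup of finite index. On a coset of \<open>N\<^sup>k\<close> the equation becomes a map
  \<open>f\<close> from \<open>N\<^sup>k\<close> to \<open>G\<close>, and \<open>f\<close> is polynomial in the sense of Leibman: with respect to a filtration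
  \<open>G \<ge> N \<ge> \<dots> \<ge> 1\<close>, iterated differences \<open>y \<mapsto> f(y)\<inverse> f(y h)\<close> descend the filtration. If \<open>f\<close> is \<open>1\<close> on
  a set of positive upper density, then one descends the filtration as well: modulo the next term,
  \<open>f\<close> is a polynomial map \<open>P\<close> to a finitely generated abelian group, and it suffices to show that
  \<open>P\<close> vanishes on some coset of a subgroup of finite index that still meets the set in positive density.

  For integer-valued \<open>P \<noteq> 0\<close> this does not occur at all: on a line \<open>y h\<^sup>n\<close> along which \<open>P\<close> has degree
  \<open>i\<close> there are at most \<open>i\<close> zeros modulo \<open>p\<close> among \<open>p\<close> consecutive \<open>n\<close>, so the density of the zeros
  modulo \<open>p\<close> tends to \<open>0\<close> with \<open>p \<rightarrow> \<infinity>\<close>; and \<open>P mod p\<close> is periodic with respect to a subgroup of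
  finite index, so that only the measures of cosets matter. In general this shows that every integer-valued
  character kills \<open>P\<close>, so \<open>P\<close> takes values in a finite group and is itself periodic.\<close>

text \<open>The obstacle is that the measures need not be invariant: density is controlled only
  through cosets of subgroups of finite index. The zero set of an integer-valued polynomial map need
  not be a union of such cosets, but the larger zero set modulo \<open>p\<close> is one, and right
  multiplication permuting the cosets of a normal subgroup then takes the place of invariance. The
  descent must keep zeros of the original map in sight, since zeros modulo the next term may be far
  more numerous. Hence a set \<open>S\<close> of true zeros with positive density is handed down,
  and not the zero set of \<open>P\<close>. The top term of the filtration is all of
  \<open>G\<close> because the constants of the equation need not lie in \<open>N\<close>. As
  \<open>G\<close> over \<open>N\<close> need not be abelian, the descent can only start at
  \<open>N\<close>; taking a solution as base point of the coset makes \<open>f\<close> trivial at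
  the unit and so brings all its values into \<open>N\<close>. Coordinates on \<open>N\<close> are
  avoided throughout: degree means iterated differences, finite generation of the shrinking domains
  is Schreier's lemma, and torsion appears as the common kernel of the integer-valued
  characters.\<close>

section \<open>Subgroups of finite index\<close>

context group
begin

lemma inv_mult_cancel [simp]:
  assumes "a \<in> carrier G" "x \<in> carrier G"
  shows "inv a \<otimes> (a \<otimes> x) = x" "a \<otimes> (inv a \<otimes> x) = x"
  using assms by (simp_all add: m_assoc[symmetric])

lemmas word_simps = m_assoc inv_mult_group

lemma lcoset_eq_iff:
  assumes "subgroup H G" "a \<in> carrier G" "b \<in> carrier G"
  shows "a <# H = b <# H \<longleftrightarrow> inv a \<otimes> b \<in> H"
proof -
  interpret H: subgroup H G by fact
  show ?thesis
    using assms H.lcos_module_imp[OF is_group, of a b] H.lcos_module_rev[OF is_group, of a b]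
      lcos_self[of b H] l_repr_independence[of b a H] by auto
qed

text \<open>The left coset of \<open>K\<close> containing \<open>a\<close> is determined by the
  coset of \<open>H\<close> containing \<open>a\<close> and the \<open>f\<close>-value of what
  remains of \<open>a\<close> once a fixed representative of that coset is stripped off. There are
  finitely many such pairs.\<close>

lemma finite_index_subgroup_in:
  assumes "finite_index_subgroup H G" "subgroup K G" "K \<subseteq> H" "finite (f ` H)"
    and f: "\<And>a b. a \<in> H \<Longrightarrow> b \<in> H \<Longrightarrow> f a = f b \<Longrightarrow> inv a \<otimes> b \<in> K"
  shows "finite_index_subgroup K G"
proof -
  have H: "subgroup H G" and fin: "finite (lcosets H)"
    using assms(1) by (auto simp: finite_index_subgroup_def)
  interpret H: subgroup H G by fact
  interpret K: subgroup K G by fact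
  have lc: "lcosets H = (\<lambda>a. a <# H) ` carrier G" "lcosets K = (\<lambda>a. a <# K) ` carrier G"
    by (auto simp: LCOSETS_def)
  define r where "r c = (SOME x. x \<in> carrier G \<and> x <# H = c)" for c
  have r: "r (a <# H) \<in> carrier G \<and> r (a <# H) <# H = a <# H" if "a \<in> carrier G" for a
    unfolding r_def by (rule someI[of _ a]) (use that in auto)
  have rH: "inv (r (a <# H)) \<otimes> a \<in> H" if "a \<in> carrier G" for a
    using r[OF that] lcoset_eq_iff[OF H, of "r (a <# H)" a] that by auto
  define F where "F a = (a <# H, f (inv (r (a <# H)) \<otimes> a))" for a
  have "F ` carrier G \<subseteq> (lcosets H) \<times> f ` H"
    using rH by (auto simp: F_def lc)
  then have finF: "finite (F ` carrier G)"
    by (rule finite_subset) (use fin assms(4) in auto)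
  define g where "g v = (SOME x. x \<in> carrier G \<and> F x = v)" for v
  have "a <# K \<in> (\<lambda>v. g v <# K) ` F ` carrier G" if a: "a \<in> carrier G" for a
  proof -
    have g: "g (F a) \<in> carrier G \<and> F (g (F a)) = F a"
      unfolding g_def by (rule someI[of _ a]) (use a in auto)
    define b where "b = g (F a)"
    have b: "b \<in> carrier G" "b <# H = a <# H" "f (inv (r (a <# H)) \<otimes> b) = f (inv (r (a <# H)) \<otimes> a)"
      using g by (auto simp: F_def b_def)
    have "inv (inv (r (a <# H)) \<otimes> b) \<otimes> (inv (r (a <# H)) \<otimes> a) \<in> K"
      using f[OF _ _ b(3)] rH[OF a] rH[OF b(1)] b(2) by simp
    then have "inv b \<otimes> a \<in> K"
      using r[OF a] a b(1) by (simp add: word_simps)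
    then have "b <# K = a <# K" using lcoset_eq_iff[OF assms(2) b(1) a] by simp
    then show ?thesis using a by (auto simp: b_def)
  qed
  then have "lcosets K \<subseteq> (\<lambda>v. g v <# K) ` F ` carrier G" by (auto simp: lc)
  then have "finite (lcosets K)" using finF finite_surj by blast
  then show ?thesis using assms(2) by (simp add: finite_index_subgroup_def)
qed

lemma finite_index_carrier: "finite_index_subgroup (carrier G) G"
proof -
  have "a <# carrier G = carrier G" if "a \<in> carrier G" for a
    using that lcoset_eq_iff[OF subgroup_self that one_closed] coset_mult_one
    by (simp add: lcos_mult_one)
  then have "lcosets (carrier G) \<subseteq> {carrier G}" by (auto simp: LCOSETS_def)
  then show ?thesis by (auto simp: finite_index_subgroup_def subgroup_self dest: finite_subset)
qed

lemma finite_index_subgroupI: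
  assumes "subgroup K G" "finite (f ` carrier G)"
    and "\<And>a b. a \<in> carrier G \<Longrightarrow> b \<in> carrier G \<Longrightarrow> f a = f b \<Longrightarrow> inv a \<otimes> b \<in> K"
  shows "finite_index_subgroup K G"
  by (rule finite_index_subgroup_in[OF finite_index_carrier assms(1) _ assms(2)])
    (use assms(1,3) in \<open>auto dest: subgroup.subset\<close>)

text \<open>The tuple of cosets separates the cosets of the intersection. The set is cut out of
  \<open>carrier G\<close>, so that the empty family gives the whole group.\<close>

lemma finite_index_INT:
  assumes "finite I" "\<And>i. i \<in> I \<Longrightarrow> finite_index_subgroup (H i) G"
  shows "finite_index_subgroup ({a \<in> carrier G. \<forall>i\<in>I. a \<in> H i}) G"
proof (rule finite_index_subgroupI[where f = "\<lambda>a. \<lambda>i\<in>I. a <# H i"])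
  have H: "subgroup (H i) G" "finite (lcosets (H i))" if "i \<in> I" for i
    using assms(2)[OF that] by (auto simp: finite_index_subgroup_def)
  show "subgroup {a \<in> carrier G. \<forall>i\<in>I. a \<in> H i} G"
    by (rule subgroupI)
      (use H in \<open>auto intro: subgroup.one_closed subgroup.m_closed subgroup.m_inv_closed\<close>)
  have "(\<lambda>a. \<lambda>i\<in>I. a <# H i) ` carrier G \<subseteq> (\<Pi>\<^sub>E i\<in>I. lcosets (H i))"
    by (auto simp: LCOSETS_def)
  then show "finite ((\<lambda>a. \<lambda>i\<in>I. a <# H i) ` carrier G)"
    by (rule finite_subset) (use assms H in \<open>auto intro: finite_PiE\<close>)
  fix a b assume ab: "a \<in> carrier G" "b \<in> carrier G" "(\<lambda>i\<in>I. a <# H i) = (\<lambda>i\<in>I. b <# H i)"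
  then have "a <# H i = b <# H i" if "i \<in> I" for i
    using that by (metis restrict_apply')
  then show "inv a \<otimes> b \<in> {a \<in> carrier G. \<forall>i\<in>I. a \<in> H i}"
    using ab lcoset_eq_iff[OF H(1)] by auto
qed

text \<open>The intersection of all conjugates of \<open>H\<close> is the kernel of the action of
  \<open>G\<close> on the left cosets of \<open>H\<close>. These are finitely many, so only finitely
  many permutations occur.\<close>

lemma finite_index_normal_core:
  assumes "finite_index_subgroup H G"
  obtains K where "K \<subseteq> H" "K \<lhd> G" "finite_index_subgroup K G"
proof
  have H: "subgroup H G" "finite (lcosets H)"
    using assms by (auto simp: finite_index_subgroup_def)
  interpret H: subgroup H G by fact
  define K where "K = {k \<in> carrier G. \<forall>a\<in>carrier G. inv a \<otimes> k \<otimes> a \<in> H}"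
  show "K \<subseteq> H"
  proof
    fix k assume "k \<in> K"
    then have "k \<in> carrier G" "inv \<one> \<otimes> k \<otimes> \<one> \<in> H" unfolding K_def by blast+
    then show "k \<in> H" by simp
  qed
  have sub: "subgroup K G"
  proof (rule subgroupI)
    show "K \<noteq> {}" by (auto simp: K_def intro: exI[of _ \<one>])
    fix k assume k: "k \<in> K"
    have "inv a \<otimes> inv k \<otimes> a \<in> H" if a: "a \<in> carrier G" for a
    proof -
      have "inv a \<otimes> inv k \<otimes> a = inv (inv a \<otimes> k \<otimes> a)"
        using a k by (simp add: K_def inv_mult_group m_assoc)
      then show ?thesis using k a by (simp add: K_def)
    qed
    then show "inv k \<in> K" using k by (auto simp: K_def)
    fix l assume l: "l \<in> K"
    have "inv a \<otimes> (k \<otimes> l) \<otimes> a \<in> H" if a: "a \<in> carrier G" for a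
    proof -
      have "inv a \<otimes> (k \<otimes> l) \<otimes> a = (inv a \<otimes> k \<otimes> a) \<otimes> (inv a \<otimes> l \<otimes> a)"
        using a k l by (simp add: K_def m_assoc)
      then show ?thesis using k l a by (simp add: K_def)
    qed
    then show "k \<otimes> l \<in> K" using k l by (auto simp: K_def)
  qed (auto simp: K_def)
  show "K \<lhd> G"
  proof (rule normal_invI[OF sub])
    fix x k assume x: "x \<in> carrier G" and k: "k \<in> K"
    have "inv a \<otimes> (x \<otimes> k \<otimes> inv x) \<otimes> a \<in> H" if a: "a \<in> carrier G" for a
    proof -
      have "inv a \<otimes> (x \<otimes> k \<otimes> inv x) \<otimes> a = inv (inv x \<otimes> a) \<otimes> k \<otimes> (inv x \<otimes> a)"
        using a x k by (simp add: K_def m_assoc inv_mult_group)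
      then show ?thesis using k a x by (simp add: K_def)
    qed
    then show "x \<otimes> k \<otimes> inv x \<in> K" using x k by (auto simp: K_def)
  qed
  show "finite_index_subgroup K G"
  proof (rule finite_index_subgroupI[OF sub, where f = "\<lambda>g. \<lambda>c\<in>lcosets H. g <# c"])
    have c: "g <# (a <# H) = (g \<otimes> a) <# H" if "g \<in> carrier G" "a \<in> carrier G" for g a
      using that by (simp add: lcos_m_assoc H.subset)
    have "(\<lambda>g. \<lambda>c\<in>lcosets H. g <# c) ` carrier G \<subseteq> (\<Pi>\<^sub>E c\<in>lcosets H. lcosets H)"
      by (auto simp: LCOSETS_def c intro!: bexI[OF _ m_closed])
    then show "finite ((\<lambda>g. \<lambda>c\<in>lcosets H. g <# c) ` carrier G)"
      by (rule finite_subset) (use H in \<open>auto intro: finite_PiE\<close>)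
    fix g h assume gh: "g \<in> carrier G" "h \<in> carrier G"
      and eq: "(\<lambda>c\<in>lcosets H. g <# c) = (\<lambda>c\<in>lcosets H. h <# c)"
    have "inv a \<otimes> (inv g \<otimes> h) \<otimes> a \<in> H" if a: "a \<in> carrier G" for a
    proof -
      have "a <# H \<in> lcosets H" using a by (auto simp: LCOSETS_def)
      then have "g <# (a <# H) = h <# (a <# H)" using fun_cong[OF eq, of "a <# H"] by simp
      then have "inv (g \<otimes> a) \<otimes> (h \<otimes> a) \<in> H"
        using c gh a lcoset_eq_iff[OF H(1), of "g \<otimes> a" "h \<otimes> a"] by simp
      then show ?thesis using gh a by (simp add: inv_mult_group m_assoc)
    qed
    then show "inv g \<otimes> h \<in> K" using gh by (simp add: K_def)
  qed
qed

lemma finite_index_transversal: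
  assumes "finite_index_subgroup H G"
  obtains R where "finite R" "R \<subseteq> carrier G" "carrier G = (\<Union>r\<in>R. r <# H)"
proof -
  have H: "subgroup H G" "finite (lcosets H)"
    using assms by (auto simp: finite_index_subgroup_def)
  have "lcosets H = (\<lambda>a. a <# H) ` carrier G" by (auto simp: LCOSETS_def)
  then obtain R where R: "R \<subseteq> carrier G" "finite R" "lcosets H = (\<lambda>a. a <# H) ` R"
    using finite_subset_image[OF H(2), of "\<lambda>a. a <# H" "carrier G"] by blast
  then have "carrier G = (\<Union>r\<in>R. r <# H)"
    using lcosets_part_G[OF H(1)] by simp
  then show ?thesis using that[OF R(2,1)] by blast
qed

text \<open>Schreier's lemma. Products of an element generated by \<open>U\<close> with a
  representative in \<open>T\<close> absorb right multiplication by generators, hence exhaust the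
  group; if such a product lies in \<open>H\<close>, then so does its representative, which is then
  in \<open>U\<close>.\<close>

lemma finite_index_finitely_generated:
  assumes "finite S" "S \<subseteq> carrier G" "generate G S = carrier G" "finite_index_subgroup H G"
  obtains U where "finite U" "U \<subseteq> H" "generate G U = H"
proof -
  have H: "subgroup H G" using assms(4) by (auto simp: finite_index_subgroup_def)
  interpret H: subgroup H G by fact
  obtain R where R: "finite R" "R \<subseteq> carrier G" "carrier G = (\<Union>r\<in>R. r <# H)"
    using finite_index_transversal[OF assms(4)] by blast
  \<comment> \<open>\<open>R\<close> represents left cosets, its inverses right cosets. The unit is
    added here and to \<open>S'\<close> so that \<open>U\<close> contains each representative
    \<open>t\<close> in \<open>H\<close>, written as
    \<open>t \<otimes> \<one> \<otimes> inv \<one>\<close>.\<close>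
  define T where "T = insert \<one> (m_inv G ` R)"
  define S' where "S' = insert \<one> (S \<union> m_inv G ` S)"
  define U where "U = H \<inter> (\<lambda>(t, s, t'). t \<otimes> s \<otimes> inv t') ` (T \<times> S' \<times> T)"
  have fin: "finite U" using R assms by (auto simp: U_def T_def S'_def)
  have TS: "T \<subseteq> carrier G" "S' \<subseteq> carrier G"
    using R(2) assms(2) by (auto simp: T_def S'_def subset_iff)
  have UH: "U \<subseteq> H" by (auto simp: U_def)
  have UG: "U \<subseteq> carrier G" using UH H.subset by auto
  have T: "\<exists>t\<in>T. g \<otimes> inv t \<in> H" if g: "g \<in> carrier G" for g
  proof -
    have "inv g \<in> (\<Union>r\<in>R. r <# H)" using inv_closed[OF g] unfolding R(3) .
    then obtain r where r: "r \<in> R" "inv g \<in> r <# H" by auto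
    then have "inv r \<otimes> inv g \<in> H"
      using H.lcos_module_imp[OF is_group] R(2) by auto
    then have "inv (inv r \<otimes> inv g) \<in> H" by simp
    then have "g \<otimes> inv (inv r) \<in> H" using g r R(2) by (auto simp: inv_mult_group)
    then show ?thesis using r by (auto simp: T_def)
  qed
  define W where "W = {u \<otimes> t | u t. u \<in> generate G U \<and> t \<in> T}"
  have gU: "generate G U \<subseteq> carrier G" using generate_in_carrier[OF UG] by auto
  have Ws: "w \<otimes> s \<in> W" if wW: "w \<in> W" and s: "s \<in> S'" for w s
  proof -
    obtain u t where w: "w = u \<otimes> t" "u \<in> generate G U" "t \<in> T" using wW by (auto simp: W_def)
    have c: "u \<in> carrier G" "t \<in> carrier G" "s \<in> carrier G" using w gU TS s by auto
    obtain t' where t': "t' \<in> T" "t \<otimes> s \<otimes> inv t' \<in> H" using T[of "t \<otimes> s"] c by auto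
    have c': "t' \<in> carrier G" using t' TS by auto
    have "t \<otimes> s \<otimes> inv t' \<in> U"
      using t' w(3) s unfolding U_def by (intro IntI image_eqI[of _ _ "(t, s, t')"]) auto
    then have "u \<otimes> (t \<otimes> s \<otimes> inv t') \<in> generate G U"
      using w(2) by (auto intro: generate.eng generate.incl)
    moreover have "w \<otimes> s = u \<otimes> (t \<otimes> s \<otimes> inv t') \<otimes> t'"
      using c c' w(1) by (simp add: m_assoc)
    ultimately show ?thesis using t'(1) by (auto simp: W_def)
  qed
  have WG: "W \<subseteq> carrier G" using gU TS by (auto simp: W_def)
  have Wg: "\<forall>w\<in>W. w \<otimes> g \<in> W" if "g \<in> generate G S" for g
    using that
  proof induction
    case one
    have "w \<otimes> \<one> = w" if "w \<in> W" for w using that WG by auto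
    then show ?case by simp
  next
    case (incl s)
    then show ?case using Ws by (auto simp: S'_def)
  next
    case (inv s)
    then show ?case using Ws by (auto simp: S'_def)
  next
    case (eng g h)
    then have "g \<in> carrier G" "h \<in> carrier G" using generate_in_carrier[OF assms(2)] by auto
    then have "w \<otimes> (g \<otimes> h) = w \<otimes> g \<otimes> h" if "w \<in> W" for w
      using that WG by (auto simp: m_assoc)
    then show ?case using eng.IH by simp
  qed
  have "\<one> \<otimes> \<one> \<in> W"
    unfolding W_def mem_Collect_eq
    by (intro exI[of _ \<one>] conjI refl generate.one) (auto simp: T_def)
  then have "\<one> \<in> W" by simp
  have "g \<in> generate G U" if g: "g \<in> H" for g
  proof -
    have "\<one> \<otimes> g \<in> W" using Wg[of g] \<open>\<one> \<in> W\<close> assms(3) g by auto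
    then obtain u t where w: "g = u \<otimes> t" "u \<in> generate G U" "t \<in> T" using g by (auto simp: W_def)
    have c: "u \<in> carrier G" "t \<in> carrier G" using w gU TS by auto
    have "u \<in> H" using generate_subgroup_incl[OF UH H] w(2) by auto
    then have "inv u \<otimes> g \<in> H" using g by simp
    then have tH: "t \<in> H" using w c by (simp add: m_assoc[symmetric])
    have "t = t \<otimes> \<one> \<otimes> inv \<one>" using c by simp
    then have "t \<in> U" using tH w(3) unfolding U_def
      by (intro IntI image_eqI[of _ _ "(t, \<one>, \<one>)"]) (auto simp: T_def S'_def)
    then show ?thesis using w by (auto intro: generate.eng generate.incl)
  qed
  moreover have "generate G U \<subseteq> H" using generate_subgroup_incl[OF UH H] .
  ultimately show ?thesis using that[OF fin UH] by auto
qed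

end

section \<open>Polynomial maps between groups\<close>

definition difference ::
    "('g, 'm) monoid_scheme \<Rightarrow> ('a, 'n) monoid_scheme \<Rightarrow> 'g \<Rightarrow> ('g \<Rightarrow> 'a) \<Rightarrow> 'g \<Rightarrow> 'a" where
  "difference G A h f = (\<lambda>y. inv\<^bsub>A\<^esub> f y \<otimes>\<^bsub>A\<^esub> f (y \<otimes>\<^bsub>G\<^esub> h))"

text \<open>Counting starts with the trivial map, and bound 1 describes the constant maps into the
  carrier. So the recursion needs no special degree for the zero map.\<close>

primrec degree_less ::
    "('g, 'm) monoid_scheme \<Rightarrow> 'g set \<Rightarrow> ('a, 'n) monoid_scheme \<Rightarrow> nat \<Rightarrow> ('g \<Rightarrow> 'a) \<Rightarrow> bool" where
  "degree_less G H A 0 f \<longleftrightarrow> (\<forall>y\<in>H. f y = \<one>\<^bsub>A\<^esub>)"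
| "degree_less G H A (Suc n) f \<longleftrightarrow> (\<forall>h\<in>H. degree_less G H A n (difference G A h f))"

lemma degree_less_subset:
  "degree_less G H A n f \<Longrightarrow> K \<subseteq> H \<Longrightarrow> degree_less G K A n f"
  by (induction n arbitrary: f) auto

lemma degree_less_cong_on:
  assumes "\<And>y h. y \<in> H \<Longrightarrow> h \<in> H \<Longrightarrow> y \<otimes>\<^bsub>G\<^esub> h \<in> H" "\<And>y. y \<in> H \<Longrightarrow> f y = g y"
  shows "degree_less G H A n f = degree_less G H A n g"
  using assms(2)
proof (induction n arbitrary: f g)
  case (Suc n)
  have "degree_less G H A n (difference G A h f) = degree_less G H A n (difference G A h g)"
    if "h \<in> H" for h
    by (rule Suc.IH) (simp add: difference_def Suc.prems assms(1) that)
  then show ?case by simp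
qed simp

lemma degree_less_subgroup_codomain:
  assumes "group A" "subgroup T A" "f \<in> H \<rightarrow> T" "\<And>y h. y \<in> H \<Longrightarrow> h \<in> H \<Longrightarrow> y \<otimes>\<^bsub>G\<^esub> h \<in> H"
  shows "degree_less G H (A\<lparr>carrier := T\<rparr>) n f \<longleftrightarrow> degree_less G H A n f"
  using assms(3)
proof (induction n arbitrary: f)
  case (Suc n)
  have inv: "inv\<^bsub>A\<lparr>carrier := T\<rparr>\<^esub> x = inv\<^bsub>A\<^esub> x" if "x \<in> T" for x
    using group.m_inv_consistent[OF assms(1,2) that] .
  have T: "difference G A h f \<in> H \<rightarrow> T" if "h \<in> H" for h
  proof
    fix y assume y: "y \<in> H"
    have "f y \<in> T" "f (y \<otimes>\<^bsub>G\<^esub> h) \<in> T"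
      using Suc.prems y assms(4)[OF y that] by auto
    then show "difference G A h f y \<in> T"
      by (simp add: difference_def subgroup.m_closed[OF assms(2)] subgroup.m_inv_closed[OF assms(2)])
  qed
  have "degree_less G H (A\<lparr>carrier := T\<rparr>) n (difference G (A\<lparr>carrier := T\<rparr>) h f) \<longleftrightarrow>
      degree_less G H A n (difference G A h f)" if "h \<in> H" for h
  proof -
    have "degree_less G H (A\<lparr>carrier := T\<rparr>) n (difference G (A\<lparr>carrier := T\<rparr>) h f) \<longleftrightarrow>
      degree_less G H (A\<lparr>carrier := T\<rparr>) n (difference G A h f)"
      by (rule degree_less_cong_on[OF assms(4)]) (use Suc.prems inv in \<open>auto simp: difference_def
          Pi_iff\<close>)
    then show ?thesis using Suc.IH[OF T[OF that]] by simp
  qed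
  then show ?case by simp
qed simp

text \<open>The domain is a subgroup of a fixed ambient group because the descent keeps shrinking
  it, while the density lives on the ambient group.\<close>

locale poly_domain = group G for G :: "('g, 'm) monoid_scheme" (structure) +
  fixes H :: "'g set"
  assumes subgroup_H: "subgroup H G"
begin

sublocale H: subgroup H G by (rule subgroup_H)

lemma degree_less_cong:
  assumes "\<And>y. y \<in> H \<Longrightarrow> f y = g y"
  shows "degree_less G H A n f = degree_less G H A n g"
  by (rule degree_less_cong_on) (use assms in auto)

lemma difference_closed:
  assumes "group A" "f \<in> H \<rightarrow> carrier A" "h \<in> H"
  shows "difference G A h f \<in> H \<rightarrow> carrier A"
proof -
  interpret A: group A by fact
  show ?thesis using assms by (auto simp: difference_def Pi_iff)
qed

lemma degree_less_Suc:
  assumes "group A"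
  shows "degree_less G H A n f \<Longrightarrow> degree_less G H A (Suc n) f"
proof (induction n arbitrary: f)
  case 0
  interpret A: group A by fact
  show ?case using 0 by (auto simp: difference_def)
qed auto

lemma degree_less_mono:
  assumes "group A" "n \<le> m" "degree_less G H A n f"
  shows "degree_less G H A m f"
  using assms(2,3) by (induction m rule: dec_induct) (auto simp del: degree_less.simps intro:
      degree_less_Suc[OF assms(1)])

lemma degree_less_left_translate:
  assumes "k \<in> H" "degree_less G H A n f"
  shows "degree_less G H A n (\<lambda>y. f (k \<otimes> y))"
  using assms(2)
proof (induction n arbitrary: f)
  case (Suc n)
  have "degree_less G H A n (difference G A h (\<lambda>y. f (k \<otimes> y)))" if h: "h \<in> H" for h
  proof -
    have "degree_less G H A n (\<lambda>y. difference G A h f (k \<otimes> y))" using Suc h by simp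
    then show ?thesis
      by (subst degree_less_cong[where g = "\<lambda>y. difference G A h f (k \<otimes> y)"])
        (use h assms(1) in \<open>auto simp: difference_def m_assoc\<close>)
  qed
  then show ?case by simp
qed (use assms(1) in auto)

text \<open>Differences commute with left translations, whereas a right translation by
  \<open>k\<close> turns the direction \<open>h\<close> into
  \<open>inv k \<otimes> h \<otimes> k\<close>, which is again in \<open>H\<close>.\<close>

lemma degree_less_right_translate:
  assumes "k \<in> H" "degree_less G H A n f"
  shows "degree_less G H A n (\<lambda>y. f (y \<otimes> k))"
  using assms(2)
proof (induction n arbitrary: f)
  case (Suc n)
  have "degree_less G H A n (difference G A h (\<lambda>y. f (y \<otimes> k)))" if h: "h \<in> H" for h
  proof -
    have "inv k \<otimes> h \<otimes> k \<in> H" using h assms(1) by simp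
    then have "degree_less G H A n (\<lambda>y. difference G A (inv k \<otimes> h \<otimes> k) f (y \<otimes> k))"
      using Suc by simp
    then show ?thesis
      by (subst degree_less_cong[where g = "\<lambda>y. difference G A (inv k \<otimes> h \<otimes> k) f (y \<otimes> k)"])
        (use h assms(1) in \<open>auto simp: difference_def m_assoc\<close>)
  qed
  then show ?case by simp
qed (use assms(1) in auto)

lemma degree_less_hom:
  assumes "group A" "group B" "\<theta> \<in> hom A B" "f \<in> H \<rightarrow> carrier A" "degree_less G H A n f"
  shows "degree_less G H B n (\<lambda>y. \<theta> (f y))"
  using assms(4,5)
proof (induction n arbitrary: f)
  case 0
  then show ?case using hom_one[OF assms(3,1,2)] by auto
next
  case (Suc n)
  interpret A: group A by fact
  interpret B: group B by fact
  interpret h: group_hom A B \<theta> by unfold_locales fact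
  have "degree_less G H B n (difference G B h (\<lambda>y. \<theta> (f y)))" if h: "h \<in> H" for h
  proof -
    have "degree_less G H B n (\<lambda>y. \<theta> (difference G A h f y))"
      by (rule Suc.IH) (use Suc.prems difference_closed[OF assms(1)] h in auto)
    then show ?thesis
      by (subst degree_less_cong[where g = "\<lambda>y. \<theta> (difference G A h f y)"])
        (use h Suc.prems in \<open>auto simp: difference_def Pi_iff\<close>)
  qed
  then show ?case by simp
qed

text \<open>Equality propagates along words in the generators. A step by \<open>inv s\<close> from
  \<open>x\<close> is read backwards, from the difference along \<open>s\<close> at
  \<open>x \<otimes> inv s\<close>. The induction is stated for every starting point
  \<open>x\<close> so that steps can be composed.\<close>

lemma eq_of_difference_eq:
  assumes "group A" "S \<subseteq> H" "generate G S = H" "f \<in> H \<rightarrow> carrier A" "g \<in> H \<rightarrow> carrier A"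
    and one: "f \<one> = g \<one>"
    and diff: "\<And>s y. s \<in> S \<Longrightarrow> y \<in> H \<Longrightarrow> difference G A s f y = difference G A s g y"
    and "y \<in> H"
  shows "f y = g y"
proof -
  interpret A: group A by fact
  have fg: "f x \<in> carrier A" "g x \<in> carrier A" if "x \<in> H" for x
    using that assms(4,5) by auto
  have "\<forall>x\<in>H. f x = g x \<longrightarrow> f (x \<otimes> z) = g (x \<otimes> z)" if "z \<in> generate G S" for z
    using that
  proof induction
    case (incl s)
    then have sH: "s \<in> H" using assms(2) by auto
    show ?case
    proof (intro ballI impI)
      fix x assume x: "x \<in> H" "f x = g x"
      have xs: "x \<otimes> s \<in> H" using x sH by simp
      have "inv\<^bsub>A\<^esub> g x \<otimes>\<^bsub>A\<^esub> f (x \<otimes> s) = inv\<^bsub>A\<^esub> g x \<otimes>\<^bsub>A\<^esub> g (x \<otimes> s)"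
        using diff[OF incl x(1)] x(2) by (simp add: difference_def)
      then show "f (x \<otimes> s) = g (x \<otimes> s)" using fg[OF xs] fg[OF x(1)] by simp
    qed
  next
    case (inv s)
    have sH: "s \<in> H" using inv assms(2) by auto
    show ?case
    proof (intro ballI impI)
      fix x assume x: "x \<in> H" "f x = g x"
      have xs: "x \<otimes> inv s \<in> H" using x sH by simp
      have "inv\<^bsub>A\<^esub> f (x \<otimes> inv s) \<otimes>\<^bsub>A\<^esub> f x = inv\<^bsub>A\<^esub> g (x \<otimes> inv s) \<otimes>\<^bsub>A\<^esub> f x"
        using diff[OF inv xs] x sH by (simp add: difference_def m_assoc)
      then have "inv\<^bsub>A\<^esub> f (x \<otimes> inv s) = inv\<^bsub>A\<^esub> g (x \<otimes> inv s)"
        using fg[OF xs] fg[OF x(1)] by simp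
      then show "f (x \<otimes> inv s) = g (x \<otimes> inv s)" using fg[OF xs] by (metis A.inv_inv)
    qed
  next
    case (eng a b)
    then have "a \<in> H" "b \<in> H" using assms(3) by auto
    then show ?case using eng by (auto simp: m_assoc[symmetric])
  qed auto
  from bspec[OF this[of y] H.one_closed] have "f (\<one> \<otimes> y) = g (\<one> \<otimes> y)"
    using assms(3,8) one by simp
  then show ?thesis using assms(8) by simp
qed

text \<open>A polynomial map is determined by its value at \<open>\<one>\<close> and its differences at the generators.\<close>

lemma finite_degree_less:
  assumes "finite S" "S \<subseteq> H" "generate G S = H" "group A" "finite (carrier A)"
  shows "finite {f \<in> H \<rightarrow>\<^sub>E carrier A. degree_less G H A n f}"
proof (induction n)
  case 0
  have "{f \<in> H \<rightarrow>\<^sub>E carrier A. degree_less G H A 0 f} \<subseteq> {\<lambda>y\<in>H. \<one>\<^bsub>A\<^esub>}"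
    by (auto simp: PiE_def extensional_def)
  then show ?case by (rule finite_subset) simp
next
  case (Suc n)
  let ?Q = "\<lambda>n. {f \<in> H \<rightarrow>\<^sub>E carrier A. degree_less G H A n f}"
  define F where "F f = (f \<one>, \<lambda>s\<in>S. restrict (difference G A s f) H)" for f
  have "F ` ?Q (Suc n) \<subseteq> carrier A \<times> (S \<rightarrow>\<^sub>E ?Q n)"
  proof (intro image_subsetI)
    fix f assume f: "f \<in> ?Q (Suc n)"
    have fA: "f \<in> H \<rightarrow> carrier A" using f by auto
    have "restrict (difference G A s f) H \<in> ?Q n" if "s \<in> S" for s
    proof -
      have sH: "s \<in> H" using that assms(2) by auto
      have "degree_less G H A n (difference G A s f)" using f sH by simp
      then have "degree_less G H A n (restrict (difference G A s f) H)"
        by (subst degree_less_cong[where g = "difference G A s f"]) auto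
      then show ?thesis using difference_closed[OF assms(4) fA sH] by auto
    qed
    then show "F f \<in> carrier A \<times> (S \<rightarrow>\<^sub>E ?Q n)"
      using fA by (auto simp: F_def simp del: PiE_iff)
  qed
  then have "finite (F ` ?Q (Suc n))"
    by (rule finite_subset) (use Suc assms in \<open>auto intro!: finite_PiE\<close>)
  moreover have "inj_on F (?Q (Suc n))"
  proof (rule inj_onI)
    fix f g assume f: "f \<in> ?Q (Suc n)" and g: "g \<in> ?Q (Suc n)" and eq: "F f = F g"
    have eq1: "f \<one> = g \<one>"
      and eq2: "(\<lambda>s\<in>S. restrict (difference G A s f) H) = (\<lambda>s\<in>S. restrict (difference G A s g) H)"
      using eq by (simp_all add: F_def)
    have "f y = g y" if "y \<in> H" for y
    proof (rule eq_of_difference_eq[where f = f and g = g, OF assms(4,2,3) _ _ eq1 _ that])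
      show "difference G A s f y = difference G A s g y" if "s \<in> S" "y \<in> H" for s y
        using fun_cong[OF fun_cong[OF eq2, of s], of y] that by simp
    qed (use f g in auto)
    then show "f = g" using f g by (intro PiE_ext[of f H "\<lambda>_. carrier A" g]) auto
  qed
  ultimately show ?case by (rule finite_imageD)
qed

text \<open>Right translation by \<open>H\<close> acts on the finite set \<open>Q\<close> of
  polynomial maps with the same degree bound, and \<open>K\<close> is the kernel of this
  action.\<close>

lemma finite_degree_less_periodic:
  assumes "finite S" "S \<subseteq> H" "generate G S = H" "group A" "finite (carrier A)"
    and "finite_index_subgroup H G" "f \<in> H \<rightarrow> carrier A" "degree_less G H A n f"
  obtains K where "finite_index_subgroup K G" "K \<subseteq> H"
    "\<And>y k. y \<in> H \<Longrightarrow> k \<in> K \<Longrightarrow> f (y \<otimes> k) = f y"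
proof
  define Q where "Q = {f \<in> H \<rightarrow>\<^sub>E carrier A. degree_less G H A n f}"
  have finQ: "finite Q" unfolding Q_def by (rule finite_degree_less[OF assms(1-5)])
  define K where "K = {k \<in> H. \<forall>q\<in>Q. \<forall>y\<in>H. q (y \<otimes> k) = q y}"
  show KH: "K \<subseteq> H" by (auto simp: K_def)
  show "f (y \<otimes> k) = f y" if "y \<in> H" "k \<in> K" for y k
  proof -
    have "restrict f H \<in> Q"
      using assms(7,8) degree_less_cong[of f "restrict f H"] by (auto simp: Q_def)
    then have "restrict f H (y \<otimes> k) = restrict f H y" using that by (auto simp: K_def)
    then show ?thesis using that KH by (auto simp: subset_iff)
  qed
  have inv: "inv a \<otimes> b \<in> K" if a: "a \<in> H" "b \<in> H" and eq: "\<And>q y. q \<in> Q \<Longrightarrow> y \<in> H \<Longrightarrow> q (y \<otimes> a)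
      = q (y \<otimes> b)" for a b
  proof -
    have "q (y \<otimes> (inv a \<otimes> b)) = q y" if "q \<in> Q" "y \<in> H" for q y
    proof -
      have "q (y \<otimes> inv a \<otimes> a) = q (y \<otimes> inv a \<otimes> b)" by (rule eq) (use that a in auto)
      then show ?thesis using that a by (simp add: m_assoc)
    qed
    then show ?thesis using a by (auto simp: K_def)
  qed
  have sub: "subgroup K G"
  proof (rule subgroupI)
    show "K \<subseteq> carrier G" using KH H.subset by auto
    show "K \<noteq> {}" by (auto simp: K_def intro!: exI[of _ \<one>])
    fix a assume a: "a \<in> K"
    have "inv a \<otimes> \<one> \<in> K" by (rule inv) (use a in \<open>auto simp: K_def\<close>)
    then show "inv a \<in> K" using a by (simp add: K_def)
    fix b assume b: "b \<in> K"
    have "q (y \<otimes> (a \<otimes> b)) = q y" if "q \<in> Q" "y \<in> H" for q y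
    proof -
      have ab: "a \<in> H" "b \<in> H" using a b by (auto simp: K_def)
      have "q (y \<otimes> (a \<otimes> b)) = q (y \<otimes> a \<otimes> b)" using ab that by (simp add: m_assoc)
      also have "\<dots> = q (y \<otimes> a)" using b that H.m_closed[OF that(2) ab(1)] unfolding K_def by blast
      also have "\<dots> = q y" using a that unfolding K_def by blast
      finally show ?thesis .
    qed
    then show "a \<otimes> b \<in> K" using a b by (auto simp: K_def)
  qed
  show "finite_index_subgroup K G"
  proof (rule finite_index_subgroup_in[OF assms(6) sub KH, where f = "\<lambda>k. \<lambda>q\<in>Q. \<lambda>y\<in>H. q (y \<otimes> k)"])
    have "restrict (\<lambda>y. q (y \<otimes> k)) H \<in> Q" if "k \<in> H" "q \<in> Q" for q k
    proof -
      have "degree_less G H A n (\<lambda>y. q (y \<otimes> k))"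
        by (rule degree_less_right_translate) (use that in \<open>auto simp: Q_def\<close>)
      then show ?thesis
        using that degree_less_cong[of "\<lambda>y. q (y \<otimes> k)" "restrict (\<lambda>y. q (y \<otimes> k)) H"]
        by (auto simp: Q_def)
    qed
    then have "(\<lambda>k. \<lambda>q\<in>Q. \<lambda>y\<in>H. q (y \<otimes> k)) ` H \<subseteq> Q \<rightarrow>\<^sub>E Q" by (auto simp del: PiE_iff)
    then show "finite ((\<lambda>k. \<lambda>q\<in>Q. \<lambda>y\<in>H. q (y \<otimes> k)) ` H)"
      by (rule finite_subset) (use finQ in \<open>auto intro!: finite_PiE\<close>)
    fix a b assume ab: "a \<in> H" "b \<in> H" "(\<lambda>q\<in>Q. \<lambda>y\<in>H. q (y \<otimes> a)) = (\<lambda>q\<in>Q. \<lambda>y\<in>H. q (y \<otimes> b))"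
    show "inv a \<otimes> b \<in> K"
    proof (rule inv[OF ab(1,2)])
      fix q y assume "q \<in> Q" "y \<in> H"
      then show "q (y \<otimes> a) = q (y \<otimes> b)" using fun_cong[OF fun_cong[OF ab(3), of q], of y] by simp
    qed
  qed
qed

text \<open>The values are recovered from \<open>f \<one>\<close> and the differences along the
  finitely many generators of \<open>H\<close>; by induction each of these differences has its image
  in a finitely generated subgroup.\<close>

lemma degree_less_image_finitely_generated:
  assumes "finite S" "S \<subseteq> H" "generate G S = H" "group A"
    and "f \<in> H \<rightarrow> carrier A" "degree_less G H A n f"
  shows "\<exists>F. finite F \<and> F \<subseteq> carrier A \<and> f ` H \<subseteq> generate A F"
  using assms(5,6)
proof (induction n arbitrary: f)
  case 0
  then show ?case by (intro exI[of _ "{}"]) (auto intro: generate.one)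
next
  case (Suc n)
  interpret A: group A by fact
  have "\<exists>F. finite F \<and> F \<subseteq> carrier A \<and> difference G A s f ` H \<subseteq> generate A F" if "s \<in> S" for s
  proof -
    have "s \<in> H" using that assms(2) by auto
    then show ?thesis
      using Suc.IH[OF difference_closed[OF assms(4) Suc.prems(1)]] Suc.prems(2) by simp
  qed
  then obtain F where F: "\<And>s. s \<in> S \<Longrightarrow> finite (F s) \<and> F s \<subseteq> carrier A
      \<and> difference G A s f ` H \<subseteq> generate A (F s)"
    by metis
  define E where "E = insert (f \<one>) (\<Union>s\<in>S. F s)"
  have f: "f y \<in> carrier A" if "y \<in> H" for y using that Suc.prems by auto
  have E: "finite E" "E \<subseteq> carrier A" using F assms(1) f by (auto simp: E_def)
  interpret E: subgroup "generate A E" A by (rule A.generate_is_subgroup[OF E(2)])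
  have d: "difference G A s f y \<in> generate A E" if "s \<in> S" "y \<in> H" for s y
  proof -
    have "generate A (F s) \<subseteq> generate A E"
      by (rule A.mono_generate) (use that in \<open>auto simp: E_def\<close>)
    then show ?thesis using F that by blast
  qed
  have "\<forall>x\<in>H. f x \<in> generate A E \<longrightarrow> f (x \<otimes> z) \<in> generate A E" if "z \<in> generate G S" for z
    using that
  proof induction
    case (incl s)
    show ?case
    proof (intro ballI impI)
      fix x assume x: "x \<in> H" "f x \<in> generate A E"
      have "f x \<otimes>\<^bsub>A\<^esub> difference G A s f x \<in> generate A E" using d[OF incl] x by simp
      then show "f (x \<otimes> s) \<in> generate A E"
        using f x incl assms(2) by (simp add: difference_def subset_iff)
    qed
  next
    case (inv s)
    have sH: "s \<in> H" using inv assms(2) by auto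
    show ?case
    proof (intro ballI impI)
      fix x assume x: "x \<in> H" "f x \<in> generate A E"
      have xs: "x \<otimes> inv s \<in> H" using x sH by simp
      have "f x \<otimes>\<^bsub>A\<^esub> inv\<^bsub>A\<^esub> (difference G A s f (x \<otimes> inv s)) \<in> generate A E"
        using d[OF inv xs] x by simp
      moreover have "difference G A s f (x \<otimes> inv s) = inv\<^bsub>A\<^esub> f (x \<otimes> inv s) \<otimes>\<^bsub>A\<^esub> f x"
        using x sH by (simp add: difference_def m_assoc)
      ultimately show "f (x \<otimes> inv s) \<in> generate A E"
        using f[OF xs] f[OF x(1)] by (simp add: A.word_simps)
    qed
  next
    case (eng a b)
    then have "a \<in> H" "b \<in> H" using assms(3) by auto
    then show ?case using eng by (auto simp: m_assoc[symmetric])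
  qed auto
  moreover have "f \<one> \<in> generate A E" by (rule generate.incl) (simp add: E_def)
  ultimately have "f (\<one> \<otimes> y) \<in> generate A E" if "y \<in> H" for y
    using that assms(3) H.one_closed by blast
  then have "f ` H \<subseteq> generate A E" by auto
  then show ?case using E by blast
qed

end

section \<open>Homomorphisms from finitely generated abelian groups to the integers\<close>

context comm_group
begin

lemma subgroup_hom_int_pow:
  assumes "subgroup B G" "\<theta> \<in> hom (G\<lparr>carrier := B\<rparr>) integer_group" "x \<in> B"
  shows "\<theta> (x [^] (k::int)) = k * \<theta> x"
proof -
  interpret h: group_hom "G\<lparr>carrier := B\<rparr>" integer_group \<theta>
    by (intro group_hom.intro group_hom_axioms.intro subgroup_imp_group assms(1,2) group_integer_group)
  show ?thesis
    using h.hom_int_pow[of x k] assms(3) int_pow_consistent[OF assms(1,3)] by simp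
qed

text \<open>Prescribing \<open>m * \<theta>\<close> on \<open>B\<close> and the value
  \<open>c\<close> at \<open>b\<close> is consistent as soon as the two agree on the powers of
  \<open>b\<close> lying in \<open>B\<close>, which is \<open>wd\<close>. The factor
  \<open>m\<close> is there because the integers are not divisible, so \<open>\<theta>\<close>
  itself may fail to extend.\<close>

lemma hom_integer_group_extend:
  assumes B: "subgroup B G" and b: "b \<in> carrier G"
    and \<theta>: "\<theta> \<in> hom (G\<lparr>carrier := B\<rparr>) integer_group"
    and wd: "\<And>k::int. b [^] k \<in> B \<Longrightarrow> m * \<theta> (b [^] k) = k * c"
    and B': "B' = {x \<otimes> b [^] (n::int) | x n. x \<in> B}"
  obtains \<theta>' where "\<theta>' \<in> hom (G\<lparr>carrier := B'\<rparr>) integer_group"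
    "\<And>x n. x \<in> B \<Longrightarrow> \<theta>' (x \<otimes> b [^] n) = m * \<theta> x + n * c"
proof -
  interpret B: subgroup B G by fact
  have add: "\<theta> (x \<otimes> y) = \<theta> x + \<theta> y" if "x \<in> B" "y \<in> B" for x y
    using \<theta> that by (simp add: hom_def)
  have val: "m * \<theta> x + n * c = m * \<theta> x' + n' * c"
    if x: "x \<in> B" "x' \<in> B" and eq: "x \<otimes> b [^] n = x' \<otimes> b [^] n'" for x x' and n n' :: int
  proof -
    have xc: "x \<in> carrier G" "x' \<in> carrier G" using x by auto
    have "b [^] (n' - n) = b [^] n' \<otimes> inv (b [^] n)" using b by (rule int_pow_diff)
    also have "\<dots> = inv x' \<otimes> (x' \<otimes> b [^] n') \<otimes> inv (b [^] n)" using xc b by simp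
    also have "\<dots> = inv x' \<otimes> x" using xc b by (simp add: eq[symmetric] m_assoc)
    finally have p: "b [^] (n' - n) = inv x' \<otimes> x" .
    then have "b [^] (n' - n) \<in> B" using x by simp
    then have "m * \<theta> (inv x' \<otimes> x) = (n' - n) * c" using wd p by metis
    moreover have "\<theta> x = \<theta> x' + \<theta> (inv x' \<otimes> x)"
      using add[of x' "inv x' \<otimes> x"] x xc by simp
    ultimately show ?thesis by (simp add: algebra_simps)
  qed
  define \<theta>' where "\<theta>' z = (SOME v. \<exists>x n. x \<in> B \<and> z = x \<otimes> b [^] (n::int) \<and> v = m * \<theta> x + n * c)" for z
  have eval: "\<theta>' (x \<otimes> b [^] n) = m * \<theta> x + n * c" if x: "x \<in> B" for x and n :: int
  proof -
    have "\<exists>x' n'. x' \<in> B \<and> x \<otimes> b [^] n = x' \<otimes> b [^] (n'::int) \<and> \<theta>' (x \<otimes> b [^] n) = m * \<theta> x' + n' * c"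
      unfolding \<theta>'_def by (rule someI_ex) (use x in blast)
    then show ?thesis using val[OF x] by metis
  qed
  have "\<theta>' \<in> hom (G\<lparr>carrier := B'\<rparr>) integer_group"
  proof (rule homI)
    fix y z assume "y \<in> carrier (G\<lparr>carrier := B'\<rparr>)" "z \<in> carrier (G\<lparr>carrier := B'\<rparr>)"
    then obtain u v and i j :: int where uv: "u \<in> B" "v \<in> B" "y = u \<otimes> b [^] i" "z = v \<otimes> b [^] j"
      by (auto simp: B')
    have "y \<otimes> z = (u \<otimes> v) \<otimes> b [^] (i + j)"
      using uv b by (simp add: int_pow_mult m_assoc m_lcomm)
    then show "\<theta>' (y \<otimes>\<^bsub>G\<lparr>carrier := B'\<rparr>\<^esub> z) = \<theta>' y \<otimes>\<^bsub>integer_group\<^esub> \<theta>' z"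
      using uv eval[of "u \<otimes> v" "i + j"] eval[of u i] eval[of v j] add by (simp add: algebra_simps)
  qed simp
  then show ?thesis using that eval by blast
qed

text \<open>For finitely generated \<open>B\<close> this is the torsion subgroup. It is defined
  through characters because the vanishing of all characters is what the density argument
  delivers.\<close>

definition annihilated :: "'a set \<Rightarrow> 'a set" where
  "annihilated B = {a \<in> B. \<forall>\<theta>\<in>hom (G\<lparr>carrier := B\<rparr>) integer_group. \<theta> a = 0}"

text \<open>If \<open>b\<^sup>m \<in> B\<close> with \<open>m > 0\<close>, then \<open>m \<theta>\<close> extends to \<open>B'\<close> for every \<open>\<theta>\<close>, so each coset of \<open>B\<close> in \<open>B'\<close>
  contains at most as many annihilated elements as \<open>B\<close>.\<close>

lemma finite_annihilated_extend:
  assumes B: "subgroup B G" and b: "b \<in> carrier G"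
    and B': "B' = {x \<otimes> b [^] (n::int) | x n. x \<in> B}"
    and fin: "finite (annihilated B)"
  shows "finite (annihilated B')"
proof (cases "\<exists>m>0. b [^] (m::int) \<in> B")
  case True
  then obtain m :: int where m: "m > 0" "b [^] m \<in> B" by blast
  interpret B: subgroup B G by fact
  have ext: "\<exists>\<theta>'\<in>hom (G\<lparr>carrier := B'\<rparr>) integer_group.
      \<forall>x n. x \<in> B \<longrightarrow> \<theta>' (x \<otimes> b [^] n) = m * \<theta> x + n * \<theta> (b [^] m)"
    if \<theta>: "\<theta> \<in> hom (G\<lparr>carrier := B\<rparr>) integer_group" for \<theta>
  proof -
    have "m * \<theta> (b [^] k) = k * \<theta> (b [^] m)" if "b [^] k \<in> B" for k :: int
    proof -
      have "(b [^] k) [^] m = (b [^] m) [^] k" using b by (simp add: int_pow_pow mult.commute)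
      then show ?thesis
        using subgroup_hom_int_pow[OF B \<theta> that, of m] subgroup_hom_int_pow[OF B \<theta> m(2), of k] by simp
    qed
    from hom_integer_group_extend[OF B b \<theta> this B'] show ?thesis by metis
  qed
  \<comment> \<open>One reference element for each coset of \<open>B\<close> in \<open>B'\<close>
    that contains an annihilated element; any other annihilated element of that coset differs from
    it by an annihilated element of \<open>B\<close>.\<close>
  define s where "s n = (SOME x. x \<in> B \<and> x \<otimes> b [^] (n::int) \<in> annihilated B')" for n
  have "a \<in> (\<lambda>(t, n). t \<otimes> s n \<otimes> b [^] n) ` (annihilated B \<times> {0..<m})" if a: "a \<in> annihilated B'" for a
  proof -
    obtain x and k :: int where x: "x \<in> B" "a = x \<otimes> b [^] k"
      using a by (auto simp: annihilated_def B')
    define n where "n = k mod m"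
    define y where "y = x \<otimes> (b [^] m) [^] (k div m)"
    have y: "y \<in> B" using x m subgroup_int_pow_closed[OF B] by (simp add: y_def)
    have "b [^] k = b [^] (m * (k div m) + n)" by (simp add: n_def)
    then have ay: "a = y \<otimes> b [^] n"
      using x b B.subset by (simp add: y_def int_pow_pow int_pow_mult m_assoc subset_iff)
    have "s n \<in> B \<and> s n \<otimes> b [^] n \<in> annihilated B'"
      unfolding s_def by (rule someI[of _ y]) (use y ay a in auto)
    then have s: "s n \<in> B" "s n \<otimes> b [^] n \<in> annihilated B'" by auto
    have "\<theta> (y \<otimes> inv (s n)) = 0" if \<theta>: "\<theta> \<in> hom (G\<lparr>carrier := B\<rparr>) integer_group" for \<theta>
    proof -
      obtain \<theta>' where \<theta>': "\<theta>' \<in> hom (G\<lparr>carrier := B'\<rparr>) integer_group"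
        "\<And>x n. x \<in> B \<Longrightarrow> \<theta>' (x \<otimes> b [^] n) = m * \<theta> x + n * \<theta> (b [^] m)"
        using ext[OF \<theta>] by blast
      have "\<theta>' a = 0" "\<theta>' (s n \<otimes> b [^] n) = 0"
        using a s(2) \<theta>'(1) by (auto simp: annihilated_def)
      then have "m * \<theta> y + n * \<theta> (b [^] m) = m * \<theta> (s n) + n * \<theta> (b [^] m)"
        using \<theta>'(2) y s(1) ay by simp
      then have "\<theta> y = \<theta> (s n)" using m by simp
      moreover have "\<theta> (y \<otimes> inv (s n)) + \<theta> (s n) = \<theta> (y \<otimes> inv (s n) \<otimes> s n)"
        using \<theta> y s(1) by (simp add: hom_def)
      ultimately show ?thesis using y s(1) B.subset by (simp add: m_assoc subset_iff)
    qed
    then have t: "y \<otimes> inv (s n) \<in> annihilated B" using y s(1) by (simp add: annihilated_def)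
    have "a = (y \<otimes> inv (s n)) \<otimes> s n \<otimes> b [^] n"
      using y s(1) b B.subset ay by (simp add: m_assoc subset_iff)
    moreover have "n \<in> {0..<m}" using m by (simp add: n_def)
    ultimately show ?thesis using t by (intro image_eqI[of _ _ "(y \<otimes> inv (s n), n)"]) auto
  qed
  then have "annihilated B' \<subseteq> (\<lambda>(t, n). t \<otimes> s n \<otimes> b [^] n) ` (annihilated B \<times> {0..<m})" by blast
  then show ?thesis by (rule finite_subset) (use fin in auto)
next
  case False
  interpret B: subgroup B G by fact
  have pow0: "k = 0" if "b [^] (k::int) \<in> B" for k
  proof (rule ccontr)
    assume "k \<noteq> 0"
    moreover have "b [^] (- k) \<in> B" using that b by (simp add: int_pow_neg)
    ultimately show False using False that by (meson neg_0_less_iff_less linorder_neqE_linordered_idom)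
  qed
  \<comment> \<open>Here \<open>B'\<close> is the direct product of \<open>B\<close> and the
    infinite cyclic group of \<open>b\<close>, so \<open>m\<close> and \<open>c\<close> are free.
    The choice \<open>m = 0\<close>, \<open>c = 1\<close> reads off the exponent of \<open>b\<close>
    and forces it to vanish; \<open>m = 1\<close>, \<open>c = 0\<close> extends
    \<open>\<theta>\<close> itself.\<close>
  have ext: "\<exists>\<theta>'\<in>hom (G\<lparr>carrier := B'\<rparr>) integer_group.
      \<forall>x n. x \<in> B \<longrightarrow> \<theta>' (x \<otimes> b [^] n) = m * \<theta> x + n * c"
    if \<theta>: "\<theta> \<in> hom (G\<lparr>carrier := B\<rparr>) integer_group" for \<theta> m c
  proof -
    have "\<theta> \<one> = 0" using subgroup_hom_int_pow[OF B \<theta>, of \<one> 0] by simp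
    then have "m * \<theta> (b [^] k) = k * c" if "b [^] k \<in> B" for k :: int
      using pow0[OF that] by simp
    from hom_integer_group_extend[OF B b \<theta> this B'] show ?thesis by metis
  qed
  have zero: "(\<lambda>_. 0) \<in> hom (G\<lparr>carrier := B\<rparr>) integer_group" by (simp add: hom_def)
  have "a \<in> annihilated B" if a: "a \<in> annihilated B'" for a
  proof -
    obtain x and n :: int where x: "x \<in> B" "a = x \<otimes> b [^] n"
      using a by (auto simp: annihilated_def B')
    obtain \<theta>' where \<theta>': "\<theta>' \<in> hom (G\<lparr>carrier := B'\<rparr>) integer_group"
      "\<forall>x n. x \<in> B \<longrightarrow> \<theta>' (x \<otimes> b [^] n) = 0 * 0 + n * 1"
      using ext[OF zero, of 0 1] by blast
    have "\<theta>' a = 0" using a \<theta>'(1) by (auto simp: annihilated_def)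
    then have "n = 0" using \<theta>'(2) x by simp
    then have ax: "a = x" using x B.subset by (simp add: subset_iff)
    have "\<theta> a = 0" if \<theta>: "\<theta> \<in> hom (G\<lparr>carrier := B\<rparr>) integer_group" for \<theta>
    proof -
      obtain \<theta>' where \<theta>': "\<theta>' \<in> hom (G\<lparr>carrier := B'\<rparr>) integer_group"
        "\<forall>x n. x \<in> B \<longrightarrow> \<theta>' (x \<otimes> b [^] n) = 1 * \<theta> x + n * 0"
        using ext[OF \<theta>, of 1 0] by blast
      have "\<theta>' a = 0" using a \<theta>'(1) by (auto simp: annihilated_def)
      moreover have "\<theta>' a = 1 * \<theta> x + n * 0" unfolding x(2) using \<theta>'(2) x(1) by blast
      ultimately show ?thesis using ax by simp
    qed
    then show ?thesis using x ax by (simp add: annihilated_def)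
  qed
  then show ?thesis using fin by (meson finite_subset subsetI)
qed

lemma generate_insert:
  assumes "F \<subseteq> carrier G" "b \<in> carrier G"
  shows "generate G (insert b F) = {x \<otimes> b [^] (n::int) | x n. x \<in> generate G F}" (is "_ = ?R")
proof
  interpret B: subgroup "generate G F" G by (rule generate_is_subgroup[OF assms(1)])
  interpret B': subgroup "generate G (insert b F)" G by (rule generate_is_subgroup) (use assms in auto)
  have "subgroup ?R G"
  proof (rule subgroupI)
    show "?R \<subseteq> carrier G" using assms B.subset by auto
    show "?R \<noteq> {}" using B.one_closed by blast
    fix a assume "a \<in> ?R"
    then obtain x and n :: int where a: "a = x \<otimes> b [^] n" "x \<in> generate G F" by blast
    have "inv a = inv x \<otimes> b [^] (- n)" using a assms by (simp add: int_pow_neg inv_mult)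
    then show "inv a \<in> ?R" using a(2) by blast
    fix c assume "c \<in> ?R"
    then obtain y and k :: int where c: "c = y \<otimes> b [^] k" "y \<in> generate G F" by blast
    have "a \<otimes> c = (x \<otimes> y) \<otimes> b [^] (n + k)"
      using a c assms by (simp add: int_pow_mult m_assoc m_lcomm)
    then show "a \<otimes> c \<in> ?R" using a(2) c(2) by blast
  qed
  moreover have "insert b F \<subseteq> ?R"
  proof (intro insert_subsetI subsetI)
    have "b = \<one> \<otimes> b [^] (1::int)" using assms by simp
    then show "b \<in> ?R" using B.one_closed by blast
    fix x assume x: "x \<in> F"
    then have "x = x \<otimes> b [^] (0::int)" using assms by auto
    then show "x \<in> ?R" using x by (blast intro: generate.incl)
  qed
  ultimately show "generate G (insert b F) \<subseteq> ?R" by (rule generate_subgroup_incl[rotated])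
  have "x \<in> generate G (insert b F)" if "x \<in> generate G F" for x
    using that mono_generate[of F "insert b F"] by blast
  moreover have "b [^] (n::int) \<in> generate G (insert b F)" for n
    by (rule subgroup_int_pow_closed) (auto intro: B'.subgroup_axioms generate.incl)
  ultimately show "?R \<subseteq> generate G (insert b F)" by auto
qed

lemma finite_annihilated_generate:
  assumes "finite F" "F \<subseteq> carrier G"
  shows "finite (annihilated (generate G F))"
  using assms
proof (induction F)
  case empty
  have "annihilated (generate G {}) \<subseteq> {\<one>}" using generate_empty by (auto simp: annihilated_def)
  then show ?case by (rule finite_subset) simp
next
  case (insert b F)
  show ?case
    by (rule finite_annihilated_extend[of "generate G F" b])
      (use insert generate_insert[of F b] generate_is_subgroup[of F] in auto)
qed

lemma subgroup_annihilated:
  assumes "subgroup B G"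
  shows "subgroup (annihilated B) G"
proof -
  interpret B: subgroup B G by fact
  note pow = subgroup_hom_int_pow[OF assms]
  show ?thesis
  proof (rule subgroupI)
    show "annihilated B \<subseteq> carrier G" using B.subset by (auto simp: annihilated_def)
    have "\<theta> \<one> = 0" if "\<theta> \<in> hom (G\<lparr>carrier := B\<rparr>) integer_group" for \<theta>
      using pow[OF that, of \<one> 0] by simp
    then have "\<one> \<in> annihilated B" by (simp add: annihilated_def)
    then show "annihilated B \<noteq> {}" by blast
    fix a assume a: "a \<in> annihilated B"
    have aB: "a \<in> B" using a by (simp add: annihilated_def)
    have "\<theta> (inv a) = 0" if "\<theta> \<in> hom (G\<lparr>carrier := B\<rparr>) integer_group" for \<theta>
    proof -
      have "a [^] (-1::int) = inv a" using aB by (simp add: int_pow_neg)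
      then show ?thesis using pow[OF that aB, of "-1"] a that by (simp add: annihilated_def)
    qed
    then show "inv a \<in> annihilated B" using aB by (simp add: annihilated_def)
    fix c assume c: "c \<in> annihilated B"
    have cB: "c \<in> B" using c by (simp add: annihilated_def)
    have "\<theta> (a \<otimes> c) = 0" if \<theta>: "\<theta> \<in> hom (G\<lparr>carrier := B\<rparr>) integer_group" for \<theta>
    proof -
      have "\<theta> (a \<otimes> c) = \<theta> a + \<theta> c" using hom_mult[OF \<theta>, of a c] aB cB by simp
      moreover have "\<theta> a = 0" "\<theta> c = 0" using a c \<theta> unfolding annihilated_def by blast+
      ultimately show ?thesis by simp
    qed
    then show "a \<otimes> c \<in> annihilated B" using aB cB by (simp add: annihilated_def)
  qed
qed

end

section \<open>Zeros of integer polynomials modulo a prime\<close>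

text \<open>Lagrange's argument carried out on integer polynomials: dividing by the monic factor at
  a root \<open>r\<close> preserves the leading coefficient, so the hypothesis passes to the
  quotient. Distinct \<open>n\<close> below \<open>p\<close> are distinct residues.\<close>

lemma card_roots_mod_prime:
  fixes f :: "int poly" and p :: nat
  assumes "prime p" "\<not> int p dvd lead_coeff f"
  shows "card {n. n < p \<and> int p dvd poly f (int n)} \<le> degree f"
  using assms(2)
proof (induction "degree f" arbitrary: f)
  case 0
  then obtain c where "f = [:c:]" by (metis degree_eq_zeroE)
  then show ?case using 0 by simp
next
  case (Suc d)
  show ?case
  proof (cases "\<exists>r<p. int p dvd poly f (int r)")
    case True
    then obtain r where r: "r < p" "int p dvd poly f (int r)" by blast
    define q where "q = synthetic_div f (int r)"
    have f: "f = [:- int r, 1:] * q + [:poly f (int r):]"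
      unfolding q_def by (rule synthetic_div_correct'[symmetric])
    have dq: "degree q = d" using Suc.hyps(2) by (simp add: q_def degree_synthetic_div)
    have "Polynomial.coeff f (Suc d) = Polynomial.coeff q d"
      using dq by (subst f) (simp add: coeff_eq_0)
    then have "\<not> int p dvd lead_coeff q" using Suc.prems Suc.hyps(2) dq by simp
    from Suc.hyps(1)[OF dq[symmetric] this] dq
    have IH: "card {n. n < p \<and> int p dvd poly q (int n)} \<le> d" by simp
    have "{n. n < p \<and> int p dvd poly f (int n)} \<subseteq> insert r {n. n < p \<and> int p dvd poly q (int n)}"
    proof
      fix n assume n: "n \<in> {n. n < p \<and> int p dvd poly f (int n)}"
      have "poly f (int n) = (int n - int r) * poly q (int n) + poly f (int r)"
        by (subst f) (simp add: algebra_simps)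
      then have "int p dvd (int n - int r) * poly q (int n)"
        using n r by (metis (no_types, lifting) dvd_add_left_iff mem_Collect_eq)
      then have "int p dvd int n - int r \<or> int p dvd poly q (int n)"
        using assms(1) by (simp add: prime_dvd_mult_iff)
      moreover have "n = r" if "int p dvd int n - int r"
      proof -
        have "int n mod int p = int r mod int p" using that by (simp add: mod_eq_dvd_iff)
        then show ?thesis using n r by simp
      qed
      ultimately show "n \<in> insert r {n. n < p \<and> int p dvd poly q (int n)}" using n by auto
    qed
    then have "card {n. n < p \<and> int p dvd poly f (int n)}
        \<le> card (insert r {n. n < p \<and> int p dvd poly q (int n)})"
      by (intro card_mono) auto
    also have "\<dots> \<le> Suc d" using IH by (intro order.trans[OF card_insert_le_m1]) (auto simp:
        card_insert_if)
    finally show ?thesis using Suc.hyps(2) by simp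
  next
    case False
    then have "{n. n < p \<and> int p dvd poly f (int n)} = {}" by blast
    then show ?thesis by (simp only: card.empty)
  qed
qed

text \<open>The hypothesis says that \<open>a (Suc j)\<close> is the forward difference of
  \<open>a j\<close>; the induction step is Pascal's rule.\<close>

lemma newton_expansion:
  fixes a :: "nat \<Rightarrow> nat \<Rightarrow> int"
  assumes "\<And>j n. a j (Suc n) = a j n + a (Suc j) n"
  shows "a j n = (\<Sum>l\<le>n. int (n choose l) * a (j + l) 0)"
proof (induction n arbitrary: j)
  case (Suc n)
  have "a j (Suc n) = (\<Sum>l\<le>n. int (n choose l) * a (j + l) 0) + (\<Sum>l\<le>n. int (n choose l) * a (j +
      Suc l) 0)"
    using Suc[of j] Suc[of "Suc j"] by (simp add: assms)
  also have "(\<Sum>l\<le>n. int (n choose l) * a (j + l) 0) = (\<Sum>l\<le>Suc n. int (n choose l) * a (j + l) 0)"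
    by simp
  also have "\<dots> = a j 0 + (\<Sum>l\<le>n. int (n choose Suc l) * a (j + Suc l) 0)"
    by (subst sum.atMost_Suc_shift) simp
  also have "\<dots> + (\<Sum>l\<le>n. int (n choose l) * a (j + Suc l) 0)
      = a j 0 + (\<Sum>l\<le>n. int (Suc n choose Suc l) * a (j + Suc l) 0)"
    by (simp add: sum.distrib[symmetric] algebra_simps)
  also have "\<dots> = (\<Sum>l\<le>Suc n. int (Suc n choose l) * a (j + l) 0)"
    by (subst sum.atMost_Suc_shift) simp
  finally show ?case .
qed simp

text \<open>Binomial coefficients become integer polynomials in \<open>n\<close> once the factorial
  is cleared. For \<open>n < j\<close> both sides vanish, the product through its factor at
  \<open>l = n\<close>.\<close>

lemma fact_times_binomial:
  "fact j * int (n choose j) = (\<Prod>l<j. int n - int l)"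
proof -
  have "real_of_int (fact j * int (n choose j)) = fact j * (real n gchoose j)"
    by (simp add: binomial_gbinomial)
  also have "\<dots> = (\<Prod>l<j. real n - real l)"
    by (simp add: gbinomial_mult_fact atLeast0LessThan)
  also have "\<dots> = real_of_int (\<Prod>l<j. int n - int l)" by simp
  finally show ?thesis by (simp only: of_int_eq_iff)
qed

text \<open>Multiplied by \<open>fact i\<close>, the Newton expansion becomes an integer polynomial
  of degree \<open>i\<close> with leading coefficient \<open>a i 0\<close>. The multiplication can
  only add zeros modulo \<open>p\<close>, so the bound on roots carries over for every prime
  \<open>p\<close>, even one dividing \<open>fact i\<close>.\<close>

lemma card_zeros_mod_prime_le:
  fixes a :: "nat \<Rightarrow> nat \<Rightarrow> int" and p :: nat
  assumes rec: "\<And>j n. a j (Suc n) = a j n + a (Suc j) n"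
    and zero: "\<And>n. a (Suc i) n = 0" and p: "prime p" "\<not> int p dvd a i 0"
  shows "card {n. n < p \<and> int p dvd a 0 n} \<le> i"
proof -
  have z: "a (Suc i + j) n = 0" for j n
  proof (induction j arbitrary: n)
    case (Suc j)
    show ?case using rec[of "Suc i + j" n] Suc by simp
  qed (simp add: zero)
  have z': "a l 0 = 0" if "l > i" for l
    using z[of "l - Suc i" 0] that by simp
  define g :: "nat \<Rightarrow> int poly" where "g j = (\<Prod>l<j. [:- int l, 1:])" for j
  have dg: "degree (g j) = j \<and> lead_coeff (g j) = 1" for j
  proof (induction j)
    case (Suc j)
    have g: "g (Suc j) = g j * [:- int j, 1:]" by (simp add: g_def)
    have "g j \<noteq> 0" using Suc by auto
    then have "degree (g (Suc j)) = degree (g j) + degree [:- int j, 1:]"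
      unfolding g by (rule degree_mult_eq) simp
    moreover have "lead_coeff (g (Suc j)) = lead_coeff (g j) * lead_coeff [:- int j, 1:]"
      unfolding g by (rule lead_coeff_mult)
    ultimately show ?case using Suc by auto
  qed (simp add: g_def)
  have dg': "degree (g j) = j" "Polynomial.coeff (g j) j = 1" for j
    using dg[of j] by auto
  define f where "f = (\<Sum>j\<le>i. Polynomial.smult (a j 0 * (fact i div fact j)) (g j))"
  have "Polynomial.coeff f i = (\<Sum>j\<le>i. a j 0 * (fact i div fact j) * Polynomial.coeff (g j) i)"
    by (simp add: f_def coeff_sum)
  also have "\<dots> = (\<Sum>j\<in>{i}. a j 0 * (fact i div fact j) * Polynomial.coeff (g j) i)"
    by (rule sum.mono_neutral_right) (use dg' in \<open>auto intro!: coeff_eq_0\<close>)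
  also have "\<dots> = a i 0" by (simp add: dg')
  finally have ci: "Polynomial.coeff f i = a i 0" .
  have "degree f \<le> i"
    unfolding f_def by (intro degree_sum_le order.trans[OF degree_smult_le]) (use dg' in auto)
  moreover have "a i 0 \<noteq> 0" using p by auto
  then have "i \<le> degree f" using ci by (intro le_degree) simp
  ultimately have df: "degree f = i" by simp
  have val: "fact i * a 0 n = poly f (int n)" for n
  proof -
    have "a 0 n = (\<Sum>l\<le>n. int (n choose l) * a l 0)"
      using newton_expansion[of a, OF rec, of 0 n] by simp
    \<comment> \<open>The range is first widened and then cut back: terms with \<open>l > n\<close>
      vanish through the binomial coefficient, terms with \<open>l > i\<close> through the
      differences.\<close>
    also have "\<dots> = (\<Sum>l\<le>max n i. int (n choose l) * a l 0)"
      by (rule sum.mono_neutral_left) auto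
    also have "\<dots> = (\<Sum>l\<le>i. int (n choose l) * a l 0)"
      by (rule sum.mono_neutral_right) (use z' in auto)
    finally have "fact i * a 0 n = (\<Sum>l\<le>i. fact i * (int (n choose l) * a l 0))"
      by (simp add: sum_distrib_left)
    also have "\<dots> = (\<Sum>l\<le>i. a l 0 * (fact i div fact l) * poly (g l) (int n))"
    proof (rule sum.cong[OF HOL.refl])
      fix l assume "l \<in> {..i}"
      then have "(fact l :: int) dvd fact i" by (simp add: fact_dvd)
      then have "(fact i :: int) = (fact i div fact l) * fact l" by simp
      moreover have "fact l * int (n choose l) = poly (g l) (int n)"
        by (simp add: fact_times_binomial g_def poly_prod)
      ultimately show "fact i * (int (n choose l) * a l 0)
          = a l 0 * (fact i div fact l) * poly (g l) (int n)"
        by (metis (no_types, lifting) mult.assoc mult.commute)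
    qed
    also have "\<dots> = poly f (int n)" by (simp add: f_def poly_sum)
    finally show ?thesis .
  qed
  have "card {n. n < p \<and> int p dvd a 0 n} \<le> card {n. n < p \<and> int p dvd poly f (int n)}"
    by (rule card_mono) (auto simp: val[symmetric])
  also have "\<dots> \<le> i" using card_roots_mod_prime[of p f] p ci df by simp
  finally show ?thesis .
qed

section \<open>Zero sets of abelian-valued polynomial maps\<close>

text \<open>No invariance of the density is assumed: only cosets of subgroups of finite index are controlled.\<close>

locale upper_density = group G for G :: "('g, 'm) monoid_scheme" (structure) +
  fixes dens :: "'g set \<Rightarrow> real"
  assumes dens_nonneg: "A \<subseteq> carrier G \<Longrightarrow> 0 \<le> dens A"
    and dens_empty: "dens {} = 0"
    and dens_mono: "A \<subseteq> B \<Longrightarrow> B \<subseteq> carrier G \<Longrightarrow> dens A \<le> dens B"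
    and dens_Un: "A \<subseteq> carrier G \<Longrightarrow> B \<subseteq> carrier G \<Longrightarrow> dens (A \<union> B) \<le> dens A + dens B"
    and dens_coset: "finite_index_subgroup K G \<Longrightarrow> \<exists>L. L \<subseteq> K \<and> L \<lhd> G \<and> finite_index_subgroup L G \<and>
      (\<forall>x\<in>carrier G. dens (x <# L) * card (lcosets L) \<le> 1)"
begin

lemma dens_UN:
  assumes "finite I" "\<And>i. i \<in> I \<Longrightarrow> A i \<subseteq> carrier G"
  shows "dens (\<Union>i\<in>I. A i) \<le> (\<Sum>i\<in>I. dens (A i))"
  using assms
proof (induction I)
  case (insert i I)
  have "dens (A i \<union> (\<Union>i\<in>I. A i)) \<le> dens (A i) + dens (\<Union>i\<in>I. A i)"
    using insert.prems by (intro dens_Un) auto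
  then show ?case using insert by simp
qed (simp add: dens_empty)

text \<open>Finite subadditivity singles out a coset. It is named after a point of \<open>S\<close>,
  so that a zero of the map is available as base point.\<close>

lemma dens_pos_coset:
  assumes "finite_index_subgroup K G" "S \<subseteq> carrier G" "dens S > 0"
  obtains s where "s \<in> S" "dens (S \<inter> (s <# K)) > 0"
proof -
  have K: "subgroup K G" using assms(1) by (simp add: finite_index_subgroup_def)
  obtain R where R: "finite R" "R \<subseteq> carrier G" "carrier G = (\<Union>r\<in>R. r <# K)"
    using finite_index_transversal[OF assms(1)] by blast
  have "S = (\<Union>r\<in>R. S \<inter> (r <# K))" using assms(2) unfolding R(3) by blast
  moreover have "dens (\<Union>r\<in>R. S \<inter> (r <# K)) \<le> (\<Sum>r\<in>R. dens (S \<inter> (r <# K)))"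
    using R(1) assms(2) by (intro dens_UN) auto
  ultimately have "0 < (\<Sum>r\<in>R. dens (S \<inter> (r <# K)))" using assms(3) by simp
  then obtain r where r: "r \<in> R" "dens (S \<inter> (r <# K)) > 0"
    by (meson not_less sum_nonpos)
  then have "S \<inter> (r <# K) \<noteq> {}" using dens_empty by force
  then obtain s where s: "s \<in> S" "s \<in> r <# K" by blast
  then have "s <# K = r <# K" using l_repr_independence[OF s(2) _ K] r R(2) by auto
  then show ?thesis using that s r by simp
qed

lemma dens_periodic_le:
  fixes p i :: nat
  assumes K: "finite_index_subgroup K G" and T: "T \<subseteq> carrier G"
    and per: "\<And>y k. y \<in> T \<Longrightarrow> k \<in> K \<Longrightarrow> y \<otimes> k \<in> T"
    and h: "h \<in> carrier G" and p: "p > 0"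
    and line: "\<And>y. y \<in> carrier G \<Longrightarrow> card {n. n < p \<and> y \<otimes> h [^] (n::nat) \<in> T} \<le> i"
  shows "dens T \<le> i / p"
proof -
  \<comment> \<open>Double counting of the pairs \<open>(c, n)\<close> of a coset \<open>c\<close> of \<open>L\<close> and \<open>n < p\<close> with \<open>c h\<^sup>n \<subseteq> T\<close>.\<close>
  obtain L where L: "L \<subseteq> K" "L \<lhd> G" "finite_index_subgroup L G"
    "\<And>x. x \<in> carrier G \<Longrightarrow> dens (x <# L) * card (lcosets L) \<le> 1"
    using dens_coset[OF K] by blast
  interpret L: normal L G by fact
  have Lsub: "subgroup L G" by (rule L.subgroup_axioms)
  define Q where "Q = lcosets L"
  have Q: "finite Q" "Q = (\<lambda>y. y <# L) ` carrier G"
    using L(3) by (auto simp: Q_def finite_index_subgroup_def LCOSETS_def)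
  have Q0: "card Q > 0" using Q by (auto simp: card_gt_0_iff)
  define T' where "T' = (\<lambda>y. y <# L) ` T"
  have T'Q: "T' \<subseteq> Q" using T Q by (auto simp: T'_def)
  have mem: "y <# L \<in> T' \<longleftrightarrow> y \<in> T" if y: "y \<in> carrier G" for y
  proof
    assume "y <# L \<in> T'"
    then obtain t where t: "t \<in> T" "t <# L = y <# L" by (auto simp: T'_def)
    then have "inv t \<otimes> y \<in> L" using lcoset_eq_iff[OF Lsub, of t y] T y by auto
    then have "t \<otimes> (inv t \<otimes> y) \<in> T" using per t(1) L(1) by auto
    then show "y \<in> T" using t(1) T y by auto
  qed (auto simp: T'_def)
  have mult: "(y <# L) #> g = (y \<otimes> g) <# L" if "y \<in> carrier G" "g \<in> carrier G" for y g
    using that L.coset_eq L.subset by (metis coset_mult_assoc m_closed)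
  \<comment> \<open>Since \<open>L\<close> is normal, right multiplication by \<open>g\<close>
    permutes its left cosets. Hence every \<open>n\<close> contributes the same number of
    pairs.\<close>
  have card_eq: "card {c \<in> Q. c #> g \<in> T'} = card T'" if g: "g \<in> carrier G" for g
  proof (rule bij_betw_same_card[of "\<lambda>c. c #> g"], rule bij_betwI[where g = "\<lambda>c. c #> inv g"])
    show "(\<lambda>c. c #> g) \<in> {c \<in> Q. c #> g \<in> T'} \<rightarrow> T'" by auto
    have inv: "c #> g #> inv g = c" "c #> inv g #> g = c" if "c \<in> Q" for c
      using that g by (auto simp: Q(2) mult m_assoc)
    show "(\<lambda>c. c #> inv g) \<in> T' \<rightarrow> {c \<in> Q. c #> g \<in> T'}"
    proof
      fix c assume c: "c \<in> T'"
      then have cQ: "c \<in> Q" using T'Q by auto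
      then have "c #> inv g \<in> Q" using g by (auto simp: Q(2) mult)
      then show "c #> inv g \<in> {c \<in> Q. c #> g \<in> T'}" using inv(2)[OF cQ] c by simp
    qed
    show "c #> g #> inv g = c" if "c \<in> {c \<in> Q. c #> g \<in> T'}" for c using inv that by simp
    show "c #> inv g #> g = c" if "c \<in> T'" for c using inv that T'Q by auto
  qed
  have "p * card T' = (\<Sum>n<p. card {c \<in> Q. c #> h [^] n \<in> T'})"
    using h by (simp add: card_eq)
  also have "\<dots> = (\<Sum>n<p. \<Sum>c\<in>Q. if c #> h [^] n \<in> T' then 1 else 0)"
    using Q(1) by (simp add: sum.If_cases Int_def)
  also have "\<dots> = (\<Sum>c\<in>Q. \<Sum>n<p. if c #> h [^] n \<in> T' then 1 else 0)"
    by (rule sum.swap)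
  also have "\<dots> \<le> (\<Sum>c\<in>Q. i)"
  proof (rule sum_mono)
    fix c assume "c \<in> Q"
    then obtain y where y: "y \<in> carrier G" "c = y <# L" by (auto simp: Q(2))
    have "(\<Sum>n<p. if c #> h [^] n \<in> T' then 1 else 0) = card {n. n < p \<and> y \<otimes> h [^] n \<in> T}"
      using y h by (simp add: sum.If_cases Int_def mult mem)
    then show "(\<Sum>n<p. if c #> h [^] n \<in> T' then 1 else 0) \<le> i" using line[OF y(1)] by simp
  qed
  finally have count: "p * card T' \<le> card Q * i" by simp
  have "T \<subseteq> (\<Union>c\<in>T'. c)" using lcos_self[OF _ Lsub] T by (auto simp: T'_def)
  moreover have cG: "c \<subseteq> carrier G" if "c \<in> T'" for c
    using that T'Q L.lcosets_carrier[OF is_group] by (auto simp: Q_def)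
  ultimately have "dens T \<le> dens (\<Union>c\<in>T'. c)" by (intro dens_mono) auto
  also have "\<dots> \<le> (\<Sum>c\<in>T'. dens c)" using Q(1) T'Q cG by (intro dens_UN) (auto intro: finite_subset)
  also have "\<dots> \<le> (\<Sum>c\<in>T'. 1 / card Q)"
  proof (rule sum_mono)
    fix c assume "c \<in> T'"
    then obtain y where y: "y \<in> carrier G" "c = y <# L" using T'Q by (auto simp: Q(2))
    then have "dens c * card Q \<le> 1" using L(4) by (simp add: Q_def)
    then show "dens c \<le> 1 / card Q" using Q0 by (simp add: field_simps)
  qed
  also have "\<dots> = card T' / card Q" by simp
  also have "\<dots> \<le> i / p"
  proof -
    have "real p * card T' \<le> card Q * i" using count by (metis of_nat_le_iff of_nat_mult)
    then show ?thesis using Q0 p by (simp add: field_simps)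
  qed
  finally show ?thesis .
qed

end

locale upper_density_domain = upper_density G dens + poly_domain G H
  for G :: "('g, 'm) monoid_scheme" (structure) and dens H +
  fixes U :: "'g set"
  assumes finite_index_H: "finite_index_subgroup H G"
    and U: "finite U" "U \<subseteq> H" "generate G U = H"
begin

text \<open>Reduction modulo \<open>p\<close> makes the codomain finite; this uses
  \<open>p > 0\<close>, as \<open>integer_mod_group 0\<close> is infinite.\<close>

lemma mod_periodic:
  assumes "degree_less G H integer_group n f" "p > 0"
  obtains K where "finite_index_subgroup K G" "K \<subseteq> H"
    "\<And>y k. y \<in> H \<Longrightarrow> k \<in> K \<Longrightarrow> f (y \<otimes> k) mod int p = f y mod int p"
proof -
  have hom: "(\<lambda>k. k mod int p) \<in> hom integer_group (integer_mod_group p)"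
    using assms(2) by (auto simp: hom_def carrier_integer_mod_group mod_add_eq)
  have deg: "degree_less G H (integer_mod_group p) n (\<lambda>y. f y mod int p)"
    by (rule degree_less_hom[OF group_integer_group group_integer_mod_group hom _ assms(1)]) simp
  show ?thesis
    by (rule finite_degree_less_periodic[OF U _ _ finite_index_H _ deg])
      (use assms(2) that in \<open>auto simp: carrier_integer_mod_group\<close>)
qed

text \<open>Let \<open>g i\<close> be the last nonzero iterated difference of \<open>f\<close> in a
  direction \<open>h\<close> along which \<open>f\<close> is not invariant. It plays the role of the
  top coefficient on each line in direction \<open>h\<close>, but it varies with the line and may be
  divisible by \<open>p\<close> on many of them. The induction hypothesis bounds the density of
  those lines, and on the others the count of zeros gives at most \<open>i\<close> out of
  \<open>p\<close> points. If there is no such \<open>h\<close>, then \<open>f\<close> is a nonzero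
  constant, which no large prime divides.\<close>

lemma dens_prime_divisors:
  assumes "degree_less G H integer_group n f" "\<exists>y\<in>H. f y \<noteq> (0::int)"
    and x: "x \<in> carrier G" and "\<epsilon> > 0"
  shows "\<exists>p0. \<forall>p>p0. prime p \<longrightarrow> dens {x \<otimes> y | y. y \<in> H \<and> int p dvd f y} \<le> \<epsilon>"
  using assms(1,2,4)
proof (induction n arbitrary: f \<epsilon>)
  case 0
  then show ?case by simp
next
  case (Suc n)
  show ?case
  proof (cases "\<forall>h\<in>H. \<forall>y\<in>H. difference G integer_group h f y = 0")
    case True
    have const: "f y = f \<one>" if "y \<in> H" for y
    proof -
      have "difference G integer_group y f \<one> = 0" using True that H.one_closed by blast
      then show ?thesis using that by (simp add: difference_def)
    qed
    then have c: "f \<one> \<noteq> 0" using Suc.prems(2) by metis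
    have empty: "{x \<otimes> y | y. y \<in> H \<and> int p dvd f y} = {}" if p: "p > nat \<bar>f \<one>\<bar>" for p
    proof -
      have "\<not> int p dvd f \<one>" using dvd_imp_le_int[OF c, of "int p"] p by linarith
      then have "\<not> int p dvd f y" if "y \<in> H" for y using const[OF that] by simp
      then show ?thesis by blast
    qed
    have "dens {x \<otimes> y | y. y \<in> H \<and> int p dvd f y} \<le> \<epsilon>" if "p > nat \<bar>f \<one>\<bar>" for p
      unfolding empty[OF that] dens_empty using Suc.prems(3) by simp
    then show ?thesis by blast
  next
    case False
    then obtain h y1 where h: "h \<in> H" "y1 \<in> H" "difference G integer_group h f y1 \<noteq> 0" by blast
    define g where "g j = (difference G integer_group h ^^ j) f" for j
    have g0: "g 0 = f" and gS: "g (Suc j) = difference G integer_group h (g j)" for j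
      by (simp_all add: g_def)
    have degg: "degree_less G H integer_group (Suc n - j) (g j)" if "j \<le> Suc n" for j
      using that
    proof (induction j)
      case (Suc j)
      then have "degree_less G H integer_group (Suc (n - j)) (g j)" by (simp add: Suc_diff_le)
      then show ?case using h(1) by (simp add: gS)
    qed (use Suc.prems(1) in \<open>simp add: g0\<close>)
    have ex: "\<forall>y\<in>H. g (Suc n) y = 0" using degg[of "Suc n"] by simp
    define m where "m = (LEAST j. \<forall>y\<in>H. g j y = 0)"
    have m: "\<forall>y\<in>H. g m y = 0" unfolding m_def by (rule LeastI[of _ "Suc n"]) (rule ex)
    have mle: "m \<le> Suc n" unfolding m_def by (rule Least_le) (rule ex)
    have m_least: "\<not> (\<forall>y\<in>H. g j y = 0)" if "j < m" for j
      using not_less_Least[of j] that unfolding m_def by blast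
    \<comment> \<open>\<open>m = 0\<close> would make \<open>f\<close> zero and \<open>m = 1\<close>
      its difference along \<open>h\<close>. So \<open>i \<ge> 1\<close>, which makes the degree
      bound of \<open>g i\<close> small enough for the induction hypothesis.\<close>
    have "m \<noteq> 0" using m Suc.prems(2) g0 by (metis)
    moreover have "m \<noteq> 1" using m h by (metis One_nat_def g0 gS)
    ultimately obtain i where i: "m = Suc i" "i \<ge> 1" by (cases m) auto
    have gi: "\<exists>y\<in>H. g i y \<noteq> 0" using m_least[of i] i by auto
    have "degree_less G H integer_group n (g i)"
      by (rule degree_less_mono[OF group_integer_group _ degg[of i]]) (use i mle in auto)
    then obtain p1 where p1: "\<And>p. p > p1 \<Longrightarrow> prime p \<Longrightarrow> dens {x \<otimes> y | y. y \<in> H \<and> int p dvd g i y} \<le> \<epsilon> / 2"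
      using Suc.IH[OF _ gi, of "\<epsilon> / 2"] Suc.prems(3) by auto
    show ?thesis
    proof (intro exI[of _ "max p1 (nat \<lceil>2 * real i / \<epsilon>\<rceil>)"] allI impI)
      fix p assume p: "p > max p1 (nat \<lceil>2 * real i / \<epsilon>\<rceil>)" and prime: "prime p"
      have p0: "p > 0" using p by simp
      define T where "T = {x \<otimes> y | y. y \<in> H \<and> int p dvd f y \<and> \<not> int p dvd g i y}"
      have T: "T \<subseteq> carrier G" using x by (auto simp: T_def)
      have TI: "z \<in> T \<longleftrightarrow> inv x \<otimes> z \<in> H \<and> int p dvd f (inv x \<otimes> z) \<and> \<not> int p dvd g i (inv x \<otimes> z)"
        if "z \<in> carrier G" for z
      proof
        assume "inv x \<otimes> z \<in> H \<and> int p dvd f (inv x \<otimes> z) \<and> \<not> int p dvd g i (inv x \<otimes> z)"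
        moreover have "z = x \<otimes> (inv x \<otimes> z)" using x that by simp
        ultimately show "z \<in> T" unfolding T_def by blast
      qed (use x in \<open>auto simp: T_def\<close>)
      obtain K1 where K1: "finite_index_subgroup K1 G" "K1 \<subseteq> H"
        "\<And>y k. y \<in> H \<Longrightarrow> k \<in> K1 \<Longrightarrow> f (y \<otimes> k) mod int p = f y mod int p"
        using mod_periodic[OF Suc.prems(1) p0] by blast
      obtain K2 where K2: "finite_index_subgroup K2 G" "K2 \<subseteq> H"
        "\<And>y k. y \<in> H \<Longrightarrow> k \<in> K2 \<Longrightarrow> g i (y \<otimes> k) mod int p = g i y mod int p"
        using mod_periodic[OF degg[of i] p0] i mle by auto
      define K where "K = {a \<in> carrier G. \<forall>j\<in>{K1, K2}. a \<in> j}"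
      have K: "finite_index_subgroup K G"
        unfolding K_def by (rule finite_index_INT) (use K1 K2 in auto)
      have "dens T \<le> real i / real p"
      proof (rule dens_periodic_le[OF K T _ _ p0])
        show "h \<in> carrier G" using h by auto
        fix y k assume yk: "y \<in> T" "k \<in> K"
        then obtain z where z: "z \<in> H" "y = x \<otimes> z" "int p dvd f z" "\<not> int p dvd g i z"
          by (auto simp: T_def)
        have k: "k \<in> K1" "k \<in> K2" "k \<in> H" using yk K1(2) by (auto simp: K_def)
        have "z \<otimes> k \<in> H" "y \<otimes> k = x \<otimes> (z \<otimes> k)" using z k x by (auto simp: m_assoc)
        moreover have "int p dvd f (z \<otimes> k)" "\<not> int p dvd g i (z \<otimes> k)"
          using K1(3)[OF z(1) k(1)] K2(3)[OF z(1) k(2)] z(3,4) by (auto simp: dvd_eq_mod_eq_0)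
        ultimately show "y \<otimes> k \<in> T" unfolding T_def by blast
      next
        fix y assume y: "y \<in> carrier G"
        show "card {n. n < p \<and> y \<otimes> h [^] n \<in> T} \<le> i"
        proof (cases "\<exists>n. y \<otimes> h [^] (n::nat) \<in> T")
          case True
          then obtain n0 :: nat where n0: "y \<otimes> h [^] n0 \<in> T" by blast
          have hp: "h [^] k \<in> H" for k :: nat using h(1) subgroup_int_pow_closed[OF subgroup_H, of
              h "int k"] by (simp add: int_pow_int)
          have hc: "h \<in> carrier G" using h by auto
          have n0': "inv x \<otimes> (y \<otimes> h [^] n0) \<in> H" "\<not> int p dvd g i (inv x \<otimes> (y \<otimes> h [^] n0))"
            using TI[of "y \<otimes> h [^] n0"] n0 y hc by auto
          have "inv x \<otimes> (y \<otimes> h [^] n0) \<otimes> inv (h [^] n0) \<in> H" using n0'(1) hp by blast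
          then have z: "inv x \<otimes> y \<in> H" using x y hc by (simp add: m_assoc)
          define a where "a j n = g j (inv x \<otimes> y \<otimes> h [^] (n::nat))" for j n
          have rec: "a j (Suc n) = a j n + a (Suc j) n" for j n
            using x y hc by (simp add: a_def gS difference_def m_assoc)
          have zero: "a (Suc i) n = 0" for n
            using m i z hp by (simp add: a_def)
          \<comment> \<open>As \<open>g (Suc i)\<close> vanishes on \<open>H\<close>, the map
            \<open>g i\<close> is constant along the line. A single point of the line in
            \<open>T\<close> therefore shows that the top coefficient \<open>a i 0\<close> is
            nonzero modulo \<open>p\<close>.\<close>
          have "a i n = a i 0" for n by (induction n) (simp_all add: rec zero)
          then have "\<not> int p dvd a i 0" using n0'(2) x y hc
              by (metis a_def m_assoc inv_closed nat_pow_closed)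
          then have "card {n. n < p \<and> int p dvd a 0 n} \<le> i"
            by (rule card_zeros_mod_prime_le[of a i p, OF rec zero prime])
          moreover have "{n. n < p \<and> y \<otimes> h [^] n \<in> T} \<subseteq> {n. n < p \<and> int p dvd a 0 n}"
            using TI x y hc by (auto simp: a_def g0 m_assoc)
          then have "card {n. n < p \<and> y \<otimes> h [^] n \<in> T} \<le> card {n. n < p \<and> int p dvd a 0 n}"
            by (rule card_mono[rotated]) simp
          ultimately show ?thesis by simp
        next
          case False
          then have "{n. n < p \<and> y \<otimes> h [^] n \<in> T} = {}" by blast
          then show ?thesis by (simp only: card.empty)
        qed
      qed
      moreover have "real i / real p \<le> \<epsilon> / 2"
      proof -
        have "2 * real i / \<epsilon> \<le> real p" using p by linarith
        then show ?thesis using Suc.prems(3) p0 by (simp add: field_simps)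
      qed
      moreover have "dens {x \<otimes> y | y. y \<in> H \<and> int p dvd g i y} \<le> \<epsilon> / 2"
        using p1 p prime by simp
      moreover have "dens {x \<otimes> y | y. y \<in> H \<and> int p dvd f y}
          \<le> dens ({x \<otimes> y | y. y \<in> H \<and> int p dvd g i y} \<union> T)"
        by (rule dens_mono) (use x in \<open>auto simp: T_def\<close>)
      moreover have "\<dots> \<le> dens {x \<otimes> y | y. y \<in> H \<and> int p dvd g i y} + dens T"
        by (rule dens_Un) (use x T in auto)
      ultimately show "dens {x \<otimes> y | y. y \<in> H \<and> int p dvd f y} \<le> \<epsilon>" by linarith
    qed
  qed
qed

text \<open>A character not vanishing on the image would give an integer-valued map divisible on
  \<open>S\<close> by every prime, so \<open>dens S\<close> would be arbitrarily small.
  \<open>S\<close> may be smaller than the zero set, and a positive part of it is returned: in the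
  descent, \<open>f\<close> is the map modulo the next term while \<open>S\<close> consists of zeros
  of the map itself.\<close>

lemma abelian_zero_coset:
  assumes A: "comm_group A" and f: "f \<in> H \<rightarrow> carrier A" and deg: "degree_less G H A n f"
    and x: "x \<in> carrier G" and S: "S \<subseteq> {x \<otimes> y | y. y \<in> H \<and> f y = \<one>\<^bsub>A\<^esub>}" and pos: "dens S > 0"
  obtains y K where "y \<in> H" "finite_index_subgroup K G" "K \<subseteq> H"
    "\<And>k. k \<in> K \<Longrightarrow> f (y \<otimes> k) = \<one>\<^bsub>A\<^esub>" "dens (S \<inter> ((x \<otimes> y) <# K)) > 0"
proof -
  interpret A: comm_group A by fact
  have SG: "S \<subseteq> carrier G" using S x by auto
  obtain F where F: "finite F" "F \<subseteq> carrier A" "f ` H \<subseteq> generate A F"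
    using degree_less_image_finitely_generated[OF U A.is_group f deg] by blast
  define B where "B = generate A F"
  have B: "subgroup B A" unfolding B_def by (rule A.generate_is_subgroup[OF F(2)])
  have fB: "f \<in> H \<rightarrow> B" using F(3) by (auto simp: B_def)
  have grpB: "group (A\<lparr>carrier := B\<rparr>)" by (rule A.subgroup_imp_group[OF B])
  have degB: "degree_less G H (A\<lparr>carrier := B\<rparr>) n f"
    using degree_less_subgroup_codomain[OF A.is_group B fB, of G n] deg by simp
  have zero: "\<theta> (f y) = 0" if \<theta>: "\<theta> \<in> hom (A\<lparr>carrier := B\<rparr>) integer_group" and y: "y \<in> H" for \<theta> y
  proof (rule ccontr)
    assume nz: "\<theta> (f y) \<noteq> 0"
    have dg: "degree_less G H integer_group n (\<lambda>y. \<theta> (f y))"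
      by (rule degree_less_hom[OF grpB group_integer_group \<theta> _ degB]) (use fB in simp)
    obtain p0 where p0: "\<forall>p>p0. prime p \<longrightarrow> dens {x \<otimes> y | y. y \<in> H \<and> int p dvd \<theta> (f y)} \<le> dens S / 2"
      using dens_prime_divisors[OF dg _ x, of "dens S / 2"] nz y pos by auto
    obtain p where p: "p > p0" "prime p" using bigger_prime by blast
    have "\<theta> \<one>\<^bsub>A\<^esub> = 0" using hom_one[OF \<theta> grpB group_integer_group] by simp
    then have "S \<subseteq> {x \<otimes> y | y. y \<in> H \<and> int p dvd \<theta> (f y)}" using S by fastforce
    then have "dens S \<le> dens {x \<otimes> y | y. y \<in> H \<and> int p dvd \<theta> (f y)}"
      by (rule dens_mono) (use x in auto)
    moreover have "dens {x \<otimes> y | y. y \<in> H \<and> int p dvd \<theta> (f y)} \<le> dens S / 2" using p0 p by blast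
    ultimately show False using pos by linarith
  qed
  define T where "T = A.annihilated B"
  have T: "subgroup T A" unfolding T_def by (rule A.subgroup_annihilated[OF B])
  have finT: "finite T" unfolding T_def B_def by (rule A.finite_annihilated_generate[OF F(1,2)])
  have fT: "f \<in> H \<rightarrow> T" using fB zero by (auto simp: T_def A.annihilated_def)
  have degT: "degree_less G H (A\<lparr>carrier := T\<rparr>) n f"
    using degree_less_subgroup_codomain[OF A.is_group T fT, of G n] deg by simp
  obtain K where K: "finite_index_subgroup K G" "K \<subseteq> H"
    "\<And>y k. y \<in> H \<Longrightarrow> k \<in> K \<Longrightarrow> f (y \<otimes> k) = f y"
    by (rule finite_degree_less_periodic[OF U A.subgroup_imp_group[OF T] _ finite_index_H _ degT])
      (use finT fT in auto)
  obtain s where s: "s \<in> S" "dens (S \<inter> (s <# K)) > 0"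
    using dens_pos_coset[OF K(1) SG pos] by blast
  obtain y where y: "y \<in> H" "s = x \<otimes> y" "f y = \<one>\<^bsub>A\<^esub>" using s(1) S by auto
  show ?thesis
  proof (rule that[OF y(1) K(1,2)])
    show "f (y \<otimes> k) = \<one>\<^bsub>A\<^esub>" if "k \<in> K" for k using K(3)[OF y(1) that] y(3) by simp
    show "dens (S \<inter> ((x \<otimes> y) <# K)) > 0" using s(2) y(2) by simp
  qed
qed

end

section \<open>Polynomial maps with respect to a filtration\<close>

text \<open>Commutators with \<open>F 0\<close> express only that the terms are normal, so
  \<open>F 0\<close> modulo \<open>F 1\<close> may be any group. This leaves room for the constants
  of a word in \<open>F 0\<close> while its variables move within cosets of
  \<open>F 1\<close>.\<close>

locale filtered_group = group A for A :: "('a, 'n) monoid_scheme" (structure) +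
  fixes F :: "nat \<Rightarrow> 'a set" and c :: nat
  assumes F_0: "F 0 = carrier A"
    and subgroup_F: "subgroup (F i) A"
    and F_Suc: "F (Suc i) \<subseteq> F i"
    and F_commutator: "a \<in> F i \<Longrightarrow> b \<in> F j \<Longrightarrow> a \<otimes> b \<otimes> inv a \<otimes> inv b \<in> F (i + j)"
    and F_trivial: "F c = {\<one>}"
begin

lemma F_antimono: "i \<le> j \<Longrightarrow> F j \<subseteq> F i"
  by (rule lift_Suc_antimono_le[of F]) (rule F_Suc)

lemma F_carrier: "a \<in> F i \<Longrightarrow> a \<in> carrier A"
  using subgroup.subset[OF subgroup_F] by blast

lemma F_eq_one: "c \<le> i \<Longrightarrow> a \<in> F i \<Longrightarrow> a = \<one>"
  using F_antimono[of c i] F_trivial by blast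

lemma normal_F: "F i \<lhd> A"
proof (rule normal_invI[OF subgroup_F])
  fix x h assume x: "x \<in> carrier A" and h: "h \<in> F i"
  have "x \<otimes> h \<otimes> inv x \<otimes> inv h \<otimes> h \<in> F i"
    using F_commutator[of x 0 h i] x h by (auto simp: F_0 intro: subgroup.m_closed[OF subgroup_F])
  then show "x \<otimes> h \<otimes> inv x \<in> F i" using x F_carrier[OF h] by (simp add: m_assoc)
qed

end

locale filtered_maps = G: poly_domain G H + filtered_group A F c
  for G :: "('g, 'm) monoid_scheme" and H and A :: "('a, 'n) monoid_scheme" (structure) and F c
begin

text \<open>Each difference has to be polynomial one level deeper, without end and without a base
  case, so the least fixed point would be empty. The greatest one contains, for instance, the
  trivial map at every level.\<close>

coinductive filtered_poly :: "nat \<Rightarrow> ('g \<Rightarrow> 'a) \<Rightarrow> bool" where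
  "(\<And>y. y \<in> H \<Longrightarrow> f y \<in> F w) \<Longrightarrow> (\<And>h. h \<in> H \<Longrightarrow> filtered_poly (Suc w) (difference G A h f)) \<Longrightarrow>
    filtered_poly w f"

lemma filtered_polyD:
  assumes "filtered_poly w f"
  shows "y \<in> H \<Longrightarrow> f y \<in> F w" "h \<in> H \<Longrightarrow> filtered_poly (Suc w) (difference G A h f)"
  using assms by (auto elim: filtered_poly.cases)

lemma filtered_poly_cong:
  assumes "filtered_poly w f" "\<And>y. y \<in> H \<Longrightarrow> f y = g y"
  shows "filtered_poly w g"
proof -
  have "\<exists>f. filtered_poly w f \<and> (\<forall>y\<in>H. f y = g y)" using assms by blast
  then show ?thesis
  proof (coinduction arbitrary: w g)
    case filtered_poly
    then obtain f where f: "filtered_poly w f" "\<forall>y\<in>H. f y = g y" by blast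
    have "\<forall>y\<in>H. difference G A h f y = difference G A h g y" if "h \<in> H" for h
      using f(2) that by (simp add: difference_def)
    then show ?case using f filtered_polyD[OF f(1)] by (metis (no_types, lifting))
  qed
qed

lemma filtered_poly_Suc:
  assumes "filtered_poly (Suc w) f"
  shows "filtered_poly w f"
  using assms
proof (coinduction arbitrary: w f)
  case filtered_poly
  then show ?case using filtered_polyD[OF filtered_poly] F_Suc[of w] by blast
qed

lemma filtered_poly_antimono:
  assumes "v \<le> w" "filtered_poly w f"
  shows "filtered_poly v f"
  using assms by (induction v rule: inc_induct) (auto intro: filtered_poly_Suc)

lemma filtered_poly_one:
  assumes "\<And>y. y \<in> H \<Longrightarrow> f y = \<one>"
  shows "filtered_poly w f"
proof -
  have "\<forall>y\<in>H. f y = \<one>" using assms by blast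
  then show ?thesis
  proof (coinduction arbitrary: w f)
    case filtered_poly
    have "\<one> \<in> F w" by (rule subgroup.one_closed[OF subgroup_F])
    moreover have "\<forall>y\<in>H. difference G A h f y = \<one>" if "h \<in> H" for h
      using filtered_poly that by (simp add: difference_def)
    ultimately show ?case using filtered_poly by (metis (no_types, lifting))
  qed
qed

lemma filtered_poly_const:
  assumes "a \<in> F w"
  shows "filtered_poly w (\<lambda>_. a)"
  by (rule filtered_poly.intros)
    (use assms F_carrier[OF assms] in \<open>auto simp: difference_def intro!: filtered_poly_one\<close>)

lemma filtered_poly_trivial: "c \<le> w \<Longrightarrow> filtered_poly w f \<Longrightarrow> y \<in> H \<Longrightarrow> f y = \<one>"
  using filtered_polyD(1) F_eq_one by blast

text \<open>Each difference climbs one level, and from level \<open>c\<close> on only the trivial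
  map is left.\<close>

lemma degree_less_filtered_poly:
  assumes "filtered_poly w f"
  shows "degree_less G H A (c - w) f"
proof -
  have "degree_less G H A n f" if "n = c - w" for n
    using that assms
  proof (induction n arbitrary: w f)
    case 0
    then show ?case using filtered_poly_trivial[of w f] by simp
  next
    case (Suc n)
    have "n = c - Suc w" using Suc.prems(1) by simp
    then show ?case using Suc.IH[of "Suc w"] filtered_polyD(2)[OF Suc.prems(2)] by simp
  qed
  then show ?thesis by simp
qed

lemma filtered_poly_step:
  assumes "filtered_poly w f" "y \<in> H" "h \<in> H"
  shows "f y \<in> carrier A" "difference G A h f y \<in> carrier A"
    "f (y \<otimes>\<^bsub>G\<^esub> h) = f y \<otimes> difference G A h f y"
proof -
  have f: "f y \<in> carrier A" "f (y \<otimes>\<^bsub>G\<^esub> h) \<in> carrier A"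
    using filtered_polyD(1)[OF assms(1)] assms(2,3) F_carrier by (blast intro: G.H.m_closed)+
  then show "f y \<in> carrier A" "difference G A h f y \<in> carrier A"
    "f (y \<otimes>\<^bsub>G\<^esub> h) = f y \<otimes> difference G A h f y"
    by (simp_all add: difference_def)
qed

section \<open>Products, inverses and commutators of filtered polynomial maps\<close>

definition mult_closed :: "nat \<Rightarrow> bool" where
  "mult_closed w \<longleftrightarrow> (\<forall>f g. filtered_poly w f \<longrightarrow> filtered_poly w g \<longrightarrow> filtered_poly w (\<lambda>y. f y \<otimes> g y))"

definition inv_poly_closed :: "nat \<Rightarrow> bool" where
  "inv_poly_closed w \<longleftrightarrow> (\<forall>f. filtered_poly w f \<longrightarrow> filtered_poly w (\<lambda>y. inv f y))"

definition commutator_closed :: "nat \<Rightarrow> nat \<Rightarrow> bool" where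
  "commutator_closed v w \<longleftrightarrow> (\<forall>f g. filtered_poly v f \<longrightarrow> filtered_poly w g \<longrightarrow>
    filtered_poly (v + w) (\<lambda>y. f y \<otimes> g y \<otimes> inv f y \<otimes> inv g y))"

text \<open>A conjugate of \<open>u\<close> is a commutator with \<open>u\<close> times
  \<open>u\<close>, and the commutator of level \<open>v + w\<close> also has level
  \<open>w\<close>.\<close>

lemma filtered_poly_conj:
  assumes "commutator_closed v w" "mult_closed w" "filtered_poly v f" "filtered_poly w u"
  shows "filtered_poly w (\<lambda>y. f y \<otimes> u y \<otimes> inv f y)"
proof -
  have "filtered_poly w (\<lambda>y. f y \<otimes> u y \<otimes> inv f y \<otimes> inv u y)"
    using assms(1,3,4) filtered_poly_antimono[of w "v + w"] by (auto simp: commutator_closed_def)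
  then have "filtered_poly w (\<lambda>y. f y \<otimes> u y \<otimes> inv f y \<otimes> inv u y \<otimes> u y)"
    using assms(2,4) by (simp add: mult_closed_def)
  then show ?thesis
    by (rule filtered_poly_cong)
      (use filtered_poly_step[OF assms(3)] filtered_poly_step[OF assms(4)] in \<open>simp add: word_simps\<close>)
qed

text \<open>The Lazard--Leibman theorem, that the polynomial maps form a group, is proved by downward induction
  on the total level \<open>s = v + w\<close> of commutators. Commutators of level above \<open>s\<close> give products and
  inverses in level \<open>w\<close> only for \<open>2 w \<ge> s\<close>; this is why the case \<open>v \<le> w\<close> comes first below and the
  formula for the difference of a commutator inverts \<open>g\<close> but none of \<open>f\<close>, \<open>a\<close>, \<open>b\<close> on its own.\<close>

lemma mult_inv_closed_step:
  assumes comm: "\<And>v w. Suc s \<le> v + w \<Longrightarrow> commutator_closed v w" and w: "s \<le> 2 * w"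
    and IH: "mult_closed (Suc w)" "inv_poly_closed (Suc w)"
  shows "mult_closed w \<and> inv_poly_closed w"
proof -
  \<comment> \<open>Conjugating \<open>u\<close> by \<open>f\<close> brings in a commutator of level
    \<open>w + Suc w\<close>, which \<open>comm\<close> covers because
    \<open>s \<le> 2 * w\<close>.\<close>
  have conj: "filtered_poly (Suc w) (\<lambda>y. f y \<otimes> u y \<otimes> inv f y)"
    if "filtered_poly w f" "filtered_poly (Suc w) u" for f u
    by (rule filtered_poly_conj[OF comm IH(1) that]) (use w in simp)
  have inv: "filtered_poly w (\<lambda>y. inv f y)" if f: "filtered_poly w f" for f
  proof (rule filtered_poly.intros)
    show "inv f y \<in> F w" if "y \<in> H" for y
      using filtered_polyD(1)[OF f that] by (rule subgroup.m_inv_closed[OF subgroup_F])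
    fix h assume h: "h \<in> H"
    let ?a = "difference G A h f"
    \<comment> \<open>With \<open>f (y h) = f a\<close>, the difference of the inverse is
      \<open>f (f a)^-1 = (f a f^-1)^-1\<close>.\<close>
    have "filtered_poly (Suc w) (\<lambda>y. inv (f y \<otimes> ?a y \<otimes> inv f y))"
      using conj[OF f filtered_polyD(2)[OF f h]] IH(2) by (simp add: inv_poly_closed_def)
    then show "filtered_poly (Suc w) (difference G A h (\<lambda>y. inv f y))"
    proof (rule filtered_poly_cong)
      fix y assume y: "y \<in> H"
      note st = filtered_poly_step[OF f y h]
      show "inv (f y \<otimes> ?a y \<otimes> inv f y) = difference G A h (\<lambda>y. inv f y) y"
        unfolding difference_def[of G A h "\<lambda>y. inv f y"] st(3) using st(1,2) by (simp add: word_simps)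
    qed
  qed
  moreover have "filtered_poly w (\<lambda>y. f y \<otimes> g y)" if f: "filtered_poly w f" and g: "filtered_poly
      w g" for f g
  proof (rule filtered_poly.intros)
    show "f y \<otimes> g y \<in> F w" if "y \<in> H" for y
      using filtered_polyD(1)[OF f that] filtered_polyD(1)[OF g that]
      by (rule subgroup.m_closed[OF subgroup_F])
    fix h assume h: "h \<in> H"
    let ?a = "difference G A h f" and ?b = "difference G A h g"
    \<comment> \<open>With \<open>f (y h) = f a\<close> and \<open>g (y h) = g b\<close>, the
      difference of the product is \<open>(f g)^-1 f a g b = (g^-1 a g) b\<close>.\<close>
    have "filtered_poly (Suc w) (\<lambda>y. (inv g y \<otimes> ?a y \<otimes> inv (inv g y)) \<otimes> ?b y)"
      using conj[OF inv[OF g] filtered_polyD(2)[OF f h]] filtered_polyD(2)[OF g h] IH(1)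
      by (simp add: mult_closed_def)
    then show "filtered_poly (Suc w) (difference G A h (\<lambda>y. f y \<otimes> g y))"
    proof (rule filtered_poly_cong)
      fix y assume y: "y \<in> H"
      note st = filtered_poly_step[OF f y h] filtered_poly_step[OF g y h]
      show "inv g y \<otimes> ?a y \<otimes> inv (inv g y) \<otimes> ?b y = difference G A h (\<lambda>y. f y \<otimes> g y) y"
        unfolding difference_def[of G A h "\<lambda>y. f y \<otimes> g y"] st(3) st(6)
        using st(1,2,4,5) by (simp add: word_simps)
    qed
  qed
  ultimately show ?thesis by (simp add: mult_closed_def inv_poly_closed_def)
qed

lemma mult_inv_closed_trivial:
  assumes "c \<le> w"
  shows "mult_closed w \<and> inv_poly_closed w"
  unfolding mult_closed_def inv_poly_closed_def
proof (intro conjI allI impI filtered_poly_one)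
  fix f g y assume "filtered_poly w f" "filtered_poly w g" "y \<in> H"
  then have "f y = \<one>" "g y = \<one>" using filtered_poly_trivial[OF assms] by blast+
  then show "f y \<otimes> g y = \<one>" by simp
next
  fix f y assume "filtered_poly w f" "y \<in> H"
  then have "f y = \<one>" using filtered_poly_trivial[OF assms] by blast
  then show "inv f y = \<one>" by simp
qed

lemma mult_inv_closed:
  assumes comm: "\<And>v w. Suc s \<le> v + w \<Longrightarrow> commutator_closed v w" and w: "s \<le> 2 * w"
  shows "mult_closed w \<and> inv_poly_closed w"
proof (cases "w \<le> c")
  case True
  then show ?thesis using w
  proof (induction w rule: inc_induct)
    case (step n)
    then show ?case by (intro mult_inv_closed_step[OF comm]) auto
  qed (simp add: mult_inv_closed_trivial)
qed (simp add: mult_inv_closed_trivial)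

lemma commutator_closed_step:
  assumes comm: "\<And>v w. Suc s \<le> v + w \<Longrightarrow> commutator_closed v w" and s: "v + w = s"
  shows "commutator_closed v w"
proof -
  note closed = mult_inv_closed[where s = s, OF comm]
  have le: "filtered_poly (v + w) (\<lambda>y. f y \<otimes> g y \<otimes> inv f y \<otimes> inv g y)"
    if vw: "v + w = s" "v \<le> w" and f: "filtered_poly v f" and g: "filtered_poly w g" for v w f g
  proof (rule filtered_poly.intros)
    show "f y \<otimes> g y \<otimes> inv f y \<otimes> inv g y \<in> F (v + w)" if "y \<in> H" for y
      using filtered_polyD(1)[OF f that] filtered_polyD(1)[OF g that] by (rule F_commutator)
    fix h assume h: "h \<in> H"
    let ?a = "difference G A h f" and ?b = "difference G A h g"
    have a: "filtered_poly (Suc v) ?a" and b: "filtered_poly (Suc w) ?b"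
      using filtered_polyD(2)[OF f h] filtered_polyD(2)[OF g h] by auto
    have mult: "mult_closed (Suc s)" using closed[of "Suc s"] by simp
    have conj: "filtered_poly (Suc s) (\<lambda>y. k y \<otimes> u y \<otimes> inv k y)"
      if "filtered_poly i k" "filtered_poly (Suc s) u" for i k u
      by (rule filtered_poly_conj[OF comm mult that]) simp
    have com: "filtered_poly (Suc s) (\<lambda>y. k y \<otimes> u y \<otimes> inv k y \<otimes> inv u y)"
      if "filtered_poly i k" "filtered_poly j u" "Suc s \<le> i + j" for i j k u
      using comm[OF that(3)] that filtered_poly_antimono by (auto simp: commutator_closed_def)
    \<comment> \<open>Write \<open>[x, y]\<close> for \<open>x y x^-1 y^-1\<close>. The difference
      of \<open>[f, g]\<close> is the conjugate by \<open>g\<close> of the product of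
      \<open>f [g^-1, a] f^-1\<close>, \<open>f [a, b] f^-1\<close> and \<open>[f, b]\<close>. All
      three commutators have level at least \<open>Suc s\<close>. The inverse of \<open>g\<close> is
      available at level \<open>w\<close> because \<open>v \<le> w\<close> gives
      \<open>s \<le> 2 * w\<close>.\<close>
    have "filtered_poly w (\<lambda>y. inv g y)"
      using closed[of w] g vw by (simp add: inv_poly_closed_def)
    then have p1: "filtered_poly (Suc s) (\<lambda>y. f y \<otimes> (inv g y \<otimes> ?a y \<otimes> inv (inv g y) \<otimes> inv ?a y) \<otimes>
        inv f y)"
      using conj[OF f com[OF _ a]] vw by simp
    have p2: "filtered_poly (Suc s) (\<lambda>y. f y \<otimes> (?a y \<otimes> ?b y \<otimes> inv ?a y \<otimes> inv ?b y) \<otimes> inv f y)"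
      using conj[OF f com[OF a b]] vw by simp
    have p3: "filtered_poly (Suc s) (\<lambda>y. f y \<otimes> ?b y \<otimes> inv f y \<otimes> inv ?b y)"
      using com[OF f b] vw by simp
    have m: "filtered_poly (Suc s) (\<lambda>y. k y \<otimes> u y)"
      if "filtered_poly (Suc s) k" "filtered_poly (Suc s) u" for k u
      using mult that by (simp add: mult_closed_def)
    have "filtered_poly (Suc s) (difference G A h (\<lambda>y. f y \<otimes> g y \<otimes> inv f y \<otimes> inv g y))"
    proof (rule filtered_poly_cong[OF conj[OF g m[OF m[OF p1 p2] p3]]])
      fix y assume y: "y \<in> H"
      note st = filtered_poly_step[OF f y h] filtered_poly_step[OF g y h]
      show "g y \<otimes> (f y \<otimes> (inv g y \<otimes> ?a y \<otimes> inv (inv g y) \<otimes> inv ?a y) \<otimes> inv f y \<otimes>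
          (f y \<otimes> (?a y \<otimes> ?b y \<otimes> inv ?a y \<otimes> inv ?b y) \<otimes> inv f y) \<otimes>
          (f y \<otimes> ?b y \<otimes> inv f y \<otimes> inv ?b y)) \<otimes> inv g y =
          difference G A h (\<lambda>y. f y \<otimes> g y \<otimes> inv f y \<otimes> inv g y) y"
        unfolding difference_def[of G A h "\<lambda>y. f y \<otimes> g y \<otimes> inv f y \<otimes> inv g y"] st(3) st(6)
        using st(1,2,4,5) by (simp add: word_simps)
    qed
    then show "filtered_poly (Suc (v + w)) (difference G A h (\<lambda>y. f y \<otimes> g y \<otimes> inv f y \<otimes> inv g y))"
      using vw by simp
  qed
  show ?thesis
  proof (cases "v \<le> w")
    case True
    then show ?thesis using le s by (simp add: commutator_closed_def)
  next
    case False
    \<comment> \<open>\<open>[f, g]\<close> is the inverse of \<open>[g, f]\<close>, to which the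
      first case applies, and at level \<open>s\<close> inverses are available since
      \<open>s \<le> 2 * s\<close>.\<close>
    have "filtered_poly s (\<lambda>y. f y \<otimes> g y \<otimes> inv f y \<otimes> inv g y)"
      if f: "filtered_poly v f" and g: "filtered_poly w g" for f g
    proof -
      have "filtered_poly s (\<lambda>y. g y \<otimes> f y \<otimes> inv g y \<otimes> inv f y)"
        using le[OF _ _ g f] False s by (simp add: add.commute)
      then have "filtered_poly s (\<lambda>y. inv (g y \<otimes> f y \<otimes> inv g y \<otimes> inv f y))"
        using closed[of s] by (simp add: inv_poly_closed_def)
      then show ?thesis
      proof (rule filtered_poly_cong)
        fix y assume y: "y \<in> H"
        then show "inv (g y \<otimes> f y \<otimes> inv g y \<otimes> inv f y) = f y \<otimes> g y \<otimes> inv f y \<otimes> inv g y"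
          using filtered_poly_step(1)[OF f y y] filtered_poly_step(1)[OF g y y]
              by (simp add: word_simps)
      qed
    qed
    then show ?thesis using s by (simp add: commutator_closed_def)
  qed
qed

lemma commutator_closed: "commutator_closed v w"
proof -
  have "\<forall>v w. s \<le> v + w \<longrightarrow> commutator_closed v w" if "s \<le> c" for s
    using that
  proof (induction s rule: inc_induct)
    case base
    show ?case
      unfolding commutator_closed_def
    proof (intro allI impI filtered_poly_one)
      fix v w f g y assume *: "c \<le> v + w" "filtered_poly v f" "filtered_poly w g" "y \<in> H"
      show "f y \<otimes> g y \<otimes> inv f y \<otimes> inv g y = \<one>"
        by (rule F_eq_one[OF *(1)]) (intro F_commutator filtered_polyD *)
    qed
  next
    case (step n)
    then have "commutator_closed v w" if "Suc n \<le> v + w" for v w using that by blast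
    from commutator_closed_step[OF this] step show ?case by (metis not_less_eq_eq le_antisym)
  qed
  then show ?thesis by blast
qed

text \<open>For \<open>s = 0\<close> the restriction \<open>s \<le> 2 * w\<close> is void, so level
  0, where the words live, is included.\<close>

lemma filtered_poly_mult:
  "filtered_poly w f \<Longrightarrow> filtered_poly w g \<Longrightarrow> filtered_poly w (\<lambda>y. f y \<otimes> g y)"
  and filtered_poly_inv: "filtered_poly w f \<Longrightarrow> filtered_poly w (\<lambda>y. inv f y)"
  using mult_inv_closed[of 0 w] commutator_closed by (auto simp: mult_closed_def inv_poly_closed_def)

end

section \<open>Zero sets of nilpotent-valued polynomial maps\<close>

text \<open>Commutators of \<open>F j\<close> lie in \<open>F (j + j)\<close>, which is contained in
  \<open>F (Suc j)\<close> exactly because \<open>j\<close> is positive.\<close>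

lemma (in filtered_group) comm_group_quotient:
  assumes "0 < j"
  shows "comm_group (A\<lparr>carrier := F j\<rparr> Mod F (Suc j))"
proof -
  have N: "F (Suc j) \<lhd> A\<lparr>carrier := F j\<rparr>"
    by (rule normal_restrict_supergroup[OF subgroup_F normal_F F_Suc])
  interpret N: normal "F (Suc j)" "A\<lparr>carrier := F j\<rparr>" by (rule N)
  show ?thesis
  proof (rule group.group_comm_groupI[OF N.factorgroup_is_group])
    fix X Y assume "X \<in> carrier (A\<lparr>carrier := F j\<rparr> Mod F (Suc j))" "Y \<in> carrier (A\<lparr>carrier := F j\<rparr>
        Mod F (Suc j))"
    then obtain a b where ab: "a \<in> F j" "b \<in> F j"
      "X = F (Suc j) #>\<^bsub>A\<lparr>carrier := F j\<rparr>\<^esub> a" "Y = F (Suc j) #>\<^bsub>A\<lparr>carrier := F j\<rparr>\<^esub> b"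
      by (auto simp: FactGroup_def RCOSETS_def)
    have c: "a \<in> carrier A" "b \<in> carrier A" using ab F_carrier by auto
    have "a \<otimes> b \<otimes> inv a \<otimes> inv b \<in> F (Suc j)"
      using F_commutator[OF ab(1,2)] F_antimono[of "Suc j" "j + j"] assms by auto
    then have "a \<otimes> b \<in> F (Suc j) #> (b \<otimes> a)"
      unfolding r_coset_def using c by (auto intro!: bexI simp: word_simps)
    then have "F (Suc j) #> (b \<otimes> a) = F (Suc j) #> (a \<otimes> b)"
      by (rule repr_independence) (use c in \<open>auto intro: subgroup_F\<close>)
    moreover have "(F (Suc j) #>\<^bsub>A\<lparr>carrier := F j\<rparr>\<^esub> x) = F (Suc j) #> x" for x
      by (simp add: r_coset_def)
    ultimately show "X \<otimes>\<^bsub>A\<lparr>carrier := F j\<rparr> Mod F (Suc j)\<^esub> Y = Y \<otimes>\<^bsub>A\<lparr>carrier := F j\<rparr> Mod F (Suc j)\<^esub> X"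
      using N.rcos_sum[of a b] N.rcos_sum[of b a] ab by (simp add: FactGroup_def)
  qed
qed

locale upper_density_fg = upper_density G dens for G :: "('g, 'm) monoid_scheme" (structure) and dens +
  fixes S0 :: "'g set"
  assumes S0: "finite S0" "S0 \<subseteq> carrier G" "generate G S0 = carrier G"
begin

text \<open>The induction runs over the term \<open>F j\<close> containing the values and ends at
  \<open>F c\<close>, while the bound \<open>n\<close> stays fixed. A bound on the degree in
  \<open>A\<close> is inherited by restrictions, left translates and quotients, so the descent does
  not have to carry the filtered notion along. Each step moves to a smaller domain \<open>K\<close>,
  base point \<open>x \<otimes> y\<close> and the part of \<open>S\<close> in that coset.\<close>

lemma nilpotent_zero_coset:
  assumes "filtered_group A F c" and "0 < j" "j \<le> c"
    and "finite_index_subgroup H G" "f \<in> H \<rightarrow> F j" "degree_less G H A n f" "x \<in> carrier G"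
    and "S \<subseteq> {x \<otimes> y | y. y \<in> H \<and> f y = \<one>\<^bsub>A\<^esub>}" "dens S > 0"
  shows "\<exists>y\<in>H. \<exists>K. finite_index_subgroup K G \<and> K \<subseteq> H \<and> (\<forall>k\<in>K. f (y \<otimes> k) = \<one>\<^bsub>A\<^esub>)"
proof -
  interpret A: filtered_group A F c by fact
  show ?thesis using assms(3,2,4-)
  proof (induction j arbitrary: H f x S rule: inc_induct)
    case base
    have "subgroup H G" using base by (simp add: finite_index_subgroup_def)
    then interpret H: subgroup H G .
    have "f (\<one> \<otimes> k) = \<one>\<^bsub>A\<^esub>" if "k \<in> H" for k
      using base.prems(3) A.F_trivial that by auto
    then show ?case
      using base.prems(2) H.one_closed by blast
  next
    case (step j)
    note prems = step.prems
    have subH: "subgroup H G" using prems(2) by (simp add: finite_index_subgroup_def)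
    \<comment> \<open>Every new domain must be finitely generated again: it provides both the
      finiteness of sets of polynomial maps and the finite generation of images.\<close>
    obtain U where U: "finite U" "U \<subseteq> H" "generate G U = H"
      using finite_index_finitely_generated[OF S0 prems(2)] by blast
    interpret upper_density_domain G dens H U
      by (intro upper_density_domain.intro poly_domain.intro poly_domain_axioms.intro
          upper_density_domain_axioms.intro upper_density_axioms is_group subH prems(2) U)
    define B where "B = A\<lparr>carrier := F j\<rparr> Mod F (Suc j)"
    define q where "q a = F (Suc j) #>\<^bsub>A\<lparr>carrier := F j\<rparr>\<^esub> a" for a
    have N: "F (Suc j) \<lhd> A\<lparr>carrier := F j\<rparr>"
      by (rule A.normal_restrict_supergroup[OF A.subgroup_F A.normal_F A.F_Suc])
    interpret N: normal "F (Suc j)" "A\<lparr>carrier := F j\<rparr>" by (rule N)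
    interpret B: comm_group B unfolding B_def by (rule A.comm_group_quotient[OF prems(1)])
    have grpF: "group (A\<lparr>carrier := F j\<rparr>)" by (rule N.is_group)
    have q: "q \<in> hom (A\<lparr>carrier := F j\<rparr>) B"
      unfolding q_def B_def using N.r_coset_hom_Mod by simp
    have qone: "q a = \<one>\<^bsub>B\<^esub> \<longleftrightarrow> a \<in> F (Suc j)" if "a \<in> F j" for a
    proof
      assume "q a = \<one>\<^bsub>B\<^esub>"
      then show "a \<in> F (Suc j)"
        using group.coset_join1[OF grpF _ _ N.subgroup_axioms, of a] that by (simp add: q_def B_def)
    next
      assume "a \<in> F (Suc j)"
      then show "q a = \<one>\<^bsub>B\<^esub>"
        using group.coset_join2[OF grpF _ N.subgroup_axioms, of a] that by (simp add: q_def B_def)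
    qed
    have fF: "f y \<in> F j" if "y \<in> H" for y using that prems(3) by auto
    have deg: "degree_less G H B n (\<lambda>y. q (f y))"
      by (rule degree_less_hom[OF grpF B.is_group q])
        (use prems(3,4) degree_less_subgroup_codomain[OF A.is_group A.subgroup_F prems(3)] in auto)
    have qf: "(\<lambda>y. q (f y)) \<in> H \<rightarrow> carrier B" using fF hom_carrier[OF q] by auto
    have "\<one>\<^bsub>A\<^esub> \<in> F (Suc j)" by (rule subgroup.one_closed[OF A.subgroup_F])
    then have "q (f y) = \<one>\<^bsub>B\<^esub>" if "y \<in> H" "f y = \<one>\<^bsub>A\<^esub>" for y
      using qone[OF fF[OF that(1)]] that(2) by simp
    then have "S \<subseteq> {x \<otimes> y | y. y \<in> H \<and> q (f y) = \<one>\<^bsub>B\<^esub>}" using prems(6) by blast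
    then obtain y K where yK: "y \<in> H" "finite_index_subgroup K G" "K \<subseteq> H"
      "\<And>k. k \<in> K \<Longrightarrow> q (f (y \<otimes> k)) = \<one>\<^bsub>B\<^esub>" "dens (S \<inter> ((x \<otimes> y) <# K)) > 0"
      using abelian_zero_coset[OF B.comm_group_axioms qf deg prems(5) _ prems(7)] by blast
    have "\<exists>z\<in>K. \<exists>L. finite_index_subgroup L G \<and> L \<subseteq> K \<and> (\<forall>k\<in>L. f (y \<otimes> (z \<otimes> k)) = \<one>\<^bsub>A\<^esub>)"
    proof (rule step.IH[of K "\<lambda>k. f (y \<otimes> k)" "x \<otimes> y" "S \<inter> ((x \<otimes> y) <# K)"])
      show "0 < Suc j" "finite_index_subgroup K G" "0 < dens (S \<inter> (x \<otimes> y <# K))" using yK by auto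
      show "(\<lambda>k. f (y \<otimes> k)) \<in> K \<rightarrow> F (Suc j)"
        using yK qone fF by blast
      show "degree_less G K A n (\<lambda>k. f (y \<otimes> k))"
        by (rule degree_less_subset[OF degree_less_left_translate[OF yK(1) prems(4)] yK(3)])
      show "x \<otimes> y \<in> carrier G" using yK(1) prems(5) by simp
      show "S \<inter> (x \<otimes> y <# K) \<subseteq> {x \<otimes> y \<otimes> k | k. k \<in> K \<and> f (y \<otimes> k) = \<one>\<^bsub>A\<^esub>}"
      proof
        fix s assume s: "s \<in> S \<inter> (x \<otimes> y <# K)"
        then obtain k where k: "k \<in> K" "s = x \<otimes> y \<otimes> k" by (auto simp: l_coset_def)
        obtain y' where y': "y' \<in> H" "s = x \<otimes> y'" "f y' = \<one>\<^bsub>A\<^esub>" using s prems(6) by auto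
        have "k \<in> H" using k yK(3) by auto
        then have "x \<otimes> y' = x \<otimes> (y \<otimes> k)" using k y' yK(1) prems(5) by (simp add: m_assoc)
        then have "y' = y \<otimes> k" using y'(1) yK(1) \<open>k \<in> H\<close> prems(5) by simp
        then show "s \<in> {x \<otimes> y \<otimes> k | k. k \<in> K \<and> f (y \<otimes> k) = \<one>\<^bsub>A\<^esub>}" using k y' by blast
      qed
    qed
    then obtain z L where zL: "z \<in> K" "finite_index_subgroup L G" "L \<subseteq> K"
      "\<And>k. k \<in> L \<Longrightarrow> f (y \<otimes> (z \<otimes> k)) = \<one>\<^bsub>A\<^esub>" by blast
    show ?case
    proof (intro bexI[of _ "y \<otimes> z"] exI[of _ L] conjI ballI)
      show "y \<otimes> z \<in> H" using yK zL by auto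
      show "L \<subseteq> H" using yK zL by auto
      fix k assume k: "k \<in> L"
      then have "y \<otimes> z \<otimes> k = y \<otimes> (z \<otimes> k)" using yK(1,3) zL(1,3) by (intro m_assoc) auto
      then show "f (y \<otimes> z \<otimes> k) = \<one>\<^bsub>A\<^esub>" using zL(4)[OF k] by simp
    qed (rule zL)
  qed
qed

end

text \<open>For this filtration \<open>[F\<^sub>i, F\<^sub>j] \<subseteq> F\<^sub>i\<^sub>+\<^sub>j\<close> holds by construction, whereas for the lower central
  series it needs the three subgroups lemma. The price is the crude comparison of \<open>F\<close> at \<open>2\<^sup>m\<close> with the
  \<open>m\<close>-th term of the lower central series.\<close>

function (in group) commutator_filtration :: "'a set \<Rightarrow> nat \<Rightarrow> 'a set" where
  "commutator_filtration N n =
    (if n = 0 then carrier G else if n = 1 then N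
     else generate G (\<Union>i\<in>{1..<n}. \<Union>a\<in>commutator_filtration N i. \<Union>b\<in>commutator_filtration N (n - i).
      {a \<otimes> b \<otimes> inv a \<otimes> inv b}))"
  by pat_completeness auto
termination (in group) commutator_filtration
  by (relation "Wellfounded.measure snd") auto

declare (in group) commutator_filtration.simps [simp del]

context group
begin

lemma commutator_filtration_0 [simp]: "commutator_filtration N 0 = carrier G"
  and commutator_filtration_1 [simp]: "commutator_filtration N (Suc 0) = N"
  by (simp_all add: commutator_filtration.simps)

lemma commutator_filtration_ge_2:
  assumes "2 \<le> n"
  shows "commutator_filtration N n = generate G (\<Union>i\<in>{1..<n}. \<Union>a\<in>commutator_filtration N i.
    \<Union>b\<in>commutator_filtration N (n - i). {a \<otimes> b \<otimes> inv a \<otimes> inv b})"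
  using assms by (subst commutator_filtration.simps) simp

lemma normal_commutator_filtration:
  assumes "N \<lhd> G"
  shows "commutator_filtration N n \<lhd> G"
proof (induction n rule: less_induct)
  case (less n)
  consider "n = 0" | "n = 1" | "2 \<le> n" by linarith
  then show ?case
  proof cases
    case 1
    then show ?thesis by (auto intro!: normal_invI subgroup_self)
  next
    case 3
    have IH: "commutator_filtration N i \<lhd> G" if "i < n" for i using less that .
    have sub: "commutator_filtration N i \<subseteq> carrier G" if "i < n" for i
      using subgroup.subset[OF normal_imp_subgroup[OF IH[OF that]]] .
    show ?thesis unfolding commutator_filtration_ge_2[OF 3]
    proof (rule normal_generateI)
      show "(\<Union>i\<in>{1..<n}. \<Union>a\<in>commutator_filtration N i. \<Union>b\<in>commutator_filtration N (n - i).
          {a \<otimes> b \<otimes> inv a \<otimes> inv b}) \<subseteq> carrier G"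
      proof clarify
        fix i a b assume i: "i \<in> {1..<n}" and ab: "a \<in> commutator_filtration N i" "b \<in>
            commutator_filtration N (n - i)"
        then have "a \<in> carrier G" "b \<in> carrier G" using sub[of i] sub[of "n - i"] by auto
        then show "a \<otimes> b \<otimes> inv a \<otimes> inv b \<in> carrier G" by simp
      qed
      fix h g assume "h \<in> (\<Union>i\<in>{1..<n}. \<Union>a\<in>commutator_filtration N i. \<Union>b\<in>commutator_filtration N (n - i).
          {a \<otimes> b \<otimes> inv a \<otimes> inv b})" and g: "g \<in> carrier G"
      then obtain i a b where i: "i \<in> {1..<n}"
        and ab: "a \<in> commutator_filtration N i" "b \<in> commutator_filtration N (n - i)"
        and h: "h = a \<otimes> b \<otimes> inv a \<otimes> inv b" by blast
      have c: "a \<in> carrier G" "b \<in> carrier G" using sub[of i] sub[of "n - i"] i ab by auto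
      have "g \<otimes> a \<otimes> inv g \<in> commutator_filtration N i"
        using normal.inv_op_closed2[OF IH g ab(1)] i by simp
      moreover have "g \<otimes> b \<otimes> inv g \<in> commutator_filtration N (n - i)"
        using normal.inv_op_closed2[OF IH g ab(2)] i by simp
      moreover have "g \<otimes> h \<otimes> inv g = (g \<otimes> a \<otimes> inv g) \<otimes> (g \<otimes> b \<otimes> inv g) \<otimes> inv (g \<otimes> a \<otimes> inv g) \<otimes> inv
          (g \<otimes> b \<otimes> inv g)"
        unfolding h using c g by (simp add: word_simps)
      ultimately show "g \<otimes> h \<otimes> inv g \<in> (\<Union>i\<in>{1..<n}. \<Union>a\<in>commutator_filtration N i.
          \<Union>b\<in>commutator_filtration N (n - i). {a \<otimes> b \<otimes> inv a \<otimes> inv b})"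
        using i by blast
    qed
  qed (use assms in simp)
qed

lemma commutator_filtration_commutator:
  assumes N: "N \<lhd> G" and a: "a \<in> commutator_filtration N i" and b: "b \<in> commutator_filtration N j"
  shows "a \<otimes> b \<otimes> inv a \<otimes> inv b \<in> commutator_filtration N (i + j)"
proof -
  note norm = normal_commutator_filtration[OF N]
  have sub: "subgroup (commutator_filtration N i) G" for i by (rule normal_imp_subgroup[OF norm])
  have c: "a \<in> carrier G" "b \<in> carrier G" using a b subgroup.subset[OF sub] by auto
  consider "i = 0" | "j = 0" | "i > 0" "j > 0" by auto
  then show ?thesis
  proof cases
    case 1
    have "(a \<otimes> b \<otimes> inv a) \<otimes> inv b \<in> commutator_filtration N j"
      by (rule subgroup.m_closed[OF sub normal.inv_op_closed2[OF norm c(1) b]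
          subgroup.m_inv_closed[OF sub b]])
    then show ?thesis using 1 by simp
  next
    case 2
    have "a \<otimes> (b \<otimes> inv a \<otimes> inv b) \<in> commutator_filtration N i"
      by (rule subgroup.m_closed[OF sub a
            normal.inv_op_closed2[OF norm c(2) subgroup.m_inv_closed[OF sub a]]])
    then show ?thesis using 2 c by (simp add: m_assoc)
  next
    case 3
    then have "i \<in> {1..<i + j}" "j = i + j - i" "2 \<le> i + j" by auto
    then show ?thesis
      unfolding commutator_filtration_ge_2[OF \<open>2 \<le> i + j\<close>]
      using a b by (intro generate.incl UN_I[of i] UN_I[of a] UN_I[of b] singletonI) auto
  qed
qed

text \<open>For a generating commutator of term \<open>Suc n\<close>, the induction hypothesis
  lowers the index of one entry by one, which puts the commutator into term \<open>n\<close>. When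
  both entries have index 1, closure of \<open>N\<close> suffices.\<close>

lemma commutator_filtration_Suc:
  assumes N: "N \<lhd> G"
  shows "commutator_filtration N (Suc n) \<subseteq> commutator_filtration N n"
proof (induction n rule: less_induct)
  case (less n)
  note norm = normal_commutator_filtration[OF N]
  have sub: "subgroup (commutator_filtration N i) G" for i by (rule normal_imp_subgroup[OF norm])
  consider "n = 0" | "n > 0" by linarith
  then show ?case
  proof cases
    case 2
    then have n: "2 \<le> Suc n" by simp
    show ?thesis unfolding commutator_filtration_ge_2[OF n]
    proof (rule generate_subgroup_incl[OF _ sub], clarify)
      fix i a b assume i: "i \<in> {1..<Suc n}"
        and ab: "a \<in> commutator_filtration N i" "b \<in> commutator_filtration N (Suc n - i)"
      show "a \<otimes> b \<otimes> inv a \<otimes> inv b \<in> commutator_filtration N n"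
      proof (cases "i = 1")
        case True
        show ?thesis
        proof (cases "n = 1")
          case n1: True
          then have "a \<in> N" "b \<in> N" using ab True by auto
          then show ?thesis using n1 N
            by (auto intro!: subgroup.m_closed[OF normal_imp_subgroup[OF N]]
                subgroup.m_inv_closed[OF normal_imp_subgroup[OF N]])
        next
          case False
          then have "b \<in> commutator_filtration N (n - 1)"
            using less[of "n - 1"] ab(2) True 2 by auto
          then show ?thesis
            using commutator_filtration_commutator[OF N ab(1), of b "n - 1"] True 2 by simp
        qed
      next
        case False
        then have "a \<in> commutator_filtration N (i - 1)"
          using less[of "i - 1"] ab(1) i by (cases i) auto
        from commutator_filtration_commutator[OF N this ab(2)] show ?thesis
          using i False by simp
      qed
    qed
  qed (use subgroup.subset[OF sub[of 1]] in simp)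
qed

text \<open>If two indices add up to at least \<open>2 ^ Suc m\<close>, one of them is at least
  \<open>2 ^ m\<close>. That entry lies in the \<open>m\<close>-th lower central term and the other
  one in \<open>H\<close>. If the deep entry is the second one, the commutator is inverted.\<close>

lemma commutator_filtration_subset_lower_central:
  assumes N: "N \<lhd> G" and H: "subgroup H G" "N \<subseteq> H" and n: "2 ^ m \<le> n"
  shows "commutator_filtration N n \<subseteq> lower_central (G\<lparr>carrier := H\<rparr>) m"
  using n
proof (induction m arbitrary: n)
  case 0
  have "commutator_filtration N n \<subseteq> commutator_filtration N 1"
    by (rule lift_Suc_antimono_le[of "commutator_filtration N"])
        (use 0 commutator_filtration_Suc[OF N] in auto)
  then show ?case using H by simp
next
  case (Suc m)
  let ?L = "lower_central (G\<lparr>carrier := H\<rparr>)"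
  note norm = normal_commutator_filtration[OF N]
  have "2 \<le> (2::nat) ^ Suc m" by simp
  then have n: "2 \<le> n" using Suc.prems by (rule order.trans)
  have mono: "commutator_filtration N i \<subseteq> N" if "1 \<le> i" for i
    using lift_Suc_antimono_le[of "commutator_filtration N" 1 i] commutator_filtration_Suc[OF N]
        that by simp
  have grpH: "group (G\<lparr>carrier := H\<rparr>)" by (rule subgroup_imp_group[OF H(1)])
  have inv: "inv\<^bsub>G\<lparr>carrier := H\<rparr>\<^esub> a = inv a" if "a \<in> H" for a using m_inv_consistent[OF H(1) that] .
  have Lsub: "?L i \<subseteq> H" for i
  proof (cases i)
    case (Suc k)
    have "?L k \<subseteq> H \<Longrightarrow> ?L (Suc k) \<subseteq> H" for k
    proof -
      assume L: "?L k \<subseteq> H"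
      have "(\<Union>a\<in>?L k. \<Union>b\<in>carrier (G\<lparr>carrier := H\<rparr>). {a \<otimes>\<^bsub>G\<lparr>carrier := H\<rparr>\<^esub> b \<otimes>\<^bsub>G\<lparr>carrier := H\<rparr>\<^esub>
          inv\<^bsub>G\<lparr>carrier := H\<rparr>\<^esub> a \<otimes>\<^bsub>G\<lparr>carrier := H\<rparr>\<^esub> inv\<^bsub>G\<lparr>carrier := H\<rparr>\<^esub> b}) \<subseteq> carrier (G\<lparr>carrier
              := H\<rparr>)"
        using L H(1) by (auto simp: inv subset_iff intro!: subgroup.m_closed[OF H(1)]
            subgroup.m_inv_closed[OF H(1)])
      from group.generate_incl[OF grpH this] show "?L (Suc k) \<subseteq> H" by simp
    qed
    then have "?L i \<subseteq> H" for i by (induction i) auto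
    then show ?thesis .
  qed simp
  have gen: "a \<otimes> b \<otimes> inv a \<otimes> inv b \<in> ?L (Suc m)" if "a \<in> ?L m" "b \<in> H" for a b
  proof -
    have "a \<otimes> b \<otimes> inv a \<otimes> inv b = a \<otimes>\<^bsub>G\<lparr>carrier := H\<rparr>\<^esub> b \<otimes>\<^bsub>G\<lparr>carrier := H\<rparr>\<^esub>
        inv\<^bsub>G\<lparr>carrier := H\<rparr>\<^esub> a \<otimes>\<^bsub>G\<lparr>carrier := H\<rparr>\<^esub> inv\<^bsub>G\<lparr>carrier := H\<rparr>\<^esub> b"
      using that Lsub[of m] by (simp add: inv subset_iff)
    then show ?thesis using that unfolding lower_central.simps
        by (intro generate.incl) (auto intro!: bexI)
  qed
  have "subgroup (?L (Suc m)) (G\<lparr>carrier := H\<rparr>)"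
    unfolding lower_central.simps
    by (rule group.generate_is_subgroup[OF grpH])
      (use Lsub[of m] H(1) in \<open>auto simp: inv subset_iff intro!: subgroup.m_closed[OF H(1)]
          subgroup.m_inv_closed[OF H(1)]\<close>)
  then have sub: "subgroup (?L (Suc m)) G" by (rule incl_subgroup[OF H(1)])
  show ?case unfolding commutator_filtration_ge_2[OF n]
  proof (rule generate_subgroup_incl[OF _ sub], clarify)
    fix i a b assume i: "i \<in> {1..<n}"
      and ab: "a \<in> commutator_filtration N i" "b \<in> commutator_filtration N (n - i)"
    have "1 \<le> i" "1 \<le> n - i" using i by auto
    then have abH: "a \<in> H" "b \<in> H" using ab mono[of i] mono[of "n - i"] H(2) by blast+
    have abc: "a \<in> carrier G" "b \<in> carrier G" using abH subgroup.subset[OF H(1)] by auto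
    have "2 ^ m \<le> i \<or> 2 ^ m \<le> n - i" using Suc.prems by auto
    then show "a \<otimes> b \<otimes> inv a \<otimes> inv b \<in> ?L (Suc m)"
    proof
      assume "2 ^ m \<le> i"
      then show ?thesis using Suc.IH[of i] ab abH gen by blast
    next
      assume "2 ^ m \<le> n - i"
      then have "b \<otimes> a \<otimes> inv b \<otimes> inv a \<in> ?L (Suc m)" using Suc.IH[of "n - i"] ab abH gen by blast
      then have "inv (b \<otimes> a \<otimes> inv b \<otimes> inv a) \<in> ?L (Suc m)" by (rule subgroup.m_inv_closed[OF sub])
      then show ?thesis using abc by (simp add: word_simps)
    qed
  qed
qed

text \<open>The length is \<open>2 ^ m\<close> for a lower central series of \<open>H\<close>
  reaching the trivial group at \<open>m\<close>. It is positive, so the descent may start at term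
  1.\<close>

lemma filtered_group_commutator_filtration:
  assumes H: "subgroup H G" "nilpotent_group (G\<lparr>carrier := H\<rparr>)" and N: "N \<lhd> G" "N \<subseteq> H"
  obtains c where "0 < c" "filtered_group G (commutator_filtration N) c"
proof -
  obtain m where m: "lower_central (G\<lparr>carrier := H\<rparr>) m = {\<one>}"
    using H(2) by (auto simp: nilpotent_group_def)
  have sub: "subgroup (commutator_filtration N i) G" for i
    by (rule normal_imp_subgroup[OF normal_commutator_filtration[OF N(1)]])
  have "filtered_group G (commutator_filtration N) (2 ^ m)"
  proof (intro filtered_group.intro filtered_group_axioms.intro sub commutator_filtration_Suc[OF N(1)]
      commutator_filtration_commutator[OF N(1)] is_group commutator_filtration_0)
    have "commutator_filtration N (2 ^ m) \<subseteq> {\<one>}"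
      using commutator_filtration_subset_lower_central[OF N(1) H(1) N(2), of m "2 ^ m"] m by simp
    then show "commutator_filtration N (2 ^ m) = {\<one>}" using subgroup.one_closed[OF sub] by blast
  qed
  then show ?thesis using that[of "2 ^ m"] by simp
qed

end

section \<open>Powers of a group and sequences of measures\<close>

context group
begin

text \<open>Countability is what makes all sets of tuples measurable below.\<close>

lemma countable_generate:
  assumes "finite S" "S \<subseteq> carrier G"
  shows "countable (generate G S)"
proof -
  let ?T = "S \<union> m_inv G ` S"
  let ?p = "\<lambda>xs. foldr (\<otimes>) xs \<one>"
  have T: "?T \<subseteq> carrier G" using assms(2) by auto
  have pc: "?p xs \<in> carrier G" if "xs \<in> lists ?T" for xs
    using that T by (induction xs) auto
  have app: "?p (xs @ ys) = ?p xs \<otimes> ?p ys" if "xs \<in> lists ?T" "ys \<in> lists ?T" for xs ys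
    using that(1)
  proof (induction xs)
    case (Cons x xs)
    have "x \<in> carrier G" using Cons.hyps T by auto
    then show ?case using Cons pc[of xs] pc[OF that(2)] by (simp add: m_assoc)
  qed (use pc[OF that(2)] in simp)
  have "g \<in> ?p ` lists ?T" if "g \<in> generate G S" for g
    using that
  proof induction
    case one
    show ?case by (rule image_eqI[of _ _ "[]"]) auto
  next
    case (incl h)
    then show ?case using assms(2) by (intro image_eqI[of _ _ "[h]"]) auto
  next
    case (inv h)
    then show ?case using assms(2) by (intro image_eqI[of _ _ "[inv h]"]) auto
  next
    case (eng g h)
    then obtain xs ys where "xs \<in> lists ?T" "g = ?p xs" "ys \<in> lists ?T" "h = ?p ys" by blast
    then show ?case using app by (intro image_eqI[of _ _ "xs @ ys"]) auto
  qed
  moreover have "countable (?p ` lists ?T)"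
    using assms(1) by (intro countable_image countable_lists countable_finite) auto
  ultimately show ?thesis by (meson countable_subset subsetI)
qed

end

locale group_power = group G for G :: "('a, 'b) monoid_scheme" (structure) + fixes k :: nat
begin

abbreviation power_group :: "(nat \<Rightarrow> 'a) monoid" ("\<Gamma>") where
  "\<Gamma> \<equiv> product_group {..<k} (\<lambda>_. G)"

sublocale Gamma: group \<Gamma>
  by (rule product_group) (rule is_group)

definition coord :: "nat \<Rightarrow> 'a \<Rightarrow> nat \<Rightarrow> 'a" where
  "coord i x = (\<lambda>j\<in>{..<k}. if j = i then x else \<one>)"

lemma coord_hom: "coord i \<in> hom G \<Gamma>"
  by (auto simp: hom_def coord_def)

text \<open>\<open>x\<close> is the product of its coordinates \<open>coord i (x i)\<close>; the
  induction multiplies in one coordinate at a time.\<close>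

lemma mem_subgroup_of_coords:
  assumes K: "subgroup K \<Gamma>" and x: "x \<in> carrier \<Gamma>" and c: "\<And>i. i < k \<Longrightarrow> coord i (x i) \<in> K"
  shows "x \<in> K"
proof -
  have "(\<lambda>j\<in>{..<k}. if j < m then x j else \<one>) \<in> K" if "m \<le> k" for m
    using that
  proof (induction m)
    case 0
    then show ?case using subgroup.one_closed[OF K] by (simp add: restrict_def)
  next
    case (Suc m)
    have "(\<lambda>j\<in>{..<k}. if j < m then x j else \<one>) \<otimes>\<^bsub>\<Gamma>\<^esub> coord m (x m) \<in> K"
      by (rule subgroup.m_closed[OF K Suc.IH c]) (use Suc.prems in auto)
    moreover have "(\<lambda>j\<in>{..<k}. if j < m then x j else \<one>) \<otimes>\<^bsub>\<Gamma>\<^esub> coord m (x m) =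
        (\<lambda>j\<in>{..<k}. if j < Suc m then x j else \<one>)"
      using x Suc.prems by (auto simp: coord_def PiE_iff less_Suc_eq fun_eq_iff)
    ultimately show ?case by (simp only:)
  qed
  from this[OF order.refl] have "(\<lambda>j\<in>{..<k}. if j < k then x j else \<one>) \<in> K" .
  moreover have "(\<lambda>j\<in>{..<k}. if j < k then x j else \<one>) = x"
    using x by (auto simp: fun_eq_iff PiE_iff extensional_def)
  ultimately show ?thesis by (simp only:)
qed

lemma finitely_generated_power:
  assumes "finite S" "S \<subseteq> carrier G" "generate G S = carrier G"
  obtains T where "finite T" "T \<subseteq> carrier \<Gamma>" "generate \<Gamma> T = carrier \<Gamma>"
proof
  define T where "T = (\<Union>i\<in>{..<k}. coord i ` S)"
  have ch: "coord i x \<in> carrier \<Gamma>" if "x \<in> carrier G" for i x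
    using hom_carrier[OF coord_hom] that by blast
  show "finite T" using assms by (simp add: T_def)
  show T: "T \<subseteq> carrier \<Gamma>" using ch assms(2) unfolding T_def by blast
  show "generate \<Gamma> T = carrier \<Gamma>"
  proof
    show "generate \<Gamma> T \<subseteq> carrier \<Gamma>" by (rule Gamma.generate_incl[OF T])
    show "carrier \<Gamma> \<subseteq> generate \<Gamma> T"
    proof
      fix x assume x: "x \<in> carrier \<Gamma>"
      show "x \<in> generate \<Gamma> T"
      proof (rule mem_subgroup_of_coords[OF Gamma.generate_is_subgroup[OF T] x])
        fix i assume i: "i < k"
        interpret h: group_hom G \<Gamma> "coord i"
          by (intro group_hom.intro group_hom_axioms.intro is_group Gamma.is_group coord_hom)
        have "x i \<in> generate G S" using x i assms(3) by auto
        then have "coord i (x i) \<in> generate \<Gamma> (coord i ` S)"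
          using h.generate_img[OF assms(2)] by blast
        moreover have "generate \<Gamma> (coord i ` S) \<subseteq> generate \<Gamma> T"
          by (rule Gamma.mono_generate) (use i in \<open>auto simp: T_def\<close>)
        ultimately show "coord i (x i) \<in> generate \<Gamma> T" by blast
      qed
    qed
  qed
qed

lemma power_l_coset:
  assumes "L \<subseteq> carrier G" "x \<in> carrier \<Gamma>"
  shows "x <#\<^bsub>\<Gamma>\<^esub> (\<Pi>\<^sub>E i\<in>{..<k}. L) = (\<Pi>\<^sub>E i\<in>{..<k}. x i <# L)"
proof
  show "x <#\<^bsub>\<Gamma>\<^esub> (\<Pi>\<^sub>E i\<in>{..<k}. L) \<subseteq> (\<Pi>\<^sub>E i\<in>{..<k}. x i <# L)"
    by (auto simp: l_coset_def PiE_iff)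
  show "(\<Pi>\<^sub>E i\<in>{..<k}. x i <# L) \<subseteq> x <#\<^bsub>\<Gamma>\<^esub> (\<Pi>\<^sub>E i\<in>{..<k}. L)"
  proof
    fix y assume y: "y \<in> (\<Pi>\<^sub>E i\<in>{..<k}. x i <# L)"
    then have "\<forall>i\<in>{..<k}. \<exists>l\<in>L. y i = x i \<otimes> l" by (auto simp: l_coset_def PiE_iff)
    then obtain l where l: "\<forall>i\<in>{..<k}. l i \<in> L \<and> y i = x i \<otimes> l i" by metis
    have "y = x \<otimes>\<^bsub>\<Gamma>\<^esub> restrict l {..<k}"
      using y l by (auto simp: fun_eq_iff PiE_iff extensional_def)
    moreover have "restrict l {..<k} \<in> (\<Pi>\<^sub>E i\<in>{..<k}. L)" using l by auto
    ultimately show "y \<in> x <#\<^bsub>\<Gamma>\<^esub> (\<Pi>\<^sub>E i\<in>{..<k}. L)" unfolding l_coset_def by blast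
  qed
qed

lemma subgroup_power: "subgroup L G \<Longrightarrow> subgroup (\<Pi>\<^sub>E i\<in>{..<k}. L) \<Gamma>"
  by (subst PiE_subgroup_product_group) (auto simp: is_group)

lemma lcosets_power_subset:
  assumes "L \<subseteq> carrier G"
  shows "lcosets\<^bsub>\<Gamma>\<^esub> (\<Pi>\<^sub>E i\<in>{..<k}. L) \<subseteq> PiE {..<k} ` (\<Pi>\<^sub>E i\<in>{..<k}. lcosets L)"
proof
  fix c assume "c \<in> lcosets\<^bsub>\<Gamma>\<^esub> (\<Pi>\<^sub>E i\<in>{..<k}. L)"
  then obtain x where x: "x \<in> carrier \<Gamma>" "c = x <#\<^bsub>\<Gamma>\<^esub> (\<Pi>\<^sub>E i\<in>{..<k}. L)" by (auto simp: LCOSETS_def)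
  have "c = PiE {..<k} (\<lambda>i\<in>{..<k}. x i <# L)"
    unfolding x(2) power_l_coset[OF assms x(1)] by (rule PiE_cong) simp
  moreover have "(\<lambda>i\<in>{..<k}. x i <# L) \<in> (\<Pi>\<^sub>E i\<in>{..<k}. lcosets L)"
    using x(1) by (auto simp: LCOSETS_def)
  ultimately show "c \<in> PiE {..<k} ` (\<Pi>\<^sub>E i\<in>{..<k}. lcosets L)" by blast
qed

text \<open>The upper bound on the index is the direction that \<open>dens_coset\<close> calls
  for.\<close>

lemma finite_index_power:
  assumes "finite_index_subgroup L G"
  shows "finite_index_subgroup (\<Pi>\<^sub>E i\<in>{..<k}. L) \<Gamma>"
    and "card (lcosets\<^bsub>\<Gamma>\<^esub> (\<Pi>\<^sub>E i\<in>{..<k}. L)) \<le> card (lcosets L) ^ k"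
proof -
  have L: "subgroup L G" "finite (lcosets L)" using assms by (auto simp: finite_index_subgroup_def)
  note sub = lcosets_power_subset[OF subgroup.subset[OF L(1)]]
  have fin: "finite (\<Pi>\<^sub>E i\<in>{..<k}. lcosets L)" using L(2) by (intro finite_PiE) auto
  show "finite_index_subgroup (\<Pi>\<^sub>E i\<in>{..<k}. L) \<Gamma>"
    using subgroup_power[OF L(1)] finite_subset[OF sub] fin by (simp add: finite_index_subgroup_def)
  have "card (lcosets\<^bsub>\<Gamma>\<^esub> (\<Pi>\<^sub>E i\<in>{..<k}. L)) \<le> card (PiE {..<k} ` (\<Pi>\<^sub>E i\<in>{..<k}. lcosets L))"
    using fin by (intro card_mono sub) auto
  also have "\<dots> \<le> card (\<Pi>\<^sub>E i\<in>{..<k}. lcosets L)" by (rule card_image_le[OF fin])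
  also have "\<dots> = card (lcosets L) ^ k" by (simp add: card_PiE)
  finally show "card (lcosets\<^bsub>\<Gamma>\<^esub> (\<Pi>\<^sub>E i\<in>{..<k}. L)) \<le> card (lcosets L) ^ k" .
qed

lemma normal_power:
  assumes "L \<lhd> G"
  shows "(\<Pi>\<^sub>E i\<in>{..<k}. L) \<lhd> \<Gamma>"
proof (rule Gamma.normal_invI[OF subgroup_power[OF normal_imp_subgroup[OF assms]]])
  fix x h assume x: "x \<in> carrier \<Gamma>" and h: "h \<in> (\<Pi>\<^sub>E i\<in>{..<k}. L)"
  have "inv\<^bsub>\<Gamma>\<^esub> x = (\<lambda>i\<in>{..<k}. inv x i)" using x by (subst inv_product_group) (auto simp: is_group)
  moreover have "x i \<otimes> h i \<otimes> inv x i \<in> L" if "i < k" for i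
    using normal.inv_op_closed2[OF assms, of "x i" "h i"] x h that by auto
  ultimately show "x \<otimes>\<^bsub>\<Gamma>\<^esub> h \<otimes>\<^bsub>\<Gamma>\<^esub> inv\<^bsub>\<Gamma>\<^esub> x \<in> (\<Pi>\<^sub>E i\<in>{..<k}. L)" by auto
qed

text \<open>Limits of measures are known only for boxes, that is, for cosets of powers of
  \<open>L\<close>. Pulling \<open>K\<close> back along the coordinate embeddings and taking a
  normal core of the intersection gives \<open>L\<close>; a tuple from \<open>L\<close> is a product
  of coordinates lying in \<open>K\<close>.\<close>

lemma finite_index_power_contains:
  assumes K: "finite_index_subgroup K \<Gamma>"
  obtains L where "L \<lhd> G" "finite_index_subgroup L G" "(\<Pi>\<^sub>E i\<in>{..<k}. L) \<subseteq> K"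
proof -
  have subK: "subgroup K \<Gamma>" and finK: "finite (lcosets\<^bsub>\<Gamma>\<^esub> K)"
    using K by (auto simp: finite_index_subgroup_def)
  define P where "P i = {x \<in> carrier G. coord i x \<in> K}" for i
  have "finite_index_subgroup (P i) G" for i
  proof -
    interpret h: group_hom G \<Gamma> "coord i"
      by (intro group_hom.intro group_hom_axioms.intro is_group Gamma.is_group coord_hom)
    show ?thesis
    proof (rule finite_index_subgroupI[where f = "\<lambda>x. coord i x <#\<^bsub>\<Gamma>\<^esub> K"])
      show "subgroup (P i) G"
      proof (rule subgroupI)
        show "P i \<noteq> {}" using h.hom_one subgroup.one_closed[OF subK]
            by (auto simp: P_def simp del: one_product_group)
        fix a assume a: "a \<in> P i"
        have "inv\<^bsub>\<Gamma>\<^esub> coord i a \<in> K" using a subgroup.m_inv_closed[OF subK] by (simp add: P_def)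
        then show "inv a \<in> P i" using a h.hom_inv[of a] by (simp add: P_def)
        fix b assume b: "b \<in> P i"
        have "coord i a \<otimes>\<^bsub>\<Gamma>\<^esub> coord i b \<in> K" using a b subgroup.m_closed[OF subK] by (simp add: P_def)
        then show "a \<otimes> b \<in> P i" using a b h.hom_mult[of a b] by (simp add: P_def)
      qed (auto simp: P_def)
      have "(\<lambda>x. coord i x <#\<^bsub>\<Gamma>\<^esub> K) ` carrier G \<subseteq> lcosets\<^bsub>\<Gamma>\<^esub> K"
        using h.hom_closed by (auto simp: LCOSETS_def)
      then show "finite ((\<lambda>x. coord i x <#\<^bsub>\<Gamma>\<^esub> K) ` carrier G)" by (rule finite_subset) (rule finK)
      fix a b assume ab: "a \<in> carrier G" "b \<in> carrier G" "coord i a <#\<^bsub>\<Gamma>\<^esub> K = coord i b <#\<^bsub>\<Gamma>\<^esub> K"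
      then have "inv\<^bsub>\<Gamma>\<^esub> coord i a \<otimes>\<^bsub>\<Gamma>\<^esub> coord i b \<in> K"
        using Gamma.lcoset_eq_iff[OF subK h.hom_closed h.hom_closed] by blast
      moreover have "coord i (inv a \<otimes> b) = inv\<^bsub>\<Gamma>\<^esub> coord i a \<otimes>\<^bsub>\<Gamma>\<^esub> coord i b"
        using h.hom_mult[of "inv a" b] h.hom_inv[of a] ab by simp
      ultimately show "inv a \<otimes> b \<in> P i" using ab by (simp add: P_def)
    qed
  qed
  then have "finite_index_subgroup {a \<in> carrier G. \<forall>i\<in>{..<k}. a \<in> P i} G"
    by (intro finite_index_INT) auto
  then obtain L where L: "L \<subseteq> {a \<in> carrier G. \<forall>i\<in>{..<k}. a \<in> P i}" "L \<lhd> G" "finite_index_subgroup L G"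
    by (rule finite_index_normal_core)
  have "x \<in> K" if x: "x \<in> (\<Pi>\<^sub>E i\<in>{..<k}. L)" for x
  proof (rule mem_subgroup_of_coords[OF subK])
    show "x \<in> carrier \<Gamma>" using x L(1) by (auto simp: PiE_iff)
    show "coord i (x i) \<in> K" if "i < k" for i
      using L(1) x that by (auto simp: PiE_iff P_def subset_iff)
  qed
  then show ?thesis using that L by blast
qed

text \<open>The difference of \<open>x i \<otimes> y i\<close> along \<open>h\<close> is the
  constant \<open>h i\<close> in \<open>F 1\<close>, so each variable is polynomial of level 0, as
  is each constant. Words arise from these by products and inverses.\<close>

lemma filtered_poly_word:
  assumes F: "filtered_group G F c" and x: "x \<in> carrier \<Gamma>" and w: "w \<in> words G k"
  shows "filtered_maps.filtered_poly \<Gamma> (\<Pi>\<^sub>E i\<in>{..<k}. F 1) G F 0 (\<lambda>y. eval_word G (\<lambda>i. x i \<otimes> y i) w)"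
proof -
  interpret F: filtered_group G F c by fact
  let ?H = "\<Pi>\<^sub>E i\<in>{..<k}. F 1"
  interpret filtered_maps \<Gamma> ?H G F c
    by (intro filtered_maps.intro poly_domain.intro poly_domain_axioms.intro F Gamma.is_group
        subgroup_power F.subgroup_F)
  have xc: "x i \<in> carrier G" if "i < k" for i using x that by auto
  have yc: "y i \<in> F 1" "y i \<in> carrier G" if "y \<in> ?H" "i < k" for y i
    using that F.F_carrier by auto
  have var: "filtered_poly 0 (\<lambda>y. x i \<otimes> y i)" if i: "i < k" for i
  proof (rule filtered_poly.intros)
    show "x i \<otimes> y i \<in> F 0" if "y \<in> ?H" for y using xc[OF i] yc[OF that i] by (simp add: F.F_0)
    fix h assume h: "h \<in> ?H"
    have "filtered_poly (Suc 0) (\<lambda>_. h i)"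
      by (rule filtered_poly_const) (use yc[OF h i] in simp)
    then show "filtered_poly (Suc 0) (difference \<Gamma> G h (\<lambda>y. x i \<otimes> y i))"
      by (rule filtered_poly_cong) (use xc[OF i] yc[OF _ i] h i in \<open>simp add: difference_def
          word_simps\<close>)
  qed
  show ?thesis using w
  proof (induction w)
    case Nil
    show ?case by (rule filtered_poly_one) (simp add: eval_word_def)
  next
    case (Cons l w)
    have IH: "filtered_poly 0 (\<lambda>y. eval_word G (\<lambda>i. x i \<otimes> y i) w)"
      using Cons by (simp add: words_def)
    have "filtered_poly 0 (\<lambda>y. eval_letter G (\<lambda>i. x i \<otimes> y i) l)"
    proof (cases l)
      case (Var i)
      then show ?thesis using var Cons.prems by (auto simp: words_def)
    next
      case (VarInv i)
      then show ?thesis using filtered_poly_inv[OF var[of i]] Cons.prems by (auto simp: words_def)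
    next
      case (Const a)
      then show ?thesis using Cons.prems filtered_poly_const[of a 0] by (auto simp: words_def F.F_0)
    qed
    from filtered_poly_mult[OF this IH] show ?case by (simp add: eval_word_def)
  qed
qed

end

lemma eval_word_cong_vars:
  assumes "w \<in> words G k" "\<And>i. i < k \<Longrightarrow> g i = h i"
  shows "eval_word G g w = eval_word G h w"
  using assms(1)
proof (induction w)
  case (Cons l w)
  then have "eval_word G g w = eval_word G h w" "eval_letter G g l = eval_letter G h l"
    using assms(2) by (auto simp: words_def)
  then show ?case by (simp add: eval_word_def)
qed (simp add: eval_word_def)

section \<open>Product measures, the density of sets of tuples, and the two implications\<close>

locale index_measures = group_power G k for G :: "('a, 'b) monoid_scheme" (structure) and k +
  fixes M :: "nat \<Rightarrow> 'a measure" and S0 :: "'a set"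
  assumes S0: "finite S0" "S0 \<subseteq> carrier G" "generate G S0 = carrier G"
    and M: "\<And>n. prob_measure_on G (M n)"
    and measures_index: "measures_index_uniformly G M"
begin

definition \<nu> :: "nat \<Rightarrow> (nat \<Rightarrow> 'a) measure" where
  "\<nu> n = (\<Pi>\<^sub>M i\<in>{..<k}. M n)"

text \<open>The limsup lies between 0 and 1 for every \<open>T\<close>, so the conversion from
  extended reals loses nothing.\<close>

definition dens :: "(nat \<Rightarrow> 'a) set \<Rightarrow> real" where
  "dens T = real_of_ereal (limsup (\<lambda>n. ereal (measure (\<nu> n) T)))"

lemma M_props: "prob_space (M n)" "space (M n) = carrier G" "sets (M n) = Pow (carrier G)"
  using M[of n] by (auto simp: prob_measure_on_def)

lemma prob_space_\<nu>: "prob_space (\<nu> n)"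
  unfolding \<nu>_def by (rule prob_space_PiM) (rule M_props)

text \<open>The power group is countable and its singletons are boxes.\<close>

lemma measurable_\<nu>:
  assumes "T \<subseteq> carrier \<Gamma>"
  shows "T \<in> sets (\<nu> n)"
proof (rule sets.countable)
  have "countable (carrier G)" using countable_generate[OF S0(1,2)] S0(3) by simp
  then have "countable (carrier \<Gamma>)" by (simp add: countable_PiE)
  then show "countable T" using assms countable_subset by blast
  fix x assume "x \<in> T"
  then have x: "x \<in> carrier \<Gamma>" using assms by auto
  have "{x} = (\<Pi>\<^sub>E i\<in>{..<k}. {x i})"
    using x by (intro PiE_singleton[symmetric]) (auto simp: PiE_iff)
  also have "\<dots> \<in> sets (\<nu> n)"
    unfolding \<nu>_def by (rule sets_PiM_I_finite) (use x M_props in auto)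
  finally show "{x} \<in> sets (\<nu> n)" .
qed

lemma measure_\<nu>_PiE:
  assumes "\<And>i. i < k \<Longrightarrow> A i \<subseteq> carrier G"
  shows "measure (\<nu> n) (\<Pi>\<^sub>E i\<in>{..<k}. A i) = (\<Prod>i<k. measure (M n) (A i))"
proof -
  interpret product_sigma_finite "\<lambda>_. M n"
    by (intro product_sigma_finite.intro prob_space_imp_sigma_finite M_props)
  have "emeasure (\<nu> n) (\<Pi>\<^sub>E i\<in>{..<k}. A i) = (\<Prod>i<k. emeasure (M n) (A i))"
    unfolding \<nu>_def by (rule emeasure_PiM) (use assms M_props in auto)
  also have "\<dots> = ennreal (\<Prod>i<k. measure (M n) (A i))"
    by (simp add: finite_measure.emeasure_eq_measure[OF prob_space.finite_measure[OF M_props(1)]]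
        prod_ennreal)
  finally show ?thesis by (simp add: measure_def prod_nonneg)
qed

lemma measure_M_tendsto:
  assumes "subgroup H G" "x \<in> carrier G"
  shows "(\<lambda>n. measure (M n) (x <# H)) \<longlonglongrightarrow> inverse_index G H"
  using tendsto_uniform_limitI[OF measures_index[unfolded measures_index_uniformly_def], of "(x,
      H)"] assms
  by simp

lemma measure_\<nu>_coset_tendsto:
  assumes "finite_index_subgroup H G" "x \<in> carrier \<Gamma>"
  shows "(\<lambda>n. measure (\<nu> n) (\<Pi>\<^sub>E i\<in>{..<k}. x i <# H)) \<longlonglongrightarrow> (1 / card (lcosets H)) ^ k"
proof -
  have H: "subgroup H G" "finite (lcosets H)" using assms(1) by (auto simp: finite_index_subgroup_def)
  have "(\<lambda>n. \<Prod>i<k. measure (M n) (x i <# H)) \<longlonglongrightarrow> (\<Prod>i<k. inverse_index G H)"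
    by (intro tendsto_prod measure_M_tendsto H) (use assms(2) in auto)
  moreover have "measure (\<nu> n) (\<Pi>\<^sub>E i\<in>{..<k}. x i <# H) = (\<Prod>i<k. measure (M n) (x i <# H))" for n
    by (rule measure_\<nu>_PiE) (use assms(2) l_coset_subset_G[OF subgroup.subset[OF H(1)]] in auto)
  ultimately show ?thesis using H(2) by (simp add: inverse_index_def)
qed

lemma limsup_measure: "limsup (\<lambda>n. ereal (measure (\<nu> n) T)) = ereal (dens T)"
proof -
  have "0 \<le> limsup (\<lambda>n. ereal (measure (\<nu> n) T))"
    by (rule le_Limsup) auto
  moreover have "limsup (\<lambda>n. ereal (measure (\<nu> n) T)) \<le> 1"
    by (rule Limsup_bounded) (use prob_space.prob_le_1[OF prob_space_\<nu>] in auto)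
  ultimately show ?thesis unfolding dens_def
    by (cases "limsup (\<lambda>n. ereal (measure (\<nu> n) T))") auto
qed

lemma dens_eqI: "(\<lambda>n. measure (\<nu> n) T) \<longlonglongrightarrow> r \<Longrightarrow> dens T = r"
  using lim_imp_Limsup[of sequentially "\<lambda>n. ereal (measure (\<nu> n) T)" "ereal r"]
  by (simp add: dens_def)

sublocale upper_density \<Gamma> dens
proof
  show "0 \<le> dens T" for T
  proof -
    have "0 \<le> limsup (\<lambda>n. ereal (measure (\<nu> n) T))" by (rule le_Limsup) auto
    then show ?thesis by (simp add: limsup_measure)
  qed
  show "dens {} = 0" by (rule dens_eqI) simp
  show "dens A \<le> dens B" if "A \<subseteq> B" "B \<subseteq> carrier \<Gamma>" for A B
  proof -
    have "measure (\<nu> n) A \<le> measure (\<nu> n) B" for n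
      by (rule finite_measure.finite_measure_mono[OF prob_space.finite_measure[OF prob_space_\<nu>]
          that(1) measurable_\<nu>[OF that(2)]])
    then have "limsup (\<lambda>n. ereal (measure (\<nu> n) A)) \<le> limsup (\<lambda>n. ereal (measure (\<nu> n) B))"
      by (intro Limsup_mono) auto
    then show ?thesis by (simp add: limsup_measure)
  qed
  show "dens (A \<union> B) \<le> dens A + dens B" if "A \<subseteq> carrier \<Gamma>" "B \<subseteq> carrier \<Gamma>" for A B
  proof -
    have "measure (\<nu> n) (A \<union> B) \<le> measure (\<nu> n) A + measure (\<nu> n) B" for n
      by (rule measure_Un_le[OF measurable_\<nu>[OF that(1)] measurable_\<nu>[OF that(2)]])
    then have "limsup (\<lambda>n. ereal (measure (\<nu> n) (A \<union> B)))
        \<le> limsup (\<lambda>n. ereal (measure (\<nu> n) A) + ereal (measure (\<nu> n) B))"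
      by (intro Limsup_mono) auto
    also have "\<dots> \<le> limsup (\<lambda>n. ereal (measure (\<nu> n) A)) + limsup (\<lambda>n. ereal (measure (\<nu> n) B))"
      by (rule ereal_limsup_add_mono)
    finally show ?thesis by (simp add: limsup_measure)
  qed
  fix K assume "finite_index_subgroup K \<Gamma>"
  then obtain L where L: "L \<lhd> G" "finite_index_subgroup L G" "(\<Pi>\<^sub>E i\<in>{..<k}. L) \<subseteq> K"
    by (rule finite_index_power_contains)
  have Lsub: "subgroup L G" "finite (lcosets L)" using L(2) by (auto simp: finite_index_subgroup_def)
  have "lcosets L \<noteq> {}" by (auto simp: LCOSETS_def)
  then have pos: "card (lcosets L) > 0" using Lsub(2) by (simp add: card_gt_0_iff)
  have "dens (x <#\<^bsub>\<Gamma>\<^esub> (\<Pi>\<^sub>E i\<in>{..<k}. L)) * card (lcosets\<^bsub>\<Gamma>\<^esub> (\<Pi>\<^sub>E i\<in>{..<k}. L)) \<le> 1"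
    if x: "x \<in> carrier \<Gamma>" for x
  proof -
    have "dens (x <#\<^bsub>\<Gamma>\<^esub> (\<Pi>\<^sub>E i\<in>{..<k}. L)) = (1 / card (lcosets L)) ^ k"
      unfolding power_l_coset[OF subgroup.subset[OF Lsub(1)] x]
      by (rule dens_eqI[OF measure_\<nu>_coset_tendsto[OF L(2) x]])
    moreover have "real (card (lcosets\<^bsub>\<Gamma>\<^esub> (\<Pi>\<^sub>E i\<in>{..<k}. L))) \<le> real (card (lcosets L)) ^ k"
      using finite_index_power(2)[OF L(2)] by (metis of_nat_le_iff of_nat_power)
    moreover have "real (card (lcosets L)) ^ k > 0" using pos by simp
    ultimately show ?thesis unfolding power_one_over
        by (simp only: divide_le_eq_1_pos mult_1 times_divide_eq_left)
  qed
  then show "\<exists>L. L \<subseteq> K \<and> L \<lhd> \<Gamma> \<and> finite_index_subgroup L \<Gamma> \<and>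
      (\<forall>x\<in>carrier \<Gamma>. dens (x <#\<^bsub>\<Gamma>\<^esub> L) * real (card (lcosets\<^bsub>\<Gamma>\<^esub> L)) \<le> 1)"
    using L(3) normal_power[OF L(1)] finite_index_power(1)[OF L(2)] by blast
qed

context
  fixes \<phi> w
  assumes w: "w \<in> words G k" and \<phi>: "\<phi> = word_rel G k `` {w}"
begin

definition solutions :: "(nat \<Rightarrow> 'a) set" where
  "solutions = {g \<in> carrier \<Gamma>. eval_word G g w = \<one>}"

lemma eval_eqn_eq: "(\<And>i. i < k \<Longrightarrow> g i \<in> carrier G) \<Longrightarrow> eval_eqn G \<phi> g = eval_word G g w"
  unfolding \<phi> by (rule eval_eqn_class[OF is_group w])

lemma probabilistic_identity_iff: "probabilistic_identity G k \<phi> M \<longleftrightarrow> dens solutions > 0"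
proof -
  have "{g \<in> space (\<Pi>\<^sub>M i\<in>{..<k}. M n). eval_eqn G \<phi> g = \<one>} = solutions" for n
    using eval_eqn_eq by (auto simp: solutions_def space_PiM M_props PiE_iff)
  then have "eqn_prob G k \<phi> (M n) = measure (\<nu> n) solutions" for n
    by (simp add: eqn_prob_def \<nu>_def)
  then show ?thesis by (simp add: probabilistic_identity_def eqn_limsup_def limsup_measure)
qed

lemma coset_identity_imp_probabilistic_identity:
  assumes "coset_identity G k \<phi>"
  shows "probabilistic_identity G k \<phi> M"
proof -
  obtain H g where H: "finite_index_subgroup H G" and g: "\<And>i. i < k \<Longrightarrow> g i \<in> carrier G"
    and eq: "\<And>y. (\<forall>i<k. y i \<in> g i <# H) \<Longrightarrow> eval_eqn G \<phi> y = \<one>"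
    using assms unfolding coset_identity_def by blast
  have subH: "subgroup H G" "finite (lcosets H)" using H by (auto simp: finite_index_subgroup_def)
  have sub: "g i <# H \<subseteq> carrier G" if "i < k" for i
    using l_coset_subset_G[OF subgroup.subset[OF subH(1)] g[OF that]] .
  \<comment> \<open>\<open>coset_identity\<close> leaves the values of \<open>g\<close> beyond
    \<open>k\<close> arbitrary, while elements of the power group are extensional.\<close>
  define x where "x = restrict g {..<k}"
  have x: "x \<in> carrier \<Gamma>" using g by (auto simp: x_def)
  have P: "(\<Pi>\<^sub>E i\<in>{..<k}. x i <# H) \<subseteq> solutions"
  proof
    fix y assume y: "y \<in> (\<Pi>\<^sub>E i\<in>{..<k}. x i <# H)"
    then have yi: "\<forall>i<k. y i \<in> g i <# H" by (auto simp: x_def PiE_iff)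
    then have "\<And>i. i < k \<Longrightarrow> y i \<in> carrier G" using sub by blast
    then show "y \<in> solutions"
      using eq[OF yi] eval_eqn_eq[of y] y by (auto simp: solutions_def PiE_iff)
  qed
  have "lcosets H \<noteq> {}" by (auto simp: LCOSETS_def)
  then have "0 < (1 / real (card (lcosets H))) ^ k" using subH(2) by (simp add: card_gt_0_iff)
  also have "\<dots> = dens (\<Pi>\<^sub>E i\<in>{..<k}. x i <# H)"
    by (rule dens_eqI[OF measure_\<nu>_coset_tendsto[OF H x], symmetric])
  also have "\<dots> \<le> dens solutions"
    by (rule dens_mono[OF P]) (auto simp: solutions_def)
  finally show ?thesis using probabilistic_identity_iff by simp
qed

lemma probabilistic_identity_imp_coset_identity:
  assumes vn: "virtually_nilpotent G" and prob: "probabilistic_identity G k \<phi> M"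
  shows "coset_identity G k \<phi>"
proof -
  obtain H where H: "finite_index_subgroup H G" "nilpotent_group (G\<lparr>carrier := H\<rparr>)"
    using vn by (auto simp: virtually_nilpotent_def)
  \<comment> \<open>The filtration needs a normal subgroup. Its length is bounded by the lower
    central series of \<open>H\<close>, so nilpotency of \<open>N\<close> itself is never
    established separately.\<close>
  obtain N where N: "N \<subseteq> H" "N \<lhd> G" "finite_index_subgroup N G"
    by (rule finite_index_normal_core[OF H(1)])
  obtain c where c: "0 < c" "filtered_group G (commutator_filtration N) c"
    by (rule filtered_group_commutator_filtration[OF _ H(2) N(2,1)])
      (use H(1) in \<open>auto simp: finite_index_subgroup_def\<close>)
  define F where "F = commutator_filtration N"
  have F: "filtered_group G F c" and F1: "F 1 = N" using c(2) by (simp_all add: F_def)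
  interpret F: filtered_group G F c by (rule F)
  define H0 where "H0 = (\<Pi>\<^sub>E i\<in>{..<k}. F 1)"
  have H0: "finite_index_subgroup H0 \<Gamma>"
    unfolding H0_def F1 by (rule finite_index_power(1)[OF N(3)])
  have subH0: "subgroup H0 \<Gamma>" using H0 by (simp add: finite_index_subgroup_def)
  have pos: "dens solutions > 0" using prob probabilistic_identity_iff by simp
  have sol: "solutions \<subseteq> carrier \<Gamma>" by (auto simp: solutions_def)
  \<comment> \<open>The base point is itself a solution, so that \<open>f\<close> below takes the
    value \<open>\<one>\<close> at the unit.\<close>
  obtain s where s: "s \<in> solutions" "dens (solutions \<inter> (s <#\<^bsub>\<Gamma>\<^esub> H0)) > 0"
    by (rule dens_pos_coset[OF H0 sol pos])
  have sG: "s \<in> carrier \<Gamma>" using s sol by auto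
  define f where "f y = eval_word G (\<lambda>i. s i \<otimes> y i) w" for y
  interpret filtered_maps \<Gamma> H0 G F c
    by (intro filtered_maps.intro poly_domain.intro poly_domain_axioms.intro F Gamma.is_group subH0)
  have poly: "filtered_poly 0 f"
    using filtered_poly_word[OF F sG w] by (simp add: f_def[abs_def] H0_def)
  have deg: "degree_less \<Gamma> H0 G c f" using degree_less_filtered_poly[OF poly] by simp
  have feval: "f y = eval_word G (s \<otimes>\<^bsub>\<Gamma>\<^esub> y) w" for y
    unfolding f_def by (rule eval_word_cong_vars[OF w]) simp
  have oneH: "\<one>\<^bsub>\<Gamma>\<^esub> \<in> H0" by (rule subgroup.one_closed[OF subH0])
  have f1: "f \<one>\<^bsub>\<Gamma>\<^esub> = \<one>"
    using s(1) Gamma.r_one[OF sG] by (simp add: feval solutions_def del: one_product_group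
        mult_product_group)
  have H0c: "y \<in> carrier \<Gamma>" if "y \<in> H0" for y using subgroup.subset[OF subH0] that by blast
  \<comment> \<open>From the trivial value at the unit, \<open>f y\<close> is a single difference of
    a map of level 0, hence lies in \<open>F 1\<close>. This is the first term from which the
    quotients are abelian.\<close>
  have fF: "f y \<in> F 1" if y: "y \<in> H0" for y
  proof -
    have "f (\<one>\<^bsub>\<Gamma>\<^esub> \<otimes>\<^bsub>\<Gamma>\<^esub> y) = f \<one>\<^bsub>\<Gamma>\<^esub> \<otimes> difference \<Gamma> G y f \<one>\<^bsub>\<Gamma>\<^esub>"
      by (rule filtered_poly_step(3)[OF poly oneH y])
    then have "f y = \<one> \<otimes> difference \<Gamma> G y f \<one>\<^bsub>\<Gamma>\<^esub>"
      unfolding f1 Gamma.l_one[OF H0c[OF y]] .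
    moreover have "difference \<Gamma> G y f \<one>\<^bsub>\<Gamma>\<^esub> \<in> F 1"
      using filtered_polyD(1)[OF filtered_polyD(2)[OF poly y] oneH] by simp
    ultimately show ?thesis using F.F_carrier by simp
  qed
  obtain S1 where S1: "finite S1" "S1 \<subseteq> carrier \<Gamma>" "generate \<Gamma> S1 = carrier \<Gamma>"
    by (rule finitely_generated_power[OF S0])
  interpret fg: upper_density_fg \<Gamma> dens S1
    by (intro upper_density_fg.intro upper_density_fg_axioms.intro upper_density_axioms S1)
  have "solutions \<inter> (s <#\<^bsub>\<Gamma>\<^esub> H0) \<subseteq> {s \<otimes>\<^bsub>\<Gamma>\<^esub> y | y. y \<in> H0 \<and> f y = \<one>}"
  proof
    fix z assume z: "z \<in> solutions \<inter> (s <#\<^bsub>\<Gamma>\<^esub> H0)"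
    then obtain y where y: "y \<in> H0" "z = s \<otimes>\<^bsub>\<Gamma>\<^esub> y" unfolding l_coset_def by blast
    moreover have "eval_word G z w = \<one>" using z by (simp add: solutions_def)
    ultimately show "z \<in> {s \<otimes>\<^bsub>\<Gamma>\<^esub> y | y. y \<in> H0 \<and> f y = \<one>}" using feval[of y] by auto
  qed
  from fg.nilpotent_zero_coset[OF F zero_less_one _ H0 _ deg sG this s(2)]
  obtain y K where yK: "y \<in> H0" "finite_index_subgroup K \<Gamma>" "\<And>k. k \<in> K \<Longrightarrow> f (y \<otimes>\<^bsub>\<Gamma>\<^esub> k) = \<one>"
    using c(1) fF by (auto simp del: mult_product_group)
  obtain L where L: "L \<lhd> G" "finite_index_subgroup L G" "(\<Pi>\<^sub>E i\<in>{..<k}. L) \<subseteq> K"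
    by (rule finite_index_power_contains[OF yK(2)])
  have Lsub: "subgroup L G" by (rule normal_imp_subgroup[OF L(1)])
  define g where "g = s \<otimes>\<^bsub>\<Gamma>\<^esub> y"
  have gG: "g \<in> carrier \<Gamma>" unfolding g_def by (rule Gamma.m_closed[OF sG H0c[OF yK(1)]])
  have gi: "g i \<in> carrier G" if "i < k" for i using gG that by auto
  have "eval_eqn G \<phi> z = \<one>" if z: "\<forall>i<k. z i \<in> g i <# L" for z
  proof -
    have zi: "z i \<in> carrier G" if "i < k" for i
      using z that l_coset_subset_G[OF subgroup.subset[OF Lsub] gi[OF that]] by blast
    define z' where "z' = restrict z {..<k}"
    have "z' \<in> (\<Pi>\<^sub>E i\<in>{..<k}. g i <# L)" using z by (auto simp: z'_def)
    then have "z' \<in> g <#\<^bsub>\<Gamma>\<^esub> (\<Pi>\<^sub>E i\<in>{..<k}. L)"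
      using power_l_coset[OF subgroup.subset[OF Lsub] gG] by simp
    then obtain l where l: "l \<in> (\<Pi>\<^sub>E i\<in>{..<k}. L)" "z' = g \<otimes>\<^bsub>\<Gamma>\<^esub> l" unfolding l_coset_def by blast
    have lK: "l \<in> K" using l(1) L(3) by blast
    have lG: "l \<in> carrier \<Gamma>"
      using lK subgroup.subset[of K \<Gamma>] yK(2) unfolding finite_index_subgroup_def by blast
    have "z' = s \<otimes>\<^bsub>\<Gamma>\<^esub> (y \<otimes>\<^bsub>\<Gamma>\<^esub> l)"
      unfolding l(2) g_def by (rule Gamma.m_assoc[OF sG H0c[OF yK(1)] lG])
    then have "eval_word G z' w = \<one>" using yK(3)[OF lK] feval[of "y \<otimes>\<^bsub>\<Gamma>\<^esub> l"] by simp
    moreover have "eval_word G z' w = eval_word G z w"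
      by (rule eval_word_cong_vars[OF w]) (simp add: z'_def)
    ultimately show ?thesis using eval_eqn_eq[OF zi] by simp
  qed
  then show ?thesis unfolding coset_identity_def using L(2) gi by blast
qed

end

end

theorem corollary1p18:
  fixes G :: "('a, 'b) monoid_scheme" and M :: "nat \<Rightarrow> 'a measure"
    and k :: nat and \<phi> :: "'a letter list set"
  assumes "group G"
    and "finitely_generated G"
    and "virtually_nilpotent G"
    and "\<And>n. prob_measure_on G (M n)"
    and "measures_index_uniformly G M"
    and "\<phi> \<in> carrier (free_prod G k)"
  shows "probabilistic_identity G k \<phi> M \<longleftrightarrow> coset_identity G k \<phi>"
proof -
  obtain S0 where S0: "finite S0" "S0 \<subseteq> carrier G" "generate G S0 = carrier G"
    using assms(2) by (auto simp: finitely_generated_def)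
  interpret index_measures G k M S0
    by (intro index_measures.intro group_power.intro index_measures_axioms.intro assms S0)
  obtain w where "w \<in> words G k" "\<phi> = word_rel G k `` {w}"
    using assms(6) by (auto simp: free_prod_def quotient_def)
  then show ?thesis
    using coset_identity_imp_probabilistic_identity probabilistic_identity_imp_coset_identity assms(3)
    by blast
qed

end
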